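(* Let $\mathcal T$ be a zonal integral operator on $\mathbb S^2$ with multipliers $(\mu_\ell)_{\ell\ge0}$, and assume there are constants $\beta,C_{\mathcal T},\delta>0$ with $|\mu_\ell|\le C_{\mathcal T}(1+\ell)^{-\beta}$ and $|1-\mu_\ell|\ge\delta$ for all $\ell\in\mathbb N_0$. Let $\{\mathcal Q_{N_n}\}_{n\ge1}$ be a family of positive quadrature rules on $\mathbb S^2$ such that $\mathcal Q_{N_n}$ is exact on $\mathbb P_{t_n}$ with $t_n\ge2n$, and set $s_n:=t_n-n$. Let $q\in\mathbb N_0$, $\star\in\{G,N\}$, $\varepsilon_G=0$, $\varepsilon_N=1$, and $\gamma_\star=(q+\varepsilon_\star)\beta$. If $r>1$, then there is a constant $C>0$ independent of $n$ and $f$ such that for all $f\in H^r(\mathbb S^2)$, with $u=(I-\mathcal T)^{-1}f$, $$\|u-\mathcal S_q(u_{n,\mathcal Q}^{\star})\|_{L^\infty(\mathbb S^2)}\le C\left(n^{-(r+\gamma_\star-1)}+\rho_{\gamma_\star}(n)\,s_n^{-r}\right)\|f\|_{H^r(\mathbb S^2)},$$ where $u_{n,\mathcal Q}^{G}$ and $u_{n,\mathcal Q}^{N}$ are the discrete Galerkin and product-integration Nyström solutions, and $\rho_\gamma(n)=n^{1-\gamma}$ for $0\le\gamma<1$, $\rho_1(n)=(\log(n+1))^{1/2}$, $\rho_\gamma(n)=1$ for $\gamma>1$.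
   Context: Functions on the unit sphere $\mathbb S^2\subset\mathbb R^3$ are real-valued; $\omega$ is surface measure with $\omega(\mathbb S^2)=4\pi$. $\{Y_{\ell,k}:\ell\in\mathbb N_0,\ 1\le k\le 2\ell+1\}$ is a real orthonormal basis of $L^2(\mathbb S^2)$ consisting of spherical harmonics ($Y_{\ell,k}$ of degree $\ell$), $\widehat v_{\ell,k}=\int_{\mathbb S^2}vY_{\ell,k}\,d\omega$, and $\mathbb P_n=\mathrm{span}\{Y_{\ell,k}:\ell\le n\}$. For $r\in\mathbb R$, $\|v\|_{H^r(\mathbb S^2)}^2=\sum_{\ell}(1+\ell(\ell+1))^r\sum_k|\widehat v_{\ell,k}|^2$; for $r>1$, $H^r(\mathbb S^2)\hookrightarrow C(\mathbb S^2)$. Zonal integral operator: $(\mathcal Tv)(x)=\int_{\mathbb S^2}\Phi(x\cdot y)v(y)\,d\omega(y)$ with real-valued $\Phi\in L^1(-1,1)$; then $\mathcal TY_{\ell,k}=\mu_\ell Y_{\ell,k}$ with $\mu_\ell=2\pi\int_{-1}^1\Phi(t)P_\ell(t)\,dt$, $P_\ell$ the Legendre polynomial. Equation and Sloan iteration: $u$ solves $(I-\mathcal T)u=f$. For an approximation $v$ to $u$: $\mathcal S_0(v)=v$, $\mathcal S_{q+1}(v)=f+\mathcal T\mathcal S_q(v)$. Positive quadrature rule: $\mathcal Q_{N_n}(g)=\sum_{j=1}^{N_n}w_{j,n}g(x_{j,n})$ with $x_{j,n}\in\mathbb S^2$, $w_{j,n}>0$; exactness on $\mathbb P_{t}$ means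 $\mathcal Q_{N_n}(p)=\int_{\mathbb S^2}p\,d\omega$ for all $p\in\mathbb P_{t}$. Hyperinterpolation: $\mathcal L_nv=\sum_{\ell=0}^n\sum_{k=1}^{2\ell+1}\mathcal Q_{N_n}(vY_{\ell,k})Y_{\ell,k}$ for $v\in C(\mathbb S^2)$. Discrete Galerkin solution: $u_{n,\mathcal Q}^G\in\mathbb P_n$ with $\mathcal Q_{N_n}\big(((I-\mathcal T)u_{n,\mathcal Q}^G)\,p\big)=\mathcal Q_{N_n}(fp)$ for all $p\in\mathbb P_n$. Product-integration Nyström solution: $u_{n,\mathcal Q}^N\in H^r(\mathbb S^2)$ with $(I-\mathcal T\mathcal L_n)u_{n,\mathcal Q}^N=f$. Under the stated hypotheses both exist and are unique. *)

theory Defs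
  imports "HOL-Analysis.Analysis" "HOL-Computational_Algebra.Polynomial"
    "HOL-Probability.Essential_Supremum"
begin

text \<open>
  Functions on the unit sphere are represented by functions on \<^typ>\<open>real^3\<close> whose values off the
  sphere are irrelevant: all the notions below depend only on the restriction to the sphere.
\<close>

abbreviation S2 :: "(real^3) set" where
  "S2 \<equiv> sphere 0 1"

text \<open>
  Surface measure via polar coordinates: the measure of a set \<open>A\<close> is three times the volume of the
  cone \<open>{s x | 0 < s < 1, x \<in> A}\<close>, where \<open>sgn x = x / norm x\<close> is the radial projection.
\<close>

definition surface_measure :: "(real^3) measure" where
  "surface_measure =
     distr (scale_measure 3 (restrict_space lborel (ball 0 1 - {0}))) (restrict_space borel S2) sgn"

lemma space_surface_measure [simp]: "space surface_measure = S2"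
  by (simp add: surface_measure_def space_restrict_space)

lemma sets_surface_measure [simp, measurable_cong]:
  "sets surface_measure = sets (restrict_space borel S2)"
  by (simp add: surface_measure_def)

lemma emeasure_surface_measure_sphere: "emeasure surface_measure S2 = ennreal (4 * pi)"
proof -
  let ?B = "ball 0 1 - {0} :: (real^3) set"
  let ?M = "scale_measure 3 (restrict_space lborel ?B) :: (real^3) measure"
  have sp: "space ?M = ?B"
    by (simp add: space_restrict_space space_scale_measure)
  have sgn_meas: "(sgn :: real^3 \<Rightarrow> real^3) \<in> ?M \<rightarrow>\<^sub>M restrict_space borel S2"
  proof (rule measurable_restrict_space2)
    show "sgn \<in> space ?M \<rightarrow> S2"
      by (auto simp: sp norm_sgn)
    have "(sgn :: real^3 \<Rightarrow> real^3) = (\<lambda>x. x /\<^sub>R norm x)"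
      by (auto simp: sgn_div_norm)
    also have "\<dots> \<in> borel_measurable borel" by measurable
    finally show "sgn \<in> borel_measurable ?M"
      by (simp add: measurable_def space_restrict_space sets_restrict_space space_scale_measure)
        auto
  qed
  have "emeasure surface_measure S2 = emeasure ?M (sgn -` S2 \<inter> space ?M)"
    unfolding surface_measure_def
    by (subst emeasure_distr[OF sgn_meas]) (auto simp: sets_restrict_space)
  also have "sgn -` S2 \<inter> space ?M = ?B"
    by (auto simp: sp norm_sgn)
  also have "emeasure ?M ?B = 3 * emeasure lborel ?B"
    by (simp add: emeasure_restrict_space)
  also have "emeasure lborel ?B = emeasure lborel (ball 0 1 :: (real^3) set)"
    by (subst emeasure_Diff) auto
  also have "\<dots> = ennreal (4 / 3 * pi)"
    by (simp add: emeasure_ball unit_ball_vol_3)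
  also have "3 * ennreal (4 / 3 * pi) = ennreal (4 * pi)"
    by (simp add: ennreal_mult'[symmetric] flip: ennreal_numeral)
  finally show ?thesis .
qed

definition L2_sphere :: "(real^3 \<Rightarrow> real) set" where
  "L2_sphere = {v \<in> borel_measurable surface_measure. integrable surface_measure (\<lambda>x. (v x)\<^sup>2)}"

definition Linf_norm :: "(real^3 \<Rightarrow> real) \<Rightarrow> ereal" where
  "Linf_norm v = esssup surface_measure (\<lambda>x. ereal \<bar>v x\<bar>)"

definition laplacian :: "(real^3 \<Rightarrow> real) \<Rightarrow> real^3 \<Rightarrow> real" where
  "laplacian p x = (\<Sum>e\<in>Basis. (deriv ^^ 2) (\<lambda>s. p (x + s *\<^sub>R e)) 0)"

text \<open>Restrictions to the sphere of harmonic polynomials homogeneous of degree \<open>l\<close>.\<close>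

definition spherical_harmonic :: "nat \<Rightarrow> (real^3 \<Rightarrow> real) \<Rightarrow> bool" where
  "spherical_harmonic l y \<longleftrightarrow>
     (\<exists>p. real_polynomial_function p \<and> (\<forall>s x. p (s *\<^sub>R x) = s ^ l * p x) \<and>
          (\<forall>x. laplacian p x = 0) \<and> (\<forall>x\<in>S2. y x = p x))"

type_synonym harmonics = "nat \<Rightarrow> nat \<Rightarrow> real^3 \<Rightarrow> real"

definition fourier :: "harmonics \<Rightarrow> (real^3 \<Rightarrow> real) \<Rightarrow> nat \<Rightarrow> nat \<Rightarrow> real" where
  "fourier Y v l k = (LINT x|surface_measure. v x * Y l k x)"

text \<open>The basis property is expressed by convergence of the Fourier partial sums in the mean.\<close>

definition spherical_harmonic_basis :: "harmonics \<Rightarrow> bool" where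
  "spherical_harmonic_basis Y \<longleftrightarrow>
     (\<forall>l. \<forall>k\<in>{1..2*l+1}. spherical_harmonic l (Y l k)) \<and>
     (\<forall>l l'. \<forall>k\<in>{1..2*l+1}. \<forall>k'\<in>{1..2*l'+1}.
        (LINT x|surface_measure. Y l k x * Y l' k' x) = (if l = l' \<and> k = k' then 1 else 0)) \<and>
     (\<forall>v\<in>L2_sphere.
        (\<lambda>n. LINT x|surface_measure.
           (v x - (\<Sum>l\<le>n. \<Sum>k=1..2*l+1. fourier Y v l k * Y l k x))\<^sup>2) \<longlonglongrightarrow> 0)"

definition Pn :: "harmonics \<Rightarrow> nat \<Rightarrow> (real^3 \<Rightarrow> real) set" where
  "Pn Y n = {p. \<exists>c :: nat \<Rightarrow> nat \<Rightarrow> real. \<forall>x\<in>S2. p x = (\<Sum>l\<le>n. \<Sum>k=1..2*l+1. c l k * Y l k x)}"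

definition sobolev_term :: "harmonics \<Rightarrow> real \<Rightarrow> (real^3 \<Rightarrow> real) \<Rightarrow> nat \<Rightarrow> real" where
  "sobolev_term Y r v l =
     (1 + real l * (real l + 1)) powr r * (\<Sum>k=1..2*l+1. \<bar>fourier Y v l k\<bar>\<^sup>2)"

definition sobolev_norm :: "harmonics \<Rightarrow> real \<Rightarrow> (real^3 \<Rightarrow> real) \<Rightarrow> real" where
  "sobolev_norm Y r v = sqrt (\<Sum>l. sobolev_term Y r v l)"

text \<open>
  The space \<open>H\<^sup>r\<close> for \<open>r > 1\<close>, where it embeds into the continuous functions: an \<open>L\<^sup>2\<close>-class with finite
  norm is identified with its unique continuous representative, since point values are needed.
\<close>

definition sobolev :: "harmonics \<Rightarrow> real \<Rightarrow> (real^3 \<Rightarrow> real) set" where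
  "sobolev Y r = {v \<in> L2_sphere. summable (sobolev_term Y r v) \<and> continuous_on S2 v}"

text \<open>Legendre polynomials by Rodrigues' formula.\<close>

definition legendre :: "nat \<Rightarrow> real poly" where
  "legendre l = smult (1 / (2 ^ l * fact l)) ((pderiv ^^ l) ([:-1, 0, 1:] ^ l))"

definition zonal :: "(real \<Rightarrow> real) \<Rightarrow> (real^3 \<Rightarrow> real) \<Rightarrow> real^3 \<Rightarrow> real" where
  "zonal \<Phi> v x = (LINT y|surface_measure. \<Phi> (x \<bullet> y) * v y)"

definition multiplier :: "(real \<Rightarrow> real) \<Rightarrow> nat \<Rightarrow> real" where
  "multiplier \<Phi> l = 2 * pi * (LINT s:{-1<..<1}|lborel. \<Phi> s * poly (legendre l) s)"

primrec sloan :: "(real \<Rightarrow> real) \<Rightarrow> (real^3 \<Rightarrow> real) \<Rightarrow> nat \<Rightarrow> (real^3 \<Rightarrow> real) \<Rightarrow> real^3 \<Rightarrow> real" where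
  "sloan \<Phi> f 0 v = v"
| "sloan \<Phi> f (Suc q) v = (\<lambda>x. f x + zonal \<Phi> (sloan \<Phi> f q v) x)"

definition quadrature ::
  "nat \<Rightarrow> (nat \<Rightarrow> real) \<Rightarrow> (nat \<Rightarrow> real^3) \<Rightarrow> (real^3 \<Rightarrow> real) \<Rightarrow> real" where
  "quadrature N w x g = (\<Sum>j=1..N. w j * g (x j))"

definition exact_on :: "((real^3 \<Rightarrow> real) \<Rightarrow> real) \<Rightarrow> (real^3 \<Rightarrow> real) set \<Rightarrow> bool" where
  "exact_on Q P \<longleftrightarrow> (\<forall>p\<in>P. Q p = (LINT x|surface_measure. p x))"

definition hyperinterpolation ::
  "harmonics \<Rightarrow> ((real^3 \<Rightarrow> real) \<Rightarrow> real) \<Rightarrow> nat \<Rightarrow> (real^3 \<Rightarrow> real) \<Rightarrow> real^3 \<Rightarrow> real" where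
  "hyperinterpolation Y Q n v x = (\<Sum>l\<le>n. \<Sum>k=1..2*l+1. Q (\<lambda>z. v z * Y l k z) * Y l k x)"

definition exact_solution ::
  "harmonics \<Rightarrow> real \<Rightarrow> (real \<Rightarrow> real) \<Rightarrow> (real^3 \<Rightarrow> real) \<Rightarrow> (real^3 \<Rightarrow> real) \<Rightarrow> bool" where
  "exact_solution Y r \<Phi> f u \<longleftrightarrow> u \<in> sobolev Y r \<and> (\<forall>x\<in>S2. u x - zonal \<Phi> u x = f x)"

datatype scheme = Galerkin | Nystrom

fun discrete_solution ::
  "scheme \<Rightarrow> harmonics \<Rightarrow> real \<Rightarrow> (real \<Rightarrow> real) \<Rightarrow> ((real^3 \<Rightarrow> real) \<Rightarrow> real) \<Rightarrow> nat \<Rightarrow>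
   (real^3 \<Rightarrow> real) \<Rightarrow> (real^3 \<Rightarrow> real) \<Rightarrow> bool" where
  "discrete_solution Galerkin Y r \<Phi> Q n f U \<longleftrightarrow>
     U \<in> Pn Y n \<and> (\<forall>p\<in>Pn Y n. Q (\<lambda>x. (U x - zonal \<Phi> U x) * p x) = Q (\<lambda>x. f x * p x))"
| "discrete_solution Nystrom Y r \<Phi> Q n f U \<longleftrightarrow>
     U \<in> sobolev Y r \<and> (\<forall>x\<in>S2. U x - zonal \<Phi> (hyperinterpolation Y Q n U) x = f x)"

fun eps :: "scheme \<Rightarrow> nat" where
  "eps Galerkin = 0"
| "eps Nystrom = 1"

text \<open>Only used for \<open>\<gamma> \<ge> 0\<close>.\<close>

definition rho :: "real \<Rightarrow> nat \<Rightarrow> real" where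
  "rho \<gamma> n =
     (if \<gamma> < 1 then real n powr (1 - \<gamma>)
      else if \<gamma> = 1 then sqrt (ln (real n + 1))
      else 1)"

end

(*
  Expanding in spherical harmonics, the operator T is the diagonal matrix (mu_l).  The discrete Galerkin
  solution is (I - T)^(-1) L_n f and the Nystrom solution is one Sloan step applied to it, so the error
  after q steps is T^m (I - T)^(-1) (f - L_n f) with m = q or q + 1.  By the addition theorem the sup norm of
  its component of degree l is at most mu_l^m / (1 - mu_l) * sqrt ((2 l + 1) / (4 pi)) times the L2 norm of
  that component of f - L_n f; summation by Cauchy-Schwarz gives the first term of the bound from the degrees
  above n and the factor rho from the degrees up to n, where ||S_n f - L_n f|| <= Q(g^2)^(1/2) for the tail g
  of f beyond degree s_n.

  The rate s_n^(-r), with no loss of a power of s_n, needs Q(p^2) <= C (d / t)^2 ||p||^2 for polynomials p of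
  degree d beyond the degree of exactness t: p is an average over caps of radius about 1/d of a polynomial of
  comparable norm (Funk-Hecke for the indicator of a cap), and the quadrature measure of such a cap is
  bounded by the integral of a squared reproducing kernel.  A dyadic decomposition of g then converges
  because r > 1.

  Funk-Hecke itself: averaging a harmonic polynomial over circles of latitude turns Laplace's equation into
  the recurrence for the coefficients of the Legendre polynomial, and Archimedes' hat-box theorem gives the
  distribution of the latitude.  Tested against Legendre polynomials and combined with completeness it yields
  the addition theorem and the degree of products.
*)

theory Submission
  imports Defs
begin

section \<open>Surface measure\<close>

text \<open>Spherical harmonics are known only as restrictions of harmonic polynomials, and the
  basis only through convergence in the mean. Orthogonality to polynomials of lower degree and
  closure under products are therefore derived from Funk-Hecke, where Green's formula would be the
  usual source. The degree s_n is dictated by exactness: a polynomial of degree s_n times a harmonic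
  of degree at most n has degree at most t_n, so only the tail g aliases, and 2 n <= t_n makes the
  harmonics up to degree n orthonormal for the discrete inner product. Bounding Q(g^2) by the sup
  norm of g would cost a factor s_n, the power lost in the Sobolev embedding. Hence g is measured
  block by block in the discrete norm: on degrees about 2^j s_n that norm costs 2^j while the
  Sobolev weight gains 2^(-j r), so the blocks form a geometric series of ratio 2^(1 - r). The
  factor rho is the square root of the order of growth of the sum of (l + 1)^(1 - 2 gamma) over l <=
  n.\<close>

lemma orthogonal_transformation_measurable:
  fixes f :: "real^3 \<Rightarrow> real^3"
  assumes f: "orthogonal_transformation f"
  shows "f \<in> borel_measurable borel"
proof -
  have "bounded_linear f"
    using f orthogonal_transformation_linear linear_conv_bounded_linear by blast
  thus ?thesis by (intro borel_measurable_continuous_onI linear_continuous_on)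
qed

text \<open>\<open>lborel\<close> is determined by its values on boxes. The preimage of a box is its
  image under the inverse map; that such images keep their volume is a fact about
  \<open>lebesgue\<close>, hence the detour.\<close>

lemma lborel_distr_orthogonal_transformation:
  fixes f :: "real^3 \<Rightarrow> real^3"
  assumes f: "orthogonal_transformation f"
  shows "distr lborel borel f = lborel"
proof (rule sym, rule lborel_eqI)
  show "sets (distr lborel borel f) = sets borel" by simp
  note [measurable] = orthogonal_transformation_measurable[OF f]
  fix l u :: "real^3"
  assume "\<And>b. b \<in> Basis \<Longrightarrow> l \<bullet> b \<le> u \<bullet> b"
  hence e: "emeasure lborel (box l u) = ennreal (prod ((\<bullet>) (u - l)) Basis)"
    by simp
  obtain g where g: "orthogonal_transformation g" "g = inv f"
    using f orthogonal_transformation_inv by blast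
  have pre: "f -` box l u = g ` box l u"
    using f g(2) bij_vimage_eq_inv_image[OF orthogonal_transformation_bij[OF f]] by simp
  have lm: "box l u \<in> lmeasurable" by simp
  have fbox: "f -` box l u \<in> sets borel"
    by (rule measurable_sets_borel[where M = borel]) auto
  have lm': "g ` box l u \<in> lmeasurable" using measurable_orthogonal_image[OF g(1) lm] .
  have "emeasure (distr lborel borel f) (box l u) = emeasure lborel (f -` box l u)"
    by (subst emeasure_distr) auto
  also have "\<dots> = emeasure lebesgue (f -` box l u)"
    using fbox by (simp add: emeasure_completion)
  also have "\<dots> = ennreal (measure lebesgue (g ` box l u))"
    unfolding pre using lm' by (simp add: emeasure_eq_measure2)
  also have "\<dots> = ennreal (measure lebesgue (box l u))"
    using measure_orthogonal_image[OF g(1) lm] by simp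
  also have "\<dots> = emeasure lebesgue (box l u)"
    using lm by (simp add: emeasure_eq_measure2)
  also have "\<dots> = emeasure lborel (box l u)" by simp
  finally show "emeasure (distr lborel borel f) (box l u) = ennreal (prod ((\<bullet>) (u - l)) Basis)"
    using e by simp
qed

lemma sgn_borel_measurable [measurable]: "(sgn :: real^3 \<Rightarrow> real^3) \<in> borel_measurable borel"
proof -
  have "(sgn :: real^3 \<Rightarrow> real^3) = (\<lambda>x. x /\<^sub>R norm x)"
    by (auto simp: sgn_div_norm)
  also have "\<dots> \<in> borel_measurable borel" by measurable
  finally show ?thesis .
qed

lemma emeasure_surface_measure:
  assumes A: "A \<in> sets borel" "A \<subseteq> S2"
  shows "emeasure surface_measure A = 3 * emeasure lborel {x \<in> ball 0 1 - {0}. sgn x \<in> A}"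
proof -
  let ?B = "ball 0 1 - {0} :: (real^3) set"
  let ?M = "scale_measure 3 (restrict_space lborel ?B) :: (real^3) measure"
  have sp: "space ?M = ?B"
    by (simp add: space_restrict_space space_scale_measure)
  have sgn_meas: "(sgn :: real^3 \<Rightarrow> real^3) \<in> ?M \<rightarrow>\<^sub>M restrict_space borel S2"
  proof (rule measurable_restrict_space2)
    show "sgn \<in> space ?M \<rightarrow> S2" by (auto simp: sp norm_sgn)
    have "(sgn :: real^3 \<Rightarrow> real^3) \<in> borel_measurable borel" by measurable
    thus "sgn \<in> borel_measurable ?M"
      by (simp add: measurable_def space_restrict_space sets_restrict_space space_scale_measure)
        auto
  qed
  have "emeasure surface_measure A = emeasure ?M (sgn -` A \<inter> space ?M)"
    unfolding surface_measure_def using A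
    by (subst emeasure_distr[OF sgn_meas]) (auto simp: sets_restrict_space)
  also have "sgn -` A \<inter> space ?M = {x \<in> ?B. sgn x \<in> A}"
    by (auto simp: sp)
  also have "emeasure ?M \<dots> = 3 * emeasure lborel {x \<in> ?B. sgn x \<in> A}"
    by (subst emeasure_scale_measure, subst emeasure_restrict_space) auto
  finally show ?thesis .
qed

lemma finite_measure_surface [simp]: "finite_measure surface_measure"
  by (rule finite_measureI) (simp add: emeasure_surface_measure_sphere)

interpretation surface: finite_measure surface_measure by simp

lemma measure_surface_sphere: "measure surface_measure S2 = 4 * pi"
  by (simp add: measure_def emeasure_surface_measure_sphere)

lemma orthogonal_transformation_measurable_sphere:
  fixes f :: "real^3 \<Rightarrow> real^3"
  assumes f: "orthogonal_transformation f"
  shows "f \<in> surface_measure \<rightarrow>\<^sub>M surface_measure"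
proof -
  have "f \<in> restrict_space borel S2 \<rightarrow>\<^sub>M restrict_space borel S2"
    using orthogonal_transformation_measurable[OF f]
    by (auto intro!: measurable_restrict_space3 simp: orthogonal_transformation_norm[OF f])
  thus ?thesis by (simp cong: measurable_cong_sets)
qed

text \<open>Because \<open>sgn\<close> commutes with \<open>f\<close>, the cone over a rotated set
  is the rotated cone, and invariance is inherited from \<open>lborel\<close>. It allows every zonal
  computation to be moved to the pole \<open>axis 3 1\<close>.\<close>

lemma surface_measure_distr_orthogonal_transformation:
  fixes f :: "real^3 \<Rightarrow> real^3"
  assumes f: "orthogonal_transformation f"
  shows "distr surface_measure surface_measure f = surface_measure"
proof (rule measure_eqI)
  note fm = orthogonal_transformation_measurable_sphere[OF f]
  note [measurable] = orthogonal_transformation_measurable[OF f]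
  show "sets (distr surface_measure surface_measure f) = sets surface_measure" by simp
  fix A assume "A \<in> sets (distr surface_measure surface_measure f)"
  hence A: "A \<in> sets borel" "A \<subseteq> S2" and A': "A \<in> sets surface_measure"
    by (auto simp: sets_restrict_space)
  have [measurable]: "A \<in> sets borel" by fact
  have S: "f -` A \<inter> S2 \<in> sets borel"
    using measurable_sets_borel[of f borel A] by auto
  have sgnf: "sgn (f x) = f (sgn x)" for x
    using f by (simp add: sgn_div_norm orthogonal_transformation_norm
        linear_cmul[OF orthogonal_transformation_linear[OF f]])
  have "emeasure (distr surface_measure surface_measure f) A
      = emeasure surface_measure (f -` A \<inter> S2)"
    using fm A' by (simp add: emeasure_distr)
  also have "\<dots> = 3 * emeasure lborel {x \<in> ball 0 1 - {0}. sgn x \<in> f -` A \<inter> S2}"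
    by (rule emeasure_surface_measure) (use S in auto)
  also have "{x \<in> ball 0 1 - {0}. sgn x \<in> f -` A \<inter> S2} = f -` {x \<in> ball 0 1 - {0}. sgn x \<in> A}"
    using f A(2) by (auto simp: sgnf orthogonal_transformation_norm norm_sgn
        linear_0[OF orthogonal_transformation_linear[OF f]]
        simp flip: norm_eq_zero[of "f _"])
  also have "emeasure lborel \<dots> = emeasure (distr lborel borel f) {x \<in> ball 0 1 - {0}. sgn x \<in> A}"
    by (subst emeasure_distr) (auto simp: pred_def)
  also have "\<dots> = emeasure lborel {x \<in> ball 0 1 - {0}. sgn x \<in> A}"
    by (simp add: lborel_distr_orthogonal_transformation[OF f])
  also have "3 * \<dots> = emeasure surface_measure A"
    by (rule emeasure_surface_measure[symmetric]) (use A in auto)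
  finally show "emeasure (distr surface_measure surface_measure f) A = emeasure surface_measure A" .
qed

section \<open>Volumes of solid cones and areas of spherical caps\<close>

abbreviation vec3 :: "real \<Rightarrow> real \<Rightarrow> real \<Rightarrow> real^3" where
  "vec3 a b c \<equiv> a *\<^sub>R axis 1 1 + b *\<^sub>R axis 2 1 + c *\<^sub>R axis 3 1"

lemma vec3_nth [simp]: "vec3 a b c $ 1 = a" "vec3 a b c $ 2 = b" "vec3 a b c $ 3 = c"
  by (simp_all add: axis_def)

lemma norm_vec3: "norm (x::real^3) = sqrt ((x$1)\<^sup>2 + (x$2)\<^sup>2 + (x$3)\<^sup>2)"
  by (simp add: norm_eq_sqrt_inner inner_vec_def sum_3 power2_eq_square)

text \<open>Pairing as \<open>((a, b), c)\<close> puts the height last, so that slices at fixed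
  height are discs in \<open>real \<times> real\<close>, with the area of a ball.\<close>

lemma lborel_vec3:
  "distr (lborel :: ((real \<times> real) \<times> real) measure) borel (\<lambda>((a, b), c). vec3 a b c) = lborel"
proof (rule sym, rule lborel_eqI)
  let ?T = "\<lambda>((a, b), c). vec3 a b c"
  have "continuous_on UNIV (?T :: (real \<times> real) \<times> real \<Rightarrow> _)"
    unfolding case_prod_beta by (intro continuous_intros)
  hence [measurable]: "?T \<in> borel_measurable borel"
    by (rule borel_measurable_continuous_onI)
  fix l u :: "real^3"
  assume lu: "\<And>b. b \<in> Basis \<Longrightarrow> l \<bullet> b \<le> u \<bullet> b"
  have lu': "l $ i \<le> u $ i" for i
    using lu[of "axis i 1"] by (simp add: inner_axis)
  have "emeasure (distr lborel borel ?T) (box l u) = emeasure lborel (?T -` box l u)"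
    by (subst emeasure_distr) auto
  also have "?T -` box l u = box ((l$1,l$2),l$3) ((u$1,u$2),u$3)"
    by (auto simp: mem_box_cart forall_3 mem_box Basis_prod_def simp del: vector_add_component)
  also have "emeasure lborel \<dots> = ennreal ((u$1 - l$1) * (u$2 - l$2) * (u$3 - l$3))"
  proof -
    have B: "(Basis :: ((real \<times> real) \<times> real) set) = {((1,0),0), ((0,1),0), ((0,0),1)}"
      by (auto simp: Basis_prod_def zero_prod_def)
    show ?thesis using lu' by (subst emeasure_lborel_box) (auto simp: B inner_diff_left)
  qed
  also have "(u$1 - l$1) * (u$2 - l$2) * (u$3 - l$3) = prod ((\<bullet>) (u - l)) Basis"
  proof -
    have B: "(Basis :: (real^3) set) = {axis 1 1, axis 2 1, axis 3 1}"
      by (auto simp: Basis_vec_def UNIV_3)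
    show ?thesis unfolding B by (simp add: axis_eq_axis inner_axis mult.assoc)
  qed
  finally show "emeasure (distr lborel borel ?T) (box l u) = ennreal (prod ((\<bullet>) (u - l)) Basis)" .
qed simp

text \<open>The solid is sliced by height. The slice at height \<open>c\<close> is a disc of squared
  radius \<open>?h c\<close>: the ball gives the first bound in the minimum, the cone the
  second.\<close>

lemma emeasure_lborel_cone:
  fixes s :: real
  assumes s: "0 < s" "s \<le> 1"
  shows "emeasure lborel {x :: real^3. norm x < 1 \<and> s * norm x < x $ 3} = ennreal (2 / 3 * pi * (1 - s))"
proof -
  let ?A = "{x :: real^3. norm x < 1 \<and> s * norm x < x $ 3}"
  let ?T = "\<lambda>((a, b), c). vec3 a b c"
  let ?A' = "{p :: (real \<times> real) \<times> real. (norm (fst p))\<^sup>2 + (snd p)\<^sup>2 < 1 \<and>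
        s * sqrt ((norm (fst p))\<^sup>2 + (snd p)\<^sup>2) < snd p}"
  let ?h = "\<lambda>c. min (1 - c\<^sup>2) (c\<^sup>2 * (1 / s\<^sup>2 - 1))"
  have "continuous_on UNIV (?T :: (real \<times> real) \<times> real \<Rightarrow> _)"
    unfolding case_prod_beta by (intro continuous_intros)
  hence [measurable]: "?T \<in> borel_measurable borel"
    by (rule borel_measurable_continuous_onI)
  have [measurable]: "?A \<in> sets borel" by measurable
  have "open ?A'" by (intro open_Collect_conj open_Collect_less continuous_intros)
  hence A'[measurable]: "?A' \<in> sets borel" by simp
  have "emeasure lborel ?A = emeasure lborel (?T -` ?A)"
    by (subst lborel_vec3[symmetric], subst emeasure_distr) auto
  also have "?T -` ?A = ?A'"
    by (auto simp: norm_vec3 norm_prod_def simp del: vector_add_component)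
  also have "emeasure lborel ?A' = emeasure (lborel \<Otimes>\<^sub>M lborel) ?A'"
    by (simp add: lborel_prod)
  also have "\<dots> = (\<integral>\<^sup>+c. emeasure lborel ((\<lambda>p. (p, c)) -` ?A') \<partial>lborel)"
    by (rule lborel_pair.emeasure_pair_measure_alt2) (unfold lborel_prod sets_lborel, rule A')
  also have "\<dots> = (\<integral>\<^sup>+c. ennreal (pi * ?h c) * indicator {0..1} c \<partial>lborel)"
  proof (rule nn_integral_cong)
    fix c :: real
    have eq: "(\<lambda>p. (p, c)) -` ?A' = (if 0 < c \<and> c < 1 then ball 0 (sqrt (?h c)) else {})"
    proof -
      have 1: "((norm p)\<^sup>2 + c\<^sup>2 < 1 \<and> s * sqrt ((norm p)\<^sup>2 + c\<^sup>2) < c) \<longleftrightarrow> norm p < sqrt (?h c)"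
        if c: "0 < c" "c < 1" for p :: "real \<times> real"
      proof -
        have "s * sqrt ((norm p)\<^sup>2 + c\<^sup>2) < c \<longleftrightarrow> sqrt ((norm p)\<^sup>2 + c\<^sup>2) < c / s"
          using s by (simp add: pos_less_divide_eq mult.commute)
        also have "\<dots> \<longleftrightarrow> sqrt ((norm p)\<^sup>2 + c\<^sup>2) < sqrt ((c / s)\<^sup>2)"
          using s c by simp
        also have "\<dots> \<longleftrightarrow> (norm p)\<^sup>2 + c\<^sup>2 < (c / s)\<^sup>2"
          by (rule real_sqrt_less_iff)
        also have "\<dots> \<longleftrightarrow> (norm p)\<^sup>2 < c\<^sup>2 * (1 / s\<^sup>2 - 1)"
          by (simp add: power_divide algebra_simps)
        finally have "((norm p)\<^sup>2 + c\<^sup>2 < 1 \<and> s * sqrt ((norm p)\<^sup>2 + c\<^sup>2) < c) \<longleftrightarrow> (norm p)\<^sup>2 < ?h c"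
          by auto
        also have "\<dots> \<longleftrightarrow> sqrt ((norm p)\<^sup>2) < sqrt (?h c)"
          by (rule real_sqrt_less_iff[symmetric])
        finally show ?thesis by simp
      qed
      have 2: "\<not> ((norm p)\<^sup>2 + c\<^sup>2 < 1 \<and> s * sqrt ((norm p)\<^sup>2 + c\<^sup>2) < c)"
        if c: "\<not> (0 < c \<and> c < 1)" for p :: "real \<times> real"
      proof
        assume *: "(norm p)\<^sup>2 + c\<^sup>2 < 1 \<and> s * sqrt ((norm p)\<^sup>2 + c\<^sup>2) < c"
        have "0 \<le> s * sqrt ((norm p)\<^sup>2 + c\<^sup>2)" using s by simp
        with * have c0: "0 < c" by linarith
        have "c\<^sup>2 < 1" using * zero_le_power2[of "norm p"] by linarith
        hence "c < 1" using c0 by (simp add: power2_less_1_iff abs_if)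
        with c0 c show False by simp
      qed
      show ?thesis using 1 2 by (auto simp del: norm_Pair)
    qed
    have s2: "1 \<le> 1 / s\<^sup>2" using s by (simp add: power_le_one)
    have h0: "0 \<le> ?h c" if "0 \<le> c" "c \<le> 1"
      using that s2 by (auto simp: power_le_one intro!: mult_nonneg_nonneg)
    have hz: "?h c = 0" if "c = 0 \<or> c = 1"
      using that s2 by auto
    show "emeasure lborel ((\<lambda>p. (p, c)) -` ?A') = ennreal (pi * ?h c) * indicator {0..1} c"
    proof (cases "0 < c \<and> c < 1")
      case True
      have "emeasure lborel (ball 0 (sqrt (?h c)) :: (real \<times> real) set)
          = ennreal (unit_ball_vol 2 * sqrt (?h c) ^ 2)"
        using h0 True by (subst emeasure_ball) auto
      also have "sqrt (?h c) ^ 2 = ?h c"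
        using h0 True by (intro real_sqrt_pow2) auto
      finally show ?thesis
        unfolding eq using True by (simp only: if_True unit_ball_vol_2) (simp add: indicator_def)
    next
      case False
      hence "ennreal (pi * ?h c) * indicator {0..1} c = 0"
        using hz by (cases "c = 0 \<or> c = 1") (auto simp: indicator_def)
      thus ?thesis unfolding eq using False by (simp only: if_False) simp
    qed
  qed
  \<comment> \<open>The two bounds in \<open>?h\<close> cross at \<open>c = s\<close>. This point
    belongs to both intervals, hence equality only almost everywhere.\<close>
  also have "\<dots> = (\<integral>\<^sup>+c. ennreal (pi * (c\<^sup>2 * (1 / s\<^sup>2 - 1))) * indicator {0..s} c
        + ennreal (pi * (1 - c\<^sup>2)) * indicator {s..1} c \<partial>lborel)"
  proof (rule nn_integral_cong_AE)
    have "AE c in lborel. c \<noteq> s" by (rule AE_lborel_singleton)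
    thus "AE c in lborel. ennreal (pi * ?h c) * indicator {0..1} c =
       ennreal (pi * (c\<^sup>2 * (1 / s\<^sup>2 - 1))) * indicator {0..s} c
        + ennreal (pi * (1 - c\<^sup>2)) * indicator {s..1} c"
    proof eventually_elim
      case (elim c)
      have low: "?h c = c\<^sup>2 * (1 / s\<^sup>2 - 1)" if "0 \<le> c" "c \<le> s"
      proof -
        have "c\<^sup>2 \<le> s\<^sup>2" using that by (intro power_mono) auto
        hence "c\<^sup>2 * (1 / s\<^sup>2) \<le> 1" using s by simp
        thus ?thesis by (simp add: algebra_simps)
      qed
      have high: "?h c = 1 - c\<^sup>2" if "s \<le> c"
      proof -
        have "s\<^sup>2 \<le> c\<^sup>2" using that s by (intro power_mono) auto
        hence "c\<^sup>2 * (1 / s\<^sup>2) \<ge> 1" using s by simp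
        thus ?thesis by (simp add: algebra_simps)
      qed
      consider "c < 0" | "0 \<le> c" "c < s" | "s < c" "c \<le> 1" | "1 < c" using elim by linarith
      thus ?case
      proof cases
        case 2
        show ?thesis unfolding low[OF 2(1) less_imp_le[OF 2(2)]]
          using 2 s by (simp add: indicator_def)
      next
        case 3
        show ?thesis unfolding high[OF less_imp_le[OF 3(1)]]
          using 3 s by (simp add: indicator_def)
      qed (use s in \<open>auto simp: indicator_def\<close>)
    qed
  qed
  also have "\<dots> = (\<integral>\<^sup>+c. ennreal (pi * (c\<^sup>2 * (1 / s\<^sup>2 - 1))) * indicator {0..s} c \<partial>lborel)
        + (\<integral>\<^sup>+c. ennreal (pi * (1 - c\<^sup>2)) * indicator {s..1} c \<partial>lborel)"
    by (rule nn_integral_add) auto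
  also have "(\<integral>\<^sup>+c. ennreal (pi * (c\<^sup>2 * (1 / s\<^sup>2 - 1))) * indicator {0..s} c \<partial>lborel)
      = ennreal (pi * (s^3 / 3 * (1 / s\<^sup>2 - 1)) - pi * (0^3 / 3 * (1 / s\<^sup>2 - 1)))"
  proof (rule nn_integral_FTC_Icc[where F = "\<lambda>c. pi * (c^3 / 3 * (1 / s\<^sup>2 - 1))"])
    show "((\<lambda>c. pi * (c^3 / 3 * (1 / s\<^sup>2 - 1))) has_real_derivative pi * (x\<^sup>2 * (1 / s\<^sup>2 - 1)))
        (at x)" for x
      by (auto intro!: derivative_eq_intros simp: power2_eq_square)
    show "0 \<le> pi * (x\<^sup>2 * (1 / s\<^sup>2 - 1))" for x
      using s by (auto simp: power_le_one intro!: mult_nonneg_nonneg)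
  qed (use s in auto)
  also have "(\<integral>\<^sup>+c. ennreal (pi * (1 - c\<^sup>2)) * indicator {s..1} c \<partial>lborel)
      = ennreal (pi * (1 - 1^3 / 3) - pi * (s - s^3 / 3))"
  proof (rule nn_integral_FTC_Icc[where F = "\<lambda>c. pi * (c - c^3 / 3)"])
    show "((\<lambda>c. pi * (c - c^3 / 3)) has_real_derivative pi * (1 - x\<^sup>2)) (at x)" for x
      by (auto intro!: derivative_eq_intros simp: power2_eq_square)
    show "0 \<le> pi * (1 - x\<^sup>2)" if "x \<in> {s..1}" for x
      using that s by (auto simp: power_le_one)
  qed (use s in auto)
  also have "ennreal (pi * (s^3 / 3 * (1 / s\<^sup>2 - 1)) - pi * (0^3 / 3 * (1 / s\<^sup>2 - 1))) +
      ennreal (pi * (1 - 1^3 / 3) - pi * (s - s^3 / 3)) = ennreal (2 / 3 * pi * (1 - s))"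
  proof -
    have 1: "s^3 / 3 * (1 / s\<^sup>2 - 1) = s / 3 - s^3 / 3"
      using s by (simp add: field_simps power3_eq_cube power2_eq_square)
    have s3: "s^3 \<le> s" using s by (simp add: power3_eq_cube mult_le_one mult_left_le)
    have 2: "0 \<le> 1 - 1^3 / 3 - (s - s^3 / 3)"
    proof -
      have "(1 - s)\<^sup>2 * (2 + s) \<ge> 0" using s by simp
      thus ?thesis by (simp add: power2_eq_square power3_eq_cube algebra_simps)
    qed
    have "ennreal (pi * (s^3 / 3 * (1 / s\<^sup>2 - 1)) - pi * (0^3 / 3 * (1 / s\<^sup>2 - 1))) +
      ennreal (pi * (1 - 1^3 / 3) - pi * (s - s^3 / 3)) =
      ennreal (pi * (s / 3 - s^3 / 3)) + ennreal (pi * (1 - 1^3 / 3 - (s - s^3 / 3)))"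
      unfolding 1 by (simp add: algebra_simps)
    also have "\<dots> = ennreal (pi * (s / 3 - s^3 / 3) + pi * (1 - 1^3 / 3 - (s - s^3 / 3)))"
      using s3 2 by (intro ennreal_plus[symmetric] mult_nonneg_nonneg) auto
    also have "pi * (s / 3 - s^3 / 3) + pi * (1 - 1^3 / 3 - (s - s^3 / 3)) = 2 / 3 * pi * (1 - s)"
      by (simp add: algebra_simps)
    finally show ?thesis .
  qed
  finally show ?thesis .
qed

lemma emeasure_surface_cap_axis:
  assumes s: "0 < s" "s \<le> 1"
  shows "emeasure surface_measure {y \<in> S2. s < y $ 3} = ennreal (2 * pi * (1 - s))"
proof -
  have m: "{y \<in> S2. s < y $ 3} \<in> sets borel" by measurable
  have "{x :: real^3 \<in> ball 0 1 - {0}. sgn x \<in> {y \<in> S2. s < y $ 3}}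
      = {x. norm x < 1 \<and> s * norm x < x $ 3}"
    using s by (auto simp: norm_sgn sgn_div_norm field_simps)
  hence "emeasure surface_measure {y \<in> S2. s < y $ 3} = 3 * ennreal (2 / 3 * pi * (1 - s))"
    using emeasure_surface_measure[OF m] emeasure_lborel_cone[OF s] by (simp only: Collect_restrict)
  also have "\<dots> = ennreal (3 * (2 / 3 * pi * (1 - s)))"
    using s by (subst ennreal_mult) auto
  also have "3 * (2 / 3 * pi * (1 - s)) = 2 * pi * (1 - s)" by simp
  finally show ?thesis .
qed

lemma sphere_sets [measurable]: "S2 \<in> sets borel"
  by (simp add: borel_closed)

lemma measurable_surface_measure_subset:
  assumes "A \<in> sets borel" "A \<subseteq> S2"
  shows "A \<in> sets surface_measure"
  using assms by (auto simp: sets_restrict_space)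

lemma borel_measurable_surface [measurable (raw)]:
  assumes "f \<in> borel_measurable borel"
  shows "f \<in> borel_measurable surface_measure"
proof -
  have "f \<in> borel_measurable (restrict_space borel S2)"
    using assms by (rule measurable_restrict_space1)
  thus ?thesis by (simp cong: measurable_cong_sets)
qed

lemma sphere_Collect_sets:
  assumes "{y. P y} \<in> sets borel"
  shows "{y \<in> S2. P y} \<in> sets surface_measure"
proof (rule measurable_surface_measure_subset)
  have "S2 \<inter> {y. P y} \<in> sets borel" using assms by measurable
  thus "{y \<in> S2. P y} \<in> sets borel" by (simp add: Int_def)
qed auto

lemma integral_surface_orthogonal_transformation:
  fixes f :: "real^3 \<Rightarrow> real^3" and g :: "real^3 \<Rightarrow> real"
  assumes f: "orthogonal_transformation f" and g: "g \<in> borel_measurable surface_measure"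
  shows "(LINT y|surface_measure. g (f y)) = (LINT y|surface_measure. g y)"
proof -
  have "(LINT y|surface_measure. g y) = (LINT y|distr surface_measure surface_measure f. g y)"
    by (simp add: surface_measure_distr_orthogonal_transformation[OF f])
  also have "\<dots> = (LINT y|surface_measure. g (f y))"
    by (rule integral_distr[OF orthogonal_transformation_measurable_sphere[OF f] g])
  finally show ?thesis by simp
qed

lemma measure_surface_cap_axis_pos:
  assumes s: "0 < s" "s \<le> 1"
  shows "measure surface_measure {y \<in> S2. s < y $ 3} = 2 * pi * (1 - s)"
  using emeasure_surface_cap_axis[OF s] s by (simp add: measure_def)

lemma measure_surface_reflect:
  assumes "{y. P y} \<in> sets borel"
  shows "measure surface_measure {y \<in> S2. P (- y)} = measure surface_measure {y \<in> S2. P y}"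
proof -
  have o: "orthogonal_transformation (uminus :: real^3 \<Rightarrow> real^3)"
    by (rule orthogonal_transformation_neg[THEN iffD2, of "\<lambda>x. x", simplified])
  have [measurable]: "{y. P y} \<inter> S2 \<in> sets borel" using assms by measurable
  hence m: "{y \<in> S2. P y} \<in> sets surface_measure"
    by (intro measurable_surface_measure_subset) (auto simp: Int_def conj_commute)
  have "measure surface_measure {y \<in> S2. P y}
      = measure (distr surface_measure surface_measure uminus) {y \<in> S2. P y}"
    by (simp add: surface_measure_distr_orthogonal_transformation[OF o])
  also have "\<dots> = measure surface_measure (uminus -` {y \<in> S2. P y} \<inter> S2)"
    by (subst measure_distr[OF orthogonal_transformation_measurable_sphere[OF o] m]) simp
  also have "uminus -` {y \<in> S2. P y} \<inter> S2 = {y \<in> S2. P (- y)}" by auto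
  finally show ?thesis by simp
qed

text \<open>Symmetry reduces everything to open caps with \<open>0 < s\<close>: for negative
  \<open>s\<close> the complement is a reflected closed cap, and closed caps are squeezed between
  open ones.\<close>

lemma measure_surface_cap_axis:
  assumes s: "-1 \<le> s" "s \<le> 1"
  shows "measure surface_measure {y \<in> S2. s < y $ 3} = 2 * pi * (1 - s)"
proof -
  let ?m = "measure surface_measure"
  have bm: "{y :: real^3. a < y $ 3} \<in> sets borel" "{y :: real^3. a \<le> y $ 3} \<in> sets borel"
    "{y :: real^3. y $ 3 < a} \<in> sets borel" "{y :: real^3. y $ 3 \<le> a} \<in> sets borel" for a
    by measurable
  note m = bm[THEN sphere_Collect_sets]
  have closed: "?m {y \<in> S2. a \<le> y $ 3} = 2 * pi * (1 - a)" if a: "0 < a" "a \<le> 1" for a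
  proof (rule antisym)
    have "2 * pi * (1 - a) = ?m {y \<in> S2. a < y $ 3}"
      by (rule measure_surface_cap_axis_pos[OF a, symmetric])
    also have "\<dots> \<le> ?m {y \<in> S2. a \<le> y $ 3}"
      by (rule surface.finite_measure_mono[OF _ m(2)]) auto
    finally show "2 * pi * (1 - a) \<le> ?m {y \<in> S2. a \<le> y $ 3}" .
    show "?m {y \<in> S2. a \<le> y $ 3} \<le> 2 * pi * (1 - a)"
    proof (rule field_le_epsilon)
      fix e :: real assume e: "0 < e"
      \<comment> \<open>\<open>b\<close> stays positive and is so close to \<open>a\<close> that the
        area grows by at most \<open>e\<close>.\<close>
      define b where "b = max (a / 2) (a - e / (2 * pi))"
      have b: "0 < b" "b < a" using a e pi_gt_zero by (auto simp: b_def less_max_iff_disj)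
      have "?m {y \<in> S2. a \<le> y $ 3} \<le> ?m {y \<in> S2. b < y $ 3}"
        using b by (intro surface.finite_measure_mono[OF _ m(1)]) auto
      also have "\<dots> = 2 * pi * (1 - b)"
        using b a by (intro measure_surface_cap_axis_pos) auto
      also have "\<dots> \<le> 2 * pi * (1 - (a - e / (2 * pi)))"
        by (intro mult_left_mono) (auto simp: b_def)
      also have "\<dots> = 2 * pi * (1 - a) + e" by (simp add: field_simps)
      finally show "?m {y \<in> S2. a \<le> y $ 3} \<le> 2 * pi * (1 - a) + e" .
    qed
  qed
  consider "0 < s" | "s < 0" | "s = 0" by linarith
  thus ?thesis
  proof cases
    case 1 thus ?thesis using measure_surface_cap_axis_pos s by auto
  next
    case 2
    have "?m {y \<in> S2. - s \<le> (- y) $ 3} = ?m {y \<in> S2. - s \<le> y $ 3}"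
      by (rule measure_surface_reflect) (rule bm)
    hence "?m {y \<in> S2. y $ 3 \<le> s} = 2 * pi * (1 + s)"
      using closed[of "-s"] s 2 by simp
    moreover have "?m {y \<in> S2. s < y $ 3} = ?m (S2 - {y \<in> S2. y $ 3 \<le> s})"
      by (rule arg_cong[of _ _ ?m]) auto
    moreover have "\<dots> = ?m S2 - ?m {y \<in> S2. y $ 3 \<le> s}"
      by (rule surface.finite_measure_Diff[OF _ m(4)])
        (auto intro!: measurable_surface_measure_subset simp del: sets_surface_measure)
    ultimately show ?thesis by (simp add: measure_surface_sphere algebra_simps)
  next
    \<comment> \<open>For the open hemisphere the upper bound holds because two disjoint copies fit
      into the sphere; caps of height \<open>1 - b\<close> with small \<open>b\<close> give the
      lower bound.\<close>
    case 3
    have ref: "?m {y \<in> S2. 0 < (- y) $ 3} = ?m {y \<in> S2. 0 < y $ 3}"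
      by (rule measure_surface_reflect) (rule bm)
    have "?m {y \<in> S2. 0 < y $ 3} + ?m {y \<in> S2. y $ 3 < 0} = ?m ({y \<in> S2. 0 < y $ 3} \<union> {y \<in> S2. y $ 3 < 0})"
      by (rule surface.finite_measure_Union[OF m(1) m(3), symmetric]) auto
    also have "\<dots> \<le> ?m S2"
      by (rule surface.finite_measure_mono)
        (auto intro!: measurable_surface_measure_subset simp del: sets_surface_measure)
    finally have up: "?m {y \<in> S2. 0 < y $ 3} \<le> 2 * pi" using ref by (simp add: measure_surface_sphere)
    have lo: "2 * pi \<le> ?m {y \<in> S2. 0 < y $ 3}"
    proof (rule field_le_epsilon)
      fix e :: real assume e: "0 < e"
      define b where "b = min 1 (e / (2 * pi))"
      have b: "0 < b" "b \<le> 1" "b \<le> e / (2 * pi)" using e by (auto simp: b_def)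
      have "2 * pi = 2 * pi * (1 - b) + 2 * pi * b" by (simp add: algebra_simps)
      also have "2 * pi * (1 - b) = ?m {y \<in> S2. b < y $ 3}"
        using b by (intro measure_surface_cap_axis_pos[symmetric]) auto
      also have "\<dots> \<le> ?m {y \<in> S2. 0 < y $ 3}"
        using b by (intro surface.finite_measure_mono[OF _ m(1)]) auto
      also have "2 * pi * b \<le> 2 * pi * (e / (2 * pi))" using b by (intro mult_left_mono) auto
      also have "\<dots> = e" by simp
      finally show "2 * pi \<le> ?m {y \<in> S2. 0 < y $ 3} + e" by simp
    qed
    show ?thesis using up lo 3 by simp
  qed
qed

section \<open>Distribution of a coordinate on the sphere\<close>

lemma exists_orthogonal_transformation_axis:
  fixes e :: "real^3"
  assumes "e \<in> S2"
  obtains R :: "real^3 \<Rightarrow> real^3" where "orthogonal_transformation R" "R (axis (3::3) 1) = e"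
  using rotation_rightward_line[of e 3] assms by (metis mem_sphere_0 scaleR_one)

text \<open>The area of a cap is linear in its height, so for the third coordinate both measures
  agree on the half-lines \<open>{s<..}\<close>, which determine them. A rotation carries the axis
  to \<open>e\<close>.\<close>

lemma Archimedes_hat_box:
  assumes e: "e \<in> S2"
  shows "distr surface_measure borel (\<lambda>y. e \<bullet> y)
    = density lborel (\<lambda>s. ennreal (2 * pi) * indicator {-1<..<1} s)"
proof -
  obtain R :: "real^3 \<Rightarrow> real^3" where R: "orthogonal_transformation R" "R (axis 3 1) = e"
    using exists_orthogonal_transformation_axis[OF e] .
  have bm: "(\<lambda>y. e \<bullet> y) \<in> borel_measurable surface_measure" for e :: "real^3" by measurable
  have "distr surface_measure borel (\<lambda>y. e \<bullet> y)
      = distr (distr surface_measure surface_measure R) borel (\<lambda>y. e \<bullet> y)"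
    by (simp add: surface_measure_distr_orthogonal_transformation[OF R(1)])
  also have "\<dots> = distr surface_measure borel (\<lambda>y. e \<bullet> R y)"
    by (subst distr_distr[OF bm orthogonal_transformation_measurable_sphere[OF R(1)]]) (simp add: o_def)
  also have "(\<lambda>y. e \<bullet> R y) = (\<lambda>y. y $ 3)"
    using R by (auto simp: orthogonal_transformation_def inner_axis' simp flip: R(2))
  also have "distr surface_measure borel (\<lambda>y. y $ 3) = density lborel (\<lambda>s. ennreal (2 * pi) * indicator {-1<..<1} s)"
  proof (rule measure_eqI_lessThan)
    have m3: "(\<lambda>y::real^3. y $ 3) \<in> borel_measurable surface_measure" by measurable
    fix s :: real
    have l: "emeasure (distr surface_measure borel (\<lambda>y. y $ 3)) {s<..}
        = ennreal (measure surface_measure {y \<in> S2. s < y $ 3})"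
      using m3 by (subst emeasure_distr) (auto simp: surface.emeasure_eq_measure intro!: arg_cong[of _ _ "measure _"])
    show "emeasure (distr surface_measure borel (\<lambda>y. y $ 3)) {s<..} < \<infinity>"
      unfolding l by simp
    have comp: "\<bar>y $ 3\<bar> \<le> 1" if "norm y = 1" for y :: "real^3"
      using component_le_norm_cart[of y 3] that by simp
    have "emeasure (density lborel (\<lambda>s. ennreal (2 * pi) * indicator {-1<..<1} s)) {s<..}
       = (\<integral>\<^sup>+x. ennreal (2 * pi) * indicator {max s (-1)<..<1} x \<partial>lborel)"
      by (subst emeasure_density) (auto intro!: nn_integral_cong simp: indicator_def)
    also have "\<dots> = ennreal (2 * pi) * emeasure lborel {max s (-1)<..<1}"
      by (rule nn_integral_cmult_indicator) simp
    finally have r: "emeasure (density lborel (\<lambda>s. ennreal (2 * pi) * indicator {-1<..<1} s)) {s<..}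
       = ennreal (2 * pi) * emeasure lborel {max s (-1)<..<1}" .
    show "emeasure (distr surface_measure borel (\<lambda>y. y $ 3)) {s<..} =
         emeasure (density lborel (\<lambda>s. ennreal (2 * pi) * indicator {-1<..<1} s)) {s<..}"
    proof -
      consider "s < -1" | "-1 \<le> s" "s \<le> 1" | "1 < s" by linarith
      thus ?thesis
      proof cases
        case 1
        have "{y \<in> S2. s < y $ 3} = S2" using comp 1 by force
        thus ?thesis unfolding l r using 1
          by (simp add: measure_surface_sphere max_def ennreal_mult'[symmetric] flip: ennreal_numeral)
      next
        case 2
        thus ?thesis unfolding l r measure_surface_cap_axis[OF 2]
          by (simp add: max_def ennreal_mult'[symmetric])
      next
        case 3
        have z: "{y \<in> S2. s < y $ 3} = {}" using comp 3 by force
        show ?thesis unfolding l r z using 3 by simp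
      qed
    qed
  qed simp_all
  finally show ?thesis .
qed

lemma
  fixes e :: "real^3" and \<Phi> :: "real \<Rightarrow> real"
  assumes e: "e \<in> S2" and \<Phi>: "set_integrable lborel {-1<..<1} \<Phi>"
  shows integrable_surface_zonal: "integrable surface_measure (\<lambda>y. \<Phi> (e \<bullet> y))"
    and integral_surface_zonal:
      "(LINT y|surface_measure. \<Phi> (e \<bullet> y)) = 2 * pi * (LINT s:{-1<..<1}|lborel. \<Phi> s)"
proof -
  let ?I = "\<lambda>s::real. indicator {-1<..<1} s :: real"
  let ?\<Psi> = "\<lambda>s. ?I s * \<Phi> s"
  \<comment> \<open>\<open>\<Phi>\<close> is measurable only on the open interval. Cutting it off
    outside and restoring the two endpoint values gives a Borel function that agrees with
    \<open>\<Phi>\<close> at every \<open>e \<bullet> y\<close>.\<close>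
  let ?\<Theta> = "\<lambda>s. ?\<Psi> s + \<Phi> 1 * indicator {1} s + \<Phi> (-1) * indicator {-1} s"
  have int: "integrable lborel ?\<Psi>" using \<Phi> by (simp add: set_integrable_def)
  hence [measurable]: "?\<Psi> \<in> borel_measurable borel"
    using borel_measurable_integrable[OF int] by simp
  have \<Theta> [measurable]: "?\<Theta> \<in> borel_measurable borel" by measurable
  have me: "(\<lambda>y. e \<bullet> y) \<in> borel_measurable surface_measure" by measurable
  have d: "(\<lambda>s. ennreal (2 * pi) * indicator {-1<..<1} s) = (\<lambda>s. ennreal (2 * pi * ?I s))"
    by (auto simp: indicator_def)
  have k: "(2 * pi * ?I s) *\<^sub>R ?\<Theta> s = 2 * pi * ?\<Psi> s" for s
    by (auto simp: indicator_def)
  have gm: "(\<lambda>s. 2 * pi * ?I s) \<in> borel_measurable lborel" by measurable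
  have \<Theta>l: "?\<Theta> \<in> borel_measurable lborel" using \<Theta> by simp
  have "integrable (distr surface_measure borel (\<lambda>y. e \<bullet> y)) ?\<Theta>"
    unfolding Archimedes_hat_box[OF e] d
    by (subst integrable_density[OF \<Theta>l gm]) (use int in \<open>simp_all only: k AE_I2, auto\<close>)
  hence int2: "integrable surface_measure (\<lambda>y. ?\<Theta> (e \<bullet> y))"
    by (subst (asm) integrable_distr_eq[OF me \<Theta>])
  have eq: "?\<Theta> (e \<bullet> y) = \<Phi> (e \<bullet> y)" if "y \<in> S2" for y
  proof -
    have "\<bar>e \<bullet> y\<bar> \<le> 1" using Cauchy_Schwarz_ineq2[of e y] e that by simp
    hence "e \<bullet> y = 1 \<or> e \<bullet> y = -1 \<or> e \<bullet> y \<in> {-1<..<1}" by auto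
    thus ?thesis by (auto simp: indicator_def)
  qed
  show "integrable surface_measure (\<lambda>y. \<Phi> (e \<bullet> y))"
  proof -
    have "integrable surface_measure (\<lambda>y. ?\<Theta> (e \<bullet> y)) = integrable surface_measure (\<lambda>y. \<Phi> (e \<bullet> y))"
      by (rule Bochner_Integration.integrable_cong[OF refl]) (use eq in auto)
    thus ?thesis using int2 by blast
  qed
  have "(LINT y|surface_measure. \<Phi> (e \<bullet> y)) = (LINT y|surface_measure. ?\<Theta> (e \<bullet> y))"
    by (rule Bochner_Integration.integral_cong) (use eq in auto)
  also have "\<dots> = (LINT s|distr surface_measure borel (\<lambda>y. e \<bullet> y). ?\<Theta> s)"
    by (rule integral_distr[OF me \<Theta>, symmetric])
  also have "\<dots> = (LINT s|lborel. (2 * pi * ?I s) *\<^sub>R ?\<Theta> s)"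
    unfolding Archimedes_hat_box[OF e] d
    by (rule integral_density[OF \<Theta>l gm]) auto
  also have "\<dots> = (LINT s|lborel. 2 * pi * ?\<Psi> s)" by (simp only: k)
  also have "\<dots> = 2 * pi * (LINT s:{-1<..<1}|lborel. \<Phi> s)"
    by (simp add: set_lebesgue_integral_def)
  finally show "(LINT y|surface_measure. \<Phi> (e \<bullet> y)) = 2 * pi * (LINT s:{-1<..<1}|lborel. \<Phi> s)" .
qed

section \<open>Continuous functions on the sphere\<close>

lemma borel_measurable_continuous_sphere:
  fixes v :: "real^3 \<Rightarrow> real"
  assumes "continuous_on S2 v"
  shows "v \<in> borel_measurable surface_measure"
proof -
  have "v \<in> borel_measurable (restrict_space borel S2)"
    using assms by (rule borel_measurable_continuous_on_restrict)
  thus ?thesis by (simp cong: measurable_cong_sets)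
qed

lemma continuous_on_sphere_bounded:
  fixes v :: "real^3 \<Rightarrow> real"
  assumes "continuous_on S2 v"
  obtains B where "B \<ge> 0" "\<And>y. y \<in> S2 \<Longrightarrow> \<bar>v y\<bar> \<le> B"
proof -
  have "compact (v ` S2)" using assms by (intro compact_continuous_image) auto
  then obtain B where "\<And>z. z \<in> v ` S2 \<Longrightarrow> norm z \<le> B" 
    using compact_imp_bounded bounded_iff by metis
  thus ?thesis by (intro that[of "max B 0"]) (auto intro: max.coboundedI1)
qed

lemma integrable_continuous_sphere:
  fixes v :: "real^3 \<Rightarrow> real"
  assumes "continuous_on S2 v"
  shows "integrable surface_measure v"
proof -
  obtain B where "\<And>y. y \<in> S2 \<Longrightarrow> \<bar>v y\<bar> \<le> B" using continuous_on_sphere_bounded[OF assms] by metis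
  thus ?thesis
    by (intro surface.integrable_const_bound[where B = B] borel_measurable_continuous_sphere assms) auto
qed

text \<open>Nonempty relatively open subsets of the sphere have positive measure.\<close>

lemma continuous_sphere_eq_0:
  fixes v :: "real^3 \<Rightarrow> real"
  assumes v: "continuous_on S2 v" and z: "(LINT y|surface_measure. (v y)\<^sup>2) = 0" and x: "x \<in> S2"
  shows "v x = 0"
proof -
  have i: "integrable surface_measure (\<lambda>y. (v y)\<^sup>2)"
    by (intro integrable_continuous_sphere continuous_intros v)
  have "AE y in surface_measure. (v y)\<^sup>2 = 0"
    using integral_nonneg_eq_0_iff_AE[OF i] z by auto
  hence ae: "AE y in surface_measure. v y = 0" by simp
  define U where "U = {y \<in> S2. v y \<noteq> 0}"
  obtain T where T: "open T" "U = S2 \<inter> T"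
  proof -
    have "openin (top_of_set S2) (S2 \<inter> v -` (- {0}))"
      using v by (intro continuous_openin_preimage_gen) auto
    moreover have "S2 \<inter> v -` (- {0}) = U" by (auto simp: U_def)
    ultimately show ?thesis using that by (auto simp: openin_open)
  qed
  have Ub: "U \<in> sets borel" using T by auto
  hence Um: "U \<in> sets surface_measure" by (intro measurable_surface_measure_subset) (auto simp: U_def)
  have U0: "emeasure surface_measure U = 0"
    using ae AE_iff_measurable[OF Um, of "\<lambda>y. v y = 0"] by (auto simp: U_def)
  \<comment> \<open>The truncated cone over the set where \<open>v\<close> differs from 0 is open
    and null, hence empty; it would contain half of \<open>x\<close> if \<open>v x\<close> were
    nonzero.\<close>
  let ?W = "{y \<in> ball 0 1 - {0}. sgn y \<in> U}"
  have W: "?W = {y \<in> ball 0 1 - {0}. sgn y \<in> T}" using T(2) by (auto simp: norm_sgn)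
  have "3 * emeasure lborel ?W = 0"
    using emeasure_surface_measure[OF Ub] U0 by (simp add: T(2))
  hence "emeasure lborel ?W = 0" by simp
  moreover have "open ?W"
  proof -
    have "continuous_on (ball 0 1 - {0}) (sgn :: real^3 \<Rightarrow> real^3)"
      unfolding sgn_div_norm by (intro continuous_intros) auto
    hence "open ((ball 0 1 - {0}) \<inter> sgn -` T)"
      using T(1) by (intro continuous_open_preimage) auto
    also have "(ball 0 1 - {0}) \<inter> sgn -` T = ?W" unfolding W by auto
    finally show ?thesis .
  qed
  ultimately have "?W = {}"
    using open_not_negligible[of ?W] by (auto simp: negligible_iff_emeasure0)
  hence "(1/2) *\<^sub>R x \<notin> ?W" by blast
  moreover have "(1/2) *\<^sub>R x \<in> ball 0 1 - {0}" "sgn ((1/2) *\<^sub>R x) = x"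
    using x by (auto simp: sgn_div_norm)
  ultimately have "x \<notin> U" by (simp only: mem_Collect_eq) blast
  thus ?thesis using x by (simp add: U_def)
qed

section \<open>Legendre polynomials\<close>

text \<open>Taylor's formula at \<open>t\<close>; it turns the derivative in Rodrigues' formula into
  the extraction of a coefficient.\<close>

lemma poly_higher_pderiv_eq_coeff:
  fixes p :: "real poly"
  shows "poly ((pderiv ^^ n) p) t = fact n * coeff (p \<circ>\<^sub>p [:t, 1:]) n"
proof -
  have "(pderiv ^^ n) p \<circ>\<^sub>p [:t, 1:] = (pderiv ^^ n) (p \<circ>\<^sub>p [:t, 1:])"
  proof (induction n)
    case (Suc n)
    thus ?case using Suc[symmetric] by (simp add: pderiv_pcompose pderiv_pCons)
  qed simp
  hence "poly ((pderiv ^^ n) p) t = poly ((pderiv ^^ n) (p \<circ>\<^sub>p [:t, 1:])) 0"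
    by (metis add.right_neutral mult.right_neutral poly_pCons poly_pcompose mult_zero_left poly_0)
  also have "\<dots> = fact n * coeff (p \<circ>\<^sub>p [:t, 1:]) n"
    by (simp add: poly_0_coeff_0 coeff_higher_pderiv pochhammer_fact)
  finally show ?thesis .
qed

text \<open>Coefficients of the solid zonal harmonic: with \<rho>^2 = 1 - t^2 the Legendre
  polynomial becomes a combination of \<rho>^(2 j) t^(l - 2 j), homogeneous of degree
  \<open>l\<close> in \<rho> and t. Circle means of harmonic polynomials come out in this
  form.\<close>

definition legendre_coeff :: "nat \<Rightarrow> nat \<Rightarrow> real" where
  "legendre_coeff l j = (-1) ^ j * fact l / (4 ^ j * (fact j)\<^sup>2 * fact (l - 2 * j))"

text \<open>The coefficient of \<open>h\<^sup>l\<close> in \<open>((t + h)\<^sup>2 - 1)\<^sup>l = ((t\<^sup>2 - 1) + 2 t h + h\<^sup>2)\<^sup>l\<close>, read off Rodrigues' formula.\<close>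

lemma poly_legendre:
  "poly (legendre l) t = (\<Sum>j\<le>l div 2. legendre_coeff l j * (1 - t\<^sup>2) ^ j * t ^ (l - 2 * j))"
proof -
  let ?a = "t\<^sup>2 - 1" and ?b = "2 * t"
  have "([:-1, 0, 1:] ^ l) \<circ>\<^sub>p [:t, 1:] = [:?a, ?b, 1:] ^ l"
  proof -
    have "[:-1, 0, 1:] \<circ>\<^sub>p [:t, 1:] = [:?a, ?b, 1:]"
      by (simp add: pcompose_pCons power2_eq_square)
    thus ?thesis by (induction l) (simp_all add: pcompose_mult pcompose_1 del: mult_pCons_left mult_pCons_right)
  qed
  also have "[:?a, ?b, 1:] = [:?a:] + monom 1 1 * [:?b, 1:]"
    by (simp add: monom_altdef)
  also have "\<dots> ^ l = (\<Sum>j\<le>l. of_nat (l choose j) * [:?a:] ^ j * (monom 1 1 * [:?b, 1:]) ^ (l - j))"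
    by (rule binomial_ring)
  also have "\<dots> = (\<Sum>j\<le>l. smult (of_nat (l choose j) * ?a ^ j) (monom 1 (l - j) * [:?b, 1:] ^ (l - j)))"
  proof (intro sum.cong refl)
    fix j
    have 1: "of_nat n * [:?a:] ^ j * P = smult (of_nat n * ?a ^ j) P" for n and P :: "real poly"
      by (simp add: of_nat_poly poly_const_pow mult.commute)
    have 2: "(monom 1 1 * P) ^ k = monom 1 k * P ^ k" for P :: "real poly" and k
      by (simp add: power_mult_distrib monom_power)
    show "of_nat (l choose j) * [:?a:] ^ j * (monom 1 1 * [:?b, 1:]) ^ (l - j)
        = smult (of_nat (l choose j) * ?a ^ j) (monom 1 (l - j) * [:?b, 1:] ^ (l - j))"
      by (simp only: 1 2)
  qed
  finally have e: "([:-1, 0, 1:] ^ l) \<circ>\<^sub>p [:t, 1:]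
      = (\<Sum>j\<le>l. smult (of_nat (l choose j) * ?a ^ j) (monom 1 (l - j) * [:?b, 1:] ^ (l - j)))" .
  have c: "coeff (monom 1 (l - j) * [:?b, 1:] ^ (l - j)) l = of_nat ((l - j) choose j) * ?b ^ (l - j - j)"
    if "j \<le> l" for j
  proof -
    have "[:?b, 1:] ^ (l - j) = (\<Sum>i\<le>l - j. of_nat ((l - j) choose i) * monom 1 i * [:?b:] ^ (l - j - i))"
    proof -
      have "[:?b, 1:] = monom 1 1 + [:?b:]" by (simp add: monom_altdef)
      thus ?thesis by (simp only: binomial_ring monom_power) (simp only: power_one mult_1)
    qed
    also have "\<dots> = (\<Sum>i\<le>l - j. monom (of_nat ((l - j) choose i) * ?b ^ (l - j - i)) i)"
      by (intro sum.cong refl)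
         (simp add: of_nat_poly poly_const_pow smult_monom mult.commute)
    finally have e: "[:?b, 1:] ^ (l - j)
      = (\<Sum>i\<le>l - j. monom (of_nat ((l - j) choose i) * ?b ^ (l - j - i)) i)" .
    have "coeff (monom 1 (l - j) * [:?b, 1:] ^ (l - j)) l = coeff ([:?b, 1:] ^ (l - j)) j"
      using that by (simp add: coeff_monom_mult)
    also have "\<dots> = (\<Sum>i\<le>l - j. if i = j then of_nat ((l - j) choose i) * ?b ^ (l - j - i) else 0)"
      unfolding e by (simp add: coeff_sum)
    also have "\<dots> = of_nat ((l - j) choose j) * ?b ^ (l - j - j)"
      by (cases "j \<le> l - j") (simp_all add: binomial_eq_0)
    finally show ?thesis .
  qed
  have "poly (legendre l) t = coeff (([:-1, 0, 1:] ^ l) \<circ>\<^sub>p [:t, 1:]) l / 2 ^ l"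
    by (simp add: legendre_def poly_higher_pderiv_eq_coeff)
  also have "\<dots> = (\<Sum>j\<le>l. of_nat (l choose j) * ?a ^ j * (of_nat ((l - j) choose j) * ?b ^ (l - j - j))) / 2 ^ l"
    unfolding e by (simp add: coeff_sum c)
  also have "(\<Sum>j\<le>l. of_nat (l choose j) * ?a ^ j * (of_nat ((l - j) choose j) * ?b ^ (l - j - j)))
     = (\<Sum>j\<le>l div 2. of_nat (l choose j) * ?a ^ j * (of_nat ((l - j) choose j) * ?b ^ (l - j - j)))"
    by (rule sum.mono_neutral_right) (auto simp: binomial_eq_0)
  also have "\<dots> / 2 ^ l = (\<Sum>j\<le>l div 2. legendre_coeff l j * (1 - t\<^sup>2) ^ j * t ^ (l - 2 * j))"
    unfolding sum_divide_distrib
  proof (intro sum.cong refl)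
    fix j assume "j \<in> {..l div 2}"
    hence j: "2 * j \<le> l" by simp
    have 1: "real (l choose j) * real ((l - j) choose j) = fact l / ((fact j)\<^sup>2 * fact (l - 2 * j))"
      using j by (simp add: binomial_fact power2_eq_square mult_2)
    have 2: "?a ^ j = (-1) ^ j * (1 - t\<^sup>2) ^ j"
      by (simp flip: power_mult_distrib)
    have 3: "?b ^ (l - j - j) = 2 ^ l / 4 ^ j * t ^ (l - 2 * j)"
    proof -
      have "(2::real) ^ l = 2 ^ (l - 2 * j) * 2 ^ (2 * j)" using j by (simp flip: power_add)
      hence "2 ^ l / 4 ^ j = (2::real) ^ (l - 2 * j)" by (simp add: power_mult)
      moreover have "l - j - j = l - 2 * j" by simp
      ultimately show ?thesis by (simp only: power_mult_distrib)
    qed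
    have "of_nat (l choose j) * ?a ^ j * (of_nat ((l - j) choose j) * ?b ^ (l - j - j)) / 2 ^ l
       = (real (l choose j) * real ((l - j) choose j)) * ?a ^ j * ?b ^ (l - j - j) / 2 ^ l"
      by simp
    also have "\<dots> = legendre_coeff l j * (1 - t\<^sup>2) ^ j * t ^ (l - 2 * j)"
      unfolding 1 2 3 legendre_coeff_def by (simp add: mult_ac)
    finally show "of_nat (l choose j) * ?a ^ j * (of_nat ((l - j) choose j) * ?b ^ (l - j - j)) / 2 ^ l
       = legendre_coeff l j * (1 - t\<^sup>2) ^ j * t ^ (l - 2 * j)" .
  qed
  finally show ?thesis .
qed

lemma legendre_coeff_0 [simp]: "legendre_coeff l 0 = 1"
  by (simp add: legendre_coeff_def)

lemma poly_legendre_1 [simp]: "poly (legendre l) 1 = 1"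
proof -
  have "poly (legendre l) 1 = (\<Sum>j\<le>l div 2. if j = 0 then 1 else 0)"
    unfolding poly_legendre by (intro sum.cong) auto
  thus ?thesis by simp
qed

text \<open>Laplace's equation imposes this relation on circle means; with the value 1 at
  \<open>j = 0\<close> it determines all the coefficients.\<close>

lemma legendre_coeff_Suc:
  assumes "2 * Suc j \<le> l"
  shows "4 * (real (Suc j))\<^sup>2 * legendre_coeff l (Suc j)
    = - (real (l - 2 * j) * real (l - 2 * j - 1) * legendre_coeff l j)"
proof -
  obtain m where m: "l = 2 * Suc j + m" using assms le_Suc_ex by blast
  have f: "fact (Suc (Suc m)) = real (Suc (Suc m)) * real (Suc m) * fact m" by (simp add: algebra_simps)
  have "l - 2 * j = Suc (Suc m)" "l - 2 * Suc j = m" using m by auto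
  thus ?thesis unfolding legendre_coeff_def
    by (simp add: f power2_eq_square divide_simps del: fact_Suc of_nat_Suc) 
       (simp add: algebra_simps)
qed

lemma abs_legendre_coeff_le:
  assumes "2 * j \<le> l"
  shows "\<bar>legendre_coeff l j\<bar> \<le> (real l)\<^sup>2 ^ j / 4 ^ j"
proof -
  have 1: "fact l / fact (l - 2 * j) \<le> real l ^ (2 * j)"
    using fact_div_fact_le_pow[of "2 * j" l] assms
    by (metis fact_fact_dvd_fact of_nat_fact of_nat_le_iff of_nat_power real_of_nat_div fact_dvd diff_le_self)
  have "\<bar>legendre_coeff l j\<bar> = (fact l / fact (l - 2 * j)) / (4 ^ j * (fact j)\<^sup>2)"
    by (simp add: legendre_coeff_def abs_mult)
  also have "\<dots> \<le> (fact l / fact (l - 2 * j)) / (4 ^ j * 1)"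
    by (intro divide_left_mono mult_left_mono) (auto simp: one_le_power fact_ge_1)
  also have "\<dots> \<le> real l ^ (2 * j) / (4 ^ j * 1)"
    by (intro divide_right_mono 1) simp
  finally show ?thesis by (simp add: power_mult)
qed

text \<open>So close to 1 the term \<open>j = 0\<close> dominates: Bernoulli's inequality gives
  \<open>t ^ l \<ge> 3 / 4\<close>, while the term of index \<open>j\<close> is at most (1/8)^j in
  absolute value, and these sum to at most 1/7.\<close>

lemma poly_legendre_ge_half:
  assumes t: "1 - 1 / (4 * (real l + 1)\<^sup>2) \<le> t" "t \<le> 1"
  shows "1 / 2 \<le> poly (legendre l) t"
proof (cases "l = 0")
  case True
  thus ?thesis by (simp add: poly_legendre)
next
  case False
  define d where "d = 1 - t"
  have l1: "1 \<le> real l" using False by simp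
  have d: "0 \<le> d" "d \<le> 1 / (4 * (real l + 1)\<^sup>2)" using t by (auto simp: d_def)
  have "1 / (4 * (real l + 1)\<^sup>2) \<le> 1 / (4 * (real l)\<^sup>2)"
    using l1 by (intro divide_left_mono mult_left_mono power_mono) auto
  hence "d * (real l)\<^sup>2 \<le> 1 / (4 * (real l)\<^sup>2) * (real l)\<^sup>2"
    using d by (intro mult_right_mono) auto
  hence dl: "d * (real l)\<^sup>2 \<le> 1 / 4" using l1 by simp
  have "d * real l \<le> d * (real l)\<^sup>2" using d l1 by (intro mult_left_mono) (auto simp: power2_eq_square)
  hence dl1: "d * real l \<le> 1 / 4" using dl by linarith
  have d1: "d \<le> d * real l" using d(1) l1 by (simp add: mult_le_cancel_left1)
  have t0: "0 \<le> t" using d1 dl1 by (simp add: d_def)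
  have tl: "t ^ l \<ge> 3 / 4"
  proof -
    have "1 + real l * (t - 1) \<le> (1 + (t - 1)) ^ l"
      using t0 by (intro Bernoulli_inequality) auto
    thus ?thesis using dl1 by (simp add: d_def algebra_simps)
  qed
  have "poly (legendre l) t = legendre_coeff l 0 * (1 - t\<^sup>2) ^ 0 * t ^ (l - 2 * 0) +
      (\<Sum>j\<in>{..l div 2} - {0}. legendre_coeff l j * (1 - t\<^sup>2) ^ j * t ^ (l - 2 * j))"
    unfolding poly_legendre by (rule sum.remove) auto
  hence e: "poly (legendre l) t = t ^ l +
      (\<Sum>j\<in>{..l div 2} - {0}. legendre_coeff l j * (1 - t\<^sup>2) ^ j * t ^ (l - 2 * j))" by simp
  have "\<bar>\<Sum>j\<in>{..l div 2} - {0}. legendre_coeff l j * (1 - t\<^sup>2) ^ j * t ^ (l - 2 * j)\<bar>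
     \<le> (\<Sum>j\<in>{..l div 2} - {0}. (1 / 8) ^ j)"
  proof (intro order_trans[OF sum_abs] sum_mono)
    fix j assume "j \<in> {..l div 2} - {0}"
    hence j: "2 * j \<le> l" by auto
    have u: "0 \<le> 1 - t\<^sup>2" "1 - t\<^sup>2 \<le> 2 * d"
    proof -
      show "0 \<le> 1 - t\<^sup>2" using t0 t by (simp add: power_le_one)
      have "1 - t\<^sup>2 = 2 * d - d\<^sup>2" by (simp add: d_def power2_eq_square algebra_simps)
      thus "1 - t\<^sup>2 \<le> 2 * d" by simp
    qed
    have "\<bar>legendre_coeff l j * (1 - t\<^sup>2) ^ j * t ^ (l - 2 * j)\<bar>
       = \<bar>legendre_coeff l j\<bar> * (1 - t\<^sup>2) ^ j * t ^ (l - 2 * j)"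
      using u t0 by (simp add: abs_mult)
    also have "\<dots> \<le> ((real l)\<^sup>2 ^ j / 4 ^ j) * (2 * d) ^ j * 1"
      using j u t0 t by (intro mult_mono abs_legendre_coeff_le power_mono power_le_one) auto
    also have "\<dots> = ((real l)\<^sup>2 / 4 * (2 * d)) ^ j"
      by (simp only: power_mult_distrib power_divide mult_1_right)
    also have "\<dots> \<le> (1 / 8) ^ j"
      using dl d by (intro power_mono) auto
    finally show "\<bar>legendre_coeff l j * (1 - t\<^sup>2) ^ j * t ^ (l - 2 * j)\<bar> \<le> (1 / 8) ^ j" .
  qed
  also have "(\<Sum>j\<in>{..l div 2} - {0}. (1 / 8 :: real) ^ j) \<le> 1 / 7"
  proof -
    have s: "(\<Sum>j\<in>{..l div 2}. (1 / 8 :: real) ^ j) \<le> 8 / 7"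
    proof -
      have "(\<Sum>j\<in>{..l div 2}. (1 / 8 :: real) ^ j) \<le> (\<Sum>j. (1 / 8 :: real) ^ j)"
        by (rule sum_le_suminf) (auto intro: summable_geometric)
      thus ?thesis by (simp add: suminf_geometric)
    qed
    have "(\<Sum>j\<in>{..l div 2}. (1 / 8 :: real) ^ j) = (1 / 8) ^ 0 + (\<Sum>j\<in>{..l div 2} - {0}. (1 / 8 :: real) ^ j)"
      by (rule sum.remove) auto
    thus ?thesis using s by simp
  qed
  finally show ?thesis using e tl by linarith
qed

lemma set_integrable_poly: "set_integrable lborel {-1<..<1} (poly p :: real \<Rightarrow> real)"
proof -
  have "set_integrable lborel {-1..1} (poly p :: real \<Rightarrow> real)"
    by (rule borel_integrable_atLeastAtMost') (intro continuous_intros)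
  thus ?thesis by (rule set_integrable_subset) auto
qed

lemma integral_pderiv:
  "(LINT s:{-1<..<1}|lborel. poly (pderiv p) s) = poly p 1 - poly p (-1 :: real)"
proof -
  have "(LBINT s=ereal (-1)..ereal 1. poly (pderiv p) s) = poly p 1 - poly p (-1)"
    by (rule interval_integral_FTC_finite)
       (auto intro!: continuous_intros derivative_eq_intros
          simp flip: has_real_derivative_iff_has_vector_derivative)
  thus ?thesis by (simp add: interval_lebesgue_integral_def einterval_eq del: uminus_ereal.simps)
qed

text \<open>Repeated integration by parts: the power in Rodrigues' formula has zeros of order
  \<open>l\<close> at both endpoints, so boundary terms vanish, and \<open>p\<close> is
  differentiated until nothing is left.\<close>

lemma integral_legendre_orthogonal:
  assumes "degree p < l"
  shows "(LINT s:{-1<..<1}|lborel. poly (p * legendre l) s) = 0"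
proof -
  let ?u = "[:-1, 0, 1:] ^ l :: real poly"
  have dvd: "[:-1, 0, 1:] ^ (l - i) dvd (pderiv ^^ i) ?u" if "i \<le> l" for i
    using that
  proof (induction i)
    case (Suc i)
    then obtain w where w: "(pderiv ^^ i) ?u = [:-1, 0, 1:] ^ (l - i) * w" by (auto elim: dvdE)
    obtain k where k: "l - i = Suc k" "l - Suc i = k" using Suc.prems by (metis Suc_diff_Suc Suc_le_lessD)
    have "(pderiv ^^ Suc i) ?u = [:-1, 0, 1:] ^ k * ([:-1, 0, 1:] * pderiv w
        + smult (real (Suc k)) (w * pderiv [:-1, 0, 1:]))"
    proof -
      have "pderiv (a ^ Suc k * w) = a ^ k * (a * pderiv w + smult (real (Suc k)) (w * pderiv a))"
        for a :: "real poly"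
        unfolding pderiv_mult pderiv_power_Suc by (simp add: algebra_simps smult_add_left smult_add_right)
      thus ?thesis using w by (simp only: k funpow.simps o_apply)
    qed
    thus ?case by (simp only: k(2) dvd_triv_left)
  qed simp
  have vanish: "poly ((pderiv ^^ i) ?u) s = 0" if il: "i < l" "s = 1 \<or> s = -1" for i s
  proof -
    obtain w where w: "(pderiv ^^ i) ?u = [:-1, 0, 1:] ^ (l - i) * w"
      using dvd[OF less_imp_le[OF il(1)]] unfolding dvd_def by blast
    show ?thesis unfolding w using il by (auto simp: poly_power)
  qed
  \<comment> \<open>Generalised over \<open>p\<close> and the number of derivatives. The base case
    is vacuous; a constant \<open>p\<close> is treated apart because its degree cannot drop.\<close>
  have "(LINT s:{-1<..<1}|lborel. poly (p * (pderiv ^^ i) ?u) s) = 0"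
    if "i \<le> l" "degree p < i" for i p
    using that
  proof (induction i arbitrary: p)
    case (Suc i)
    let ?D = "(pderiv ^^ i) ?u"
    have 1: "(LINT s:{-1<..<1}|lborel. poly (pderiv (p * ?D)) s) = 0"
      unfolding integral_pderiv using vanish[of i] Suc.prems by simp
    have 2: "(LINT s:{-1<..<1}|lborel. poly (pderiv p * ?D) s) = 0"
    proof (cases "pderiv p = 0")
      case False
      hence "degree p \<noteq> 0" by (simp add: pderiv_eq_0_iff)
      hence "degree (pderiv p) < i" using Suc.prems by (simp add: degree_pderiv)
      thus ?thesis using Suc by simp
    qed simp
    have "poly (pderiv (p * ?D)) s = poly (p * (pderiv ^^ Suc i) ?u) s + poly (pderiv p * ?D) s" for s
      by (simp add: pderiv_mult algebra_simps)
    hence "(LINT s:{-1<..<1}|lborel. poly (pderiv (p * ?D)) s)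
       = (LINT s:{-1<..<1}|lborel. poly (p * (pderiv ^^ Suc i) ?u) s) + (LINT s:{-1<..<1}|lborel. poly (pderiv p * ?D) s)"
      by (simp only: set_integral_add(2)[OF set_integrable_poly set_integrable_poly])
    thus ?case using 1 2 by simp
  qed simp
  from this[of l p] assms
  have "(LINT s:{-1<..<1}|lborel. poly (p * (pderiv ^^ l) ?u) s) = 0" by simp
  moreover have "poly (p * legendre l) s = 1 / (2 ^ l * fact l) * poly (p * (pderiv ^^ l) ?u) s" for s
    by (simp add: legendre_def)
  ultimately show ?thesis by (simp only: set_integral_mult_right mult_zero_right)
qed

section \<open>Harmonic polynomials\<close>

text \<open>A trivariate polynomial is given by a list of terms \<open>(C, a, b, c)\<close> representing \<open>C x\<^sup>a y\<^sup>b z\<^sup>c\<close>.\<close>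

definition monomials :: "(real \<times> nat \<times> nat \<times> nat) list \<Rightarrow> real^3 \<Rightarrow> real" where
  "monomials xs x = (\<Sum>(C, a, b, c)\<leftarrow>xs. C * x$1 ^ a * x$2 ^ b * x$3 ^ c)"

lemma monomials_simps [simp]:
  "monomials [] x = 0"
  "monomials ((C, a, b, c) # xs) x = C * x$1 ^ a * x$2 ^ b * x$3 ^ c + monomials xs x"
  by (simp_all add: monomials_def)

lemma monomials_append [simp]: "monomials (xs @ ys) x = monomials xs x + monomials ys x"
  by (simp add: monomials_def)

lemma monomials_mult: "\<exists>zs. \<forall>x. monomials zs x = monomials xs x * monomials ys x"
proof (induction xs)
  case Nil
  show ?case by (intro exI[of _ "[]"]) simp
next
  case (Cons m xs)
  obtain zs where zs: "\<And>x. monomials zs x = monomials xs x * monomials ys x" using Cons by blast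
  obtain C a b c where m: "m = (C, a, b, c)" by (cases m) auto
  let ?f = "\<lambda>(C', a', b', c'). (C * C', a + a', b + b', c + c')"
  have "monomials (map ?f ys) x = C * x$1 ^ a * x$2 ^ b * x$3 ^ c * monomials ys x" for x
    by (induction ys) (auto simp: algebra_simps power_add)
  hence "monomials (map ?f ys @ zs) x = monomials (m # xs) x * monomials ys x" for x
    by (simp add: m zs algebra_simps)
  thus ?case by blast
qed

lemma vec3_expand: "vec3 (x$1) (x$2) (x$3) = x"
  by (simp add: vec_eq_iff forall_3 axis_def)

lemma real_polynomial_function_imp_monomials:
  fixes p :: "real^3 \<Rightarrow> real"
  assumes "real_polynomial_function p"
  shows "\<exists>xs. p = monomials xs"
  using assms
proof induction
  case (linear f)
  interpret bounded_linear f by fact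
  have "f x = monomials [(f (axis 1 1), 1, 0, 0), (f (axis 2 1), 0, 1, 0), (f (axis 3 1), 0, 0, 1)] x" for x
  proof -
    have "f x = f (vec3 (x$1) (x$2) (x$3))" by (simp add: vec3_expand)
    thus ?thesis by (simp add: add scaleR)
  qed
  thus ?case by blast
next
  case (const c)
  have "(\<lambda>x. c) = monomials [(c, 0, 0, 0)]" by auto
  thus ?case by blast
next
  case (add f g)
  then obtain xs ys where "f = monomials xs" "g = monomials ys" by blast
  hence "(\<lambda>x. f x + g x) = monomials (xs @ ys)" by auto
  thus ?case by blast
next
  case (mult f g)
  then obtain xs ys where "f = monomials xs" "g = monomials ys" by blast
  thus ?case using monomials_mult[of xs ys] by (metis (no_types) ext)
qed

text \<open>A list of terms is not unique, so terms of the wrong degree are discarded rather than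
  shown to be zero. Along a ray \<open>p\<close> is a polynomial in \<open>s\<close>; homogeneity
  identifies \<open>p x\<close> with its coefficient at s^l, to which only terms of total degree
  \<open>l\<close> contribute.\<close>

lemma homogeneous_imp_monomials:
  fixes p :: "real^3 \<Rightarrow> real"
  assumes p: "real_polynomial_function p" and hom: "\<And>s x. p (s *\<^sub>R x) = s ^ l * p x"
  obtains xs where "p = monomials xs" "\<And>C a b c. (C, a, b, c) \<in> set xs \<Longrightarrow> a + b + c = l"
proof -
  obtain xs where xs: "p = monomials xs" using real_polynomial_function_imp_monomials[OF p] by blast
  let ?d = "\<lambda>(C, a, b, c). a + b + c = l"
  have "p x = monomials (filter ?d xs) x" for x
  proof -
    define P where "P = (\<Sum>(C, a, b, c)\<leftarrow>xs. monom (C * x$1 ^ a * x$2 ^ b * x$3 ^ c) (a + b + c))"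
    have "poly P s = p (s *\<^sub>R x)" for s
      unfolding P_def xs by (induction xs) (auto simp: poly_monom power_mult_distrib power_add algebra_simps)
    hence "poly P s = poly (monom (p x) l) s" for s by (simp add: hom poly_monom mult.commute)
    hence "P = monom (p x) l" by (intro poly_eq_poly_eq_iff[THEN iffD1] ext)
    hence "coeff P l = p x" by simp
    moreover have "coeff P l = monomials (filter ?d xs) x"
      unfolding P_def by (induction xs) auto
    ultimately show ?thesis by simp
  qed
  thus ?thesis by (intro that[of "filter ?d xs"]) auto
qed

section \<open>The Laplacian of polynomials\<close>

lemma deriv_deriv_poly:
  fixes P :: "real poly"
  assumes "\<And>s. F s = poly P s"
  shows "(deriv ^^ 2) F s = poly (pderiv (pderiv P)) s"
proof -
  have "deriv (poly Q) = poly (pderiv Q)" for Q :: "real poly"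
    by (rule ext, rule DERIV_imp_deriv, rule poly_DERIV)
  moreover have "F = poly P" using assms by auto
  ultimately show ?thesis by (simp add: numeral_2_eq_2)
qed

lemma sum_Basis_real3: "(\<Sum>e\<in>(Basis :: (real^3) set). f e) = f (axis 1 1) + f (axis 2 1) + f (axis 3 1)"
proof -
  have B: "(Basis :: (real^3) set) = {axis 1 1, axis 2 1, axis 3 1}"
    by (auto simp: Basis_vec_def UNIV_3)
  show ?thesis unfolding B by (simp add: axis_eq_axis add.assoc)
qed

lemma poly_pderiv_pderiv_linear_power:
  "poly (pderiv (pderiv ([:x, 1:] ^ a))) (0::real) = real a * real (a - 1) * x ^ (a - 2)"
proof -
  have "pderiv ([:x, 1:] ^ n) = smult (of_nat n) ([:x, 1:] ^ (n - 1))" for n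
    by (cases n) (simp_all only: power_0 pderiv_1 pderiv_power_Suc, simp_all add: pderiv_pCons)
  thus ?thesis by (simp add: pderiv_smult poly_power numeral_2_eq_2)
qed

text \<open>For exponents below 2 the truncated subtraction is harmless, as the factor
  \<open>real a * real (a - 1)\<close> and its analogues are then 0.\<close>

lemma laplacian_monomials:
  "laplacian (monomials xs) x = (\<Sum>(C, a, b, c)\<leftarrow>xs.
      C * (real a * real (a - 1) * x$1 ^ (a - 2) * x$2 ^ b * x$3 ^ c
         + real b * real (b - 1) * x$1 ^ a * x$2 ^ (b - 2) * x$3 ^ c
         + real c * real (c - 1) * x$1 ^ a * x$2 ^ b * x$3 ^ (c - 2)))"
proof -
  have 1: "(deriv ^^ 2) (\<lambda>s. monomials xs (x + s *\<^sub>R axis 1 1)) 0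
     = (\<Sum>(C, a, b, c)\<leftarrow>xs. C * (real a * real (a - 1) * x$1 ^ (a - 2) * x$2 ^ b * x$3 ^ c))"
  proof (subst deriv_deriv_poly[of _ "\<Sum>(C, a, b, c)\<leftarrow>xs. smult (C * x$2 ^ b * x$3 ^ c) ([:x$1, 1:] ^ a)"])
    show "monomials xs (x + s *\<^sub>R axis 1 1) =
      poly (\<Sum>(C, a, b, c)\<leftarrow>xs. smult (C * x$2 ^ b * x$3 ^ c) ([:x$1, 1:] ^ a)) s" for s
      by (induction xs) (auto simp: axis_def poly_power)
  qed (induction xs, auto simp: pderiv_add pderiv_smult poly_pderiv_pderiv_linear_power)
  have 2: "(deriv ^^ 2) (\<lambda>s. monomials xs (x + s *\<^sub>R axis 2 1)) 0
     = (\<Sum>(C, a, b, c)\<leftarrow>xs. C * (real b * real (b - 1) * x$1 ^ a * x$2 ^ (b - 2) * x$3 ^ c))"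
  proof (subst deriv_deriv_poly[of _ "\<Sum>(C, a, b, c)\<leftarrow>xs. smult (C * x$1 ^ a * x$3 ^ c) ([:x$2, 1:] ^ b)"])
    show "monomials xs (x + s *\<^sub>R axis 2 1) =
      poly (\<Sum>(C, a, b, c)\<leftarrow>xs. smult (C * x$1 ^ a * x$3 ^ c) ([:x$2, 1:] ^ b)) s" for s
      by (induction xs) (auto simp: axis_def poly_power)
  qed (induction xs, auto simp: pderiv_add pderiv_smult poly_pderiv_pderiv_linear_power)
  have 3: "(deriv ^^ 2) (\<lambda>s. monomials xs (x + s *\<^sub>R axis 3 1)) 0
     = (\<Sum>(C, a, b, c)\<leftarrow>xs. C * (real c * real (c - 1) * x$1 ^ a * x$2 ^ b * x$3 ^ (c - 2)))"
  proof (subst deriv_deriv_poly[of _ "\<Sum>(C, a, b, c)\<leftarrow>xs. smult (C * x$1 ^ a * x$2 ^ b) ([:x$3, 1:] ^ c)"])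
    show "monomials xs (x + s *\<^sub>R axis 3 1) =
      poly (\<Sum>(C, a, b, c)\<leftarrow>xs. smult (C * x$1 ^ a * x$2 ^ b) ([:x$3, 1:] ^ c)) s" for s
      by (induction xs) (auto simp: axis_def poly_power)
  qed (induction xs, auto simp: pderiv_add pderiv_smult poly_pderiv_pderiv_linear_power)
  show ?thesis unfolding laplacian_def sum_Basis_real3 1 2 3
    by (induction xs) (auto simp: algebra_simps)
qed

text \<open>That the Hessian \<open>2 H\<close> serves all directions \<open>e\<close> makes the Laplacian rotation invariant.\<close>

lemma real_polynomial_function_taylor2:
  fixes p :: "real^3 \<Rightarrow> real"
  assumes "real_polynomial_function p"
  shows "\<exists>g H. \<forall>e. \<exists>P. (\<forall>s. p (x + s *\<^sub>R e) = poly P s) \<and>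
     coeff P 1 = (\<Sum>i\<in>UNIV. g i * e$i) \<and> coeff P 2 = (\<Sum>i\<in>UNIV. \<Sum>j\<in>UNIV. H i j * (e$i * e$j))"
  using assms
proof induction
  case (linear f)
  interpret bounded_linear f by fact
  have fe: "f e = (\<Sum>i\<in>UNIV. f (axis i 1) * e$i)" for e :: "real^3"
  proof -
    have "f e = f (vec3 (e$1) (e$2) (e$3))" by (simp add: vec3_expand)
    thus ?thesis by (simp add: add scaleR sum_3)
  qed
  show ?case
  proof (intro exI allI conjI)
    fix e show "f (x + s *\<^sub>R e) = poly [:f x, f e:] s" for s by (simp add: add scaleR)
    show "coeff [:f x, f e:] 1 = (\<Sum>i\<in>UNIV. f (axis i 1) * e$i)" by (simp add: fe[symmetric])
    show "coeff [:f x, f e:] 2 = (\<Sum>i\<in>UNIV. \<Sum>j\<in>UNIV. 0 * (e$i * e$j))"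
      by (simp add: numeral_2_eq_2)
  qed
next
  case (const c)
  show ?case
    by (intro exI[of _ "\<lambda>_. 0"] exI[of _ "\<lambda>_ _. 0"] allI exI[of _ "[:c:]"]) (simp add: numeral_2_eq_2)
next
  case (add f1 f2)
  obtain g H where 1: "\<forall>e. \<exists>P. (\<forall>s. f1 (x + s *\<^sub>R e) = poly P s) \<and>
     coeff P 1 = (\<Sum>i\<in>UNIV. g i * e$i) \<and> coeff P 2 = (\<Sum>i\<in>UNIV. \<Sum>j\<in>UNIV. H i j * (e$i * e$j))"
    using add by blast
  obtain g' H' where 2: "\<forall>e. \<exists>P. (\<forall>s. f2 (x + s *\<^sub>R e) = poly P s) \<and>
     coeff P 1 = (\<Sum>i\<in>UNIV. g' i * e$i) \<and> coeff P 2 = (\<Sum>i\<in>UNIV. \<Sum>j\<in>UNIV. H' i j * (e$i * e$j))"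
    using add by blast
  show ?case
  proof (rule exI[of _ "\<lambda>i. g i + g' i"], rule exI[of _ "\<lambda>i j. H i j + H' i j"], rule allI)
    fix e
    obtain P where P: "\<And>s. f1 (x + s *\<^sub>R e) = poly P s"
     "coeff P 1 = (\<Sum>i\<in>UNIV. g i * e$i)" "coeff P 2 = (\<Sum>i\<in>UNIV. \<Sum>j\<in>UNIV. H i j * (e$i * e$j))"
      using 1 by blast
    obtain P' where P': "\<And>s. f2 (x + s *\<^sub>R e) = poly P' s"
     "coeff P' 1 = (\<Sum>i\<in>UNIV. g' i * e$i)" "coeff P' 2 = (\<Sum>i\<in>UNIV. \<Sum>j\<in>UNIV. H' i j * (e$i * e$j))"
      using 2 by blast
    show "\<exists>P. (\<forall>s. f1 (x + s *\<^sub>R e) + f2 (x + s *\<^sub>R e) = poly P s) \<and>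
      coeff P 1 = (\<Sum>i\<in>UNIV. (g i + g' i) * e$i) \<and>
      coeff P 2 = (\<Sum>i\<in>UNIV. \<Sum>j\<in>UNIV. (H i j + H' i j) * (e$i * e$j))"
      by (rule exI[of _ "P + P'"]) (simp add: P P' P(2)[unfolded One_nat_def] P'(2)[unfolded One_nat_def] sum.distrib distrib_right)
  qed
next
  case (mult f1 f2)
  obtain g H where 1: "\<forall>e. \<exists>P. (\<forall>s. f1 (x + s *\<^sub>R e) = poly P s) \<and>
     coeff P 1 = (\<Sum>i\<in>UNIV. g i * e$i) \<and> coeff P 2 = (\<Sum>i\<in>UNIV. \<Sum>j\<in>UNIV. H i j * (e$i * e$j))"
    using mult by blast
  obtain g' H' where 2: "\<forall>e. \<exists>P. (\<forall>s. f2 (x + s *\<^sub>R e) = poly P s) \<and>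
     coeff P 1 = (\<Sum>i\<in>UNIV. g' i * e$i) \<and> coeff P 2 = (\<Sum>i\<in>UNIV. \<Sum>j\<in>UNIV. H' i j * (e$i * e$j))"
    using mult by blast
  show ?case
  proof (rule exI[of _ "\<lambda>i. f1 x * g' i + f2 x * g i"],
      rule exI[of _ "\<lambda>i j. f1 x * H' i j + g i * g' j + f2 x * H i j"], rule allI)
    fix e
    obtain P where P: "\<And>s. f1 (x + s *\<^sub>R e) = poly P s"
     "coeff P 1 = (\<Sum>i\<in>UNIV. g i * e$i)" "coeff P 2 = (\<Sum>i\<in>UNIV. \<Sum>j\<in>UNIV. H i j * (e$i * e$j))"
      using 1 by blast
    obtain P' where P': "\<And>s. f2 (x + s *\<^sub>R e) = poly P' s"
     "coeff P' 1 = (\<Sum>i\<in>UNIV. g' i * e$i)" "coeff P' 2 = (\<Sum>i\<in>UNIV. \<Sum>j\<in>UNIV. H' i j * (e$i * e$j))"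
      using 2 by blast
    have c0: "coeff P 0 = f1 x" "coeff P' 0 = f2 x"
      using P(1)[of 0] P'(1)[of 0] by (simp_all add: poly_0_coeff_0)
    have m1: "coeff (P * P') 1 = coeff P 0 * coeff P' 1 + coeff P 1 * coeff P' 0"
      by (simp add: coeff_mult)
    have m2: "coeff (P * P') 2 = coeff P 0 * coeff P' 2 + coeff P 1 * coeff P' 1 + coeff P 2 * coeff P' 0"
      by (simp add: coeff_mult numeral_2_eq_2)
    have pr: "(\<Sum>i\<in>UNIV. g i * e$i) * (\<Sum>i\<in>UNIV. g' i * e$i)
        = (\<Sum>i\<in>UNIV. \<Sum>j\<in>UNIV. g i * g' j * (e$i * e$j))"
      unfolding sum_product by (intro sum.cong refl) (simp add: mult_ac)
    have "(\<forall>s. f1 (x + s *\<^sub>R e) * f2 (x + s *\<^sub>R e) = poly (P * P') s) \<and>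
      coeff (P * P') 1 = (\<Sum>i\<in>UNIV. (f1 x * g' i + f2 x * g i) * e$i) \<and>
      coeff (P * P') 2 = (\<Sum>i\<in>UNIV. \<Sum>j\<in>UNIV. (f1 x * H' i j + g i * g' j + f2 x * H i j) * (e$i * e$j))"
      unfolding m1 m2 c0 P(2,3) P'(2,3) pr
      by (simp add: P(1) P'(1) sum_3 algebra_simps)
    thus "\<exists>P. (\<forall>s. f1 (x + s *\<^sub>R e) * f2 (x + s *\<^sub>R e) = poly P s) \<and>
      coeff P 1 = (\<Sum>i\<in>UNIV. (f1 x * g' i + f2 x * g i) * e$i) \<and>
      coeff P 2 = (\<Sum>i\<in>UNIV. \<Sum>j\<in>UNIV. (f1 x * H' i j + g i * g' j + f2 x * H i j) * (e$i * e$j))"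
      by blast
  qed
qed

text \<open>The Laplacian is twice the trace of the quadratic form \<open>H\<close>, and the trace
  is the same in the orthonormal frame \<open>R (axis k 1)\<close>.\<close>

lemma laplacian_orthogonal_transformation:
  fixes R :: "real^3 \<Rightarrow> real^3"
  assumes p: "real_polynomial_function p" and R: "orthogonal_transformation R"
  shows "laplacian (\<lambda>y. p (R y)) x = laplacian p (R x)"
proof -
  obtain g H where gH: "\<And>e. \<exists>P. (\<forall>s. p (R x + s *\<^sub>R e) = poly P s) \<and>
     coeff P 1 = (\<Sum>i\<in>UNIV. g i * e$i) \<and> coeff P 2 = (\<Sum>i\<in>UNIV. \<Sum>j\<in>UNIV. H i j * (e$i * e$j))"
    using real_polynomial_function_taylor2[OF p, of "R x"] by blast
  have lin: "linear R" using R by (simp only: orthogonal_transformation_linear)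
  have D: "(deriv ^^ 2) (\<lambda>s. p (R x + s *\<^sub>R e)) 0 = 2 * (\<Sum>i\<in>UNIV. \<Sum>j\<in>UNIV. H i j * (e$i * e$j))" for e
  proof -
    obtain P where P: "\<And>s. p (R x + s *\<^sub>R e) = poly P s"
      "coeff P 2 = (\<Sum>i\<in>UNIV. \<Sum>j\<in>UNIV. H i j * (e$i * e$j))" using gH by blast
    have "(deriv ^^ 2) (\<lambda>s. p (R x + s *\<^sub>R e)) 0 = poly (pderiv (pderiv P)) 0"
      by (rule deriv_deriv_poly) (rule P)
    also have "\<dots> = 2 * coeff P 2" by (simp add: poly_0_coeff_0 coeff_pderiv numeral_2_eq_2)
    finally show ?thesis by (simp only: P(2))
  qed
  have orth: "(\<Sum>k\<in>UNIV. R (axis k 1) $ i * R (axis k 1) $ j) = (if i = j then 1 else 0)" for i j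
  proof -
    have "orthogonal_matrix (matrix R)" using R by (simp add: orthogonal_transformation_matrix)
    hence "matrix R ** transpose (matrix R) = mat 1" by (simp add: orthogonal_matrix_def)
    hence "(matrix R ** transpose (matrix R)) $ i $ j = (mat 1 :: real^3^3) $ i $ j" by simp
    thus ?thesis by (simp add: matrix_matrix_mult_def transpose_def matrix_def mat_def)
  qed
  have "laplacian (\<lambda>y. p (R y)) x = (\<Sum>k\<in>UNIV. 2 * (\<Sum>i\<in>UNIV. \<Sum>j\<in>UNIV. H i j * (R (axis k 1) $ i * R (axis k 1) $ j)))"
    unfolding laplacian_def sum_Basis_real3
    by (simp add: linear_add[OF lin] linear_cmul[OF lin] D sum_3)
  also have "\<dots> = 2 * (\<Sum>i\<in>UNIV. \<Sum>j\<in>UNIV. H i j * (\<Sum>k\<in>UNIV. R (axis k 1) $ i * R (axis k 1) $ j))"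
    by (simp add: sum_3 algebra_simps)
  also have "\<dots> = 2 * (\<Sum>i\<in>UNIV. H i i)"
    unfolding orth by (simp add: if_distrib cong: if_cong)
  also have "\<dots> = laplacian p (R x)"
    unfolding laplacian_def sum_Basis_real3 D by (simp add: sum_3 axis_def)
  finally show ?thesis .
qed

text \<open>The start \<open>\<alpha>\<close> of the period is left free: it will be the longitude
  of the point that is rotated.\<close>

definition trig_moment :: "real \<Rightarrow> nat \<Rightarrow> nat \<Rightarrow> real" where
  "trig_moment \<alpha> a b = integral {\<alpha>..\<alpha> + 2 * pi} (\<lambda>\<theta>. cos \<theta> ^ a * sin \<theta> ^ b)"

lemma integrable_trig [simp]:
  "(\<lambda>\<theta>. cos \<theta> ^ a * sin \<theta> ^ b :: real) integrable_on {\<alpha>..\<beta>}"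
  by (intro integrable_continuous_interval continuous_intros)

lemma trig_moment_0 [simp]: "trig_moment \<alpha> 0 0 = 2 * pi"
  by (simp add: trig_moment_def)

text \<open>The second derivative of \<open>cos\<^sup>a \<theta> sin\<^sup>b \<theta>\<close> integrates to zero over a period.\<close>

lemma trig_moment_recurrence:
  "real a * real (a - 1) * trig_moment \<alpha> (a - 2) b + real b * real (b - 1) * trig_moment \<alpha> a (b - 2)
     = (real (a + b))\<^sup>2 * trig_moment \<alpha> a b"
proof -
  \<comment> \<open>\<open>D\<close> is the first derivative of
    \<open>cos \<theta> ^ a * sin \<theta> ^ b\<close> and \<open>h\<close> the second;
    \<open>D\<close> has equal values at both ends of the period.\<close>
  define D where "D = (\<lambda>\<theta>::real. - (real a * cos \<theta> ^ (a - 1) * sin \<theta> ^ Suc b) + real b * cos \<theta> ^ Suc a * sin \<theta> ^ (b - 1))"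
  define h where "h = (\<lambda>\<theta>::real. real a * real (a - 1) * (cos \<theta> ^ (a - 2) * sin \<theta> ^ b)
     + real b * real (b - 1) * (cos \<theta> ^ a * sin \<theta> ^ (b - 2)) - (real (a + b))\<^sup>2 * (cos \<theta> ^ a * sin \<theta> ^ b))"
  have red1: "real n * x ^ (n - 1) * x = real n * x ^ n" for n and x :: real
    by (cases n) auto
  have red2: "real n * real (n - 1) * x ^ (n - 2) * x\<^sup>2 = real n * real (n - 1) * x ^ n" for n and x :: real
  proof (cases "n \<le> 1")
    case False
    then obtain m where "n = Suc (Suc m)" by (metis Suc_diff_Suc less_one linorder_not_le not0_implies_Suc not_less_eq_eq One_nat_def)
    thus ?thesis by (simp add: power2_eq_square)
  qed (auto simp: le_Suc_eq)
  have D: "(D has_real_derivative h \<theta>) (at \<theta>)" for \<theta>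
  proof -
    let ?x = "cos \<theta>" and ?y = "sin \<theta>"
    have d: "((\<lambda>\<theta>. cos \<theta> ^ m * sin \<theta> ^ n) has_real_derivative
        - (real m * ?x ^ (m - 1) * ?y) * ?y ^ n + ?x ^ m * (real n * ?y ^ (n - 1) * ?x)) (at \<theta>)" for m n
      by (auto intro!: derivative_eq_intros)
    let ?d = "- (real a * (- (real (a - 1) * ?x ^ (a - 1 - 1) * ?y) * ?y ^ Suc b + ?x ^ (a - 1) * (real (Suc b) * ?y ^ (Suc b - 1) * ?x)))
       + real b * (- (real (Suc a) * ?x ^ (Suc a - 1) * ?y) * ?y ^ (b - 1) + ?x ^ Suc a * (real (b - 1) * ?y ^ (b - 1 - 1) * ?x))"
    have "(D has_real_derivative ?d) (at \<theta>)"
      unfolding D_def mult.assoc[of "real _"]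
      by (intro DERIV_add DERIV_minus DERIV_cmult d[unfolded mult.assoc])
    also have "?d = real a * real (a - 1) * ?x ^ (a - 2) * ?y ^ b * ?y\<^sup>2
        - (real a * ?x ^ (a - 1) * ?x) * (real b + 1) * ?y ^ b
        - (real b * ?y ^ (b - 1) * ?y) * (real a + 1) * ?x ^ a
        + real b * real (b - 1) * ?y ^ (b - 2) * ?x ^ a * ?x\<^sup>2"
    proof -
      have "a - 1 - 1 = a - 2" "b - 1 - 1 = b - 2" "Suc a - 1 = a" "Suc b - 1 = b" by auto
      moreover have "- (A * (- (A1 * x2 * y) * (y * yb) + x1 * ((1 + B) * yb * x)))
          + B * (- ((1 + A) * xa * y) * y1 + x * xa * (B1 * y2 * x))
        = A * A1 * x2 * yb * y\<^sup>2 - (A * x1 * x) * (B + 1) * yb - (B * y1 * y) * (A + 1) * xa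
          + B * B1 * y2 * xa * x\<^sup>2" for A A1 B B1 x y x1 x2 xa y1 y2 yb :: real
        by (simp add: power2_eq_square algebra_simps)
      ultimately show ?thesis by (simp only: power_Suc of_nat_Suc)
    qed
    also have "\<dots> = real a * real (a - 1) * ?x ^ (a - 2) * ?y ^ b * (1 - ?x\<^sup>2)
        - (real a * ?x ^ a) * (real b + 1) * ?y ^ b
        - (real b * ?y ^ b) * (real a + 1) * ?x ^ a
        + real b * real (b - 1) * ?y ^ (b - 2) * ?x ^ a * (1 - ?y\<^sup>2)"
      unfolding red1 sin_squared_eq[of \<theta>] by simp
    also have "\<dots> = real a * real (a - 1) * ?x ^ (a - 2) * ?y ^ b
        - (real a * real (a - 1) * ?x ^ (a - 2) * ?x\<^sup>2) * ?y ^ b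
        - (real a * ?x ^ a) * (real b + 1) * ?y ^ b
        - (real b * ?y ^ b) * (real a + 1) * ?x ^ a
        + real b * real (b - 1) * ?y ^ (b - 2) * ?x ^ a
        - (real b * real (b - 1) * ?y ^ (b - 2) * ?y\<^sup>2) * ?x ^ a"
      by (simp only: algebra_simps)
    also have "\<dots> = h \<theta>"
    proof -
      have n1: "real n * real (n - 1) = real n * (real n - 1)" for n by (cases n) auto
      show ?thesis unfolding red2 unfolding h_def n1 by (simp add: power2_eq_square algebra_simps)
    qed
    finally show ?thesis .
  qed
  have "(h has_integral (D (\<alpha> + 2 * pi) - D \<alpha>)) {\<alpha>..\<alpha> + 2 * pi}"
    using D by (intro fundamental_theorem_of_calculus)
      (auto simp: has_real_derivative_iff_has_vector_derivative[symmetric] intro: has_field_derivative_at_within)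
  moreover have "D (\<alpha> + 2 * pi) = D \<alpha>" by (simp add: D_def)
  ultimately have "integral {\<alpha>..\<alpha> + 2 * pi} h = 0" by (simp add: integral_unique)
  moreover have "integral {\<alpha>..\<alpha> + 2 * pi} h = real a * real (a - 1) * trig_moment \<alpha> (a - 2) b
     + real b * real (b - 1) * trig_moment \<alpha> a (b - 2) - (real (a + b))\<^sup>2 * trig_moment \<alpha> a b"
    unfolding h_def trig_moment_def
    by (subst integral_diff integral_add; (intro integrable_diff integrable_add integrable_on_mult_right integrable_trig)?)+
       (simp add: integral_mult_right)
  ultimately show ?thesis by simp
qed

lemma integral_sum_list:
  fixes f :: "'b \<Rightarrow> real \<Rightarrow> real"
  assumes "\<And>m. m \<in> set xs \<Longrightarrow> f m integrable_on S"
  shows "(\<lambda>\<theta>. \<Sum>m\<leftarrow>xs. f m \<theta>) integrable_on S"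
    and "integral S (\<lambda>\<theta>. \<Sum>m\<leftarrow>xs. f m \<theta>) = (\<Sum>m\<leftarrow>xs. integral S (f m))"
proof -
  have "(\<lambda>\<theta>. \<Sum>m\<leftarrow>xs. f m \<theta>) integrable_on S \<and>
    integral S (\<lambda>\<theta>. \<Sum>m\<leftarrow>xs. f m \<theta>) = (\<Sum>m\<leftarrow>xs. integral S (f m))"
    using assms by (induction xs) (auto simp: integrable_add integral_add integrable_0)
  thus "(\<lambda>\<theta>. \<Sum>m\<leftarrow>xs. f m \<theta>) integrable_on S"
    "integral S (\<lambda>\<theta>. \<Sum>m\<leftarrow>xs. f m \<theta>) = (\<Sum>m\<leftarrow>xs. integral S (f m))" by auto
qed

text \<open>
  Averaging Laplace's equation over circles of latitude turns it into the two-term recurrence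
  satisfied by \<open>legendre_coeff\<close>.
\<close>

lemma circle_mean_harmonic:
  fixes p :: "real^3 \<Rightarrow> real"
  assumes p: "real_polynomial_function p" and hom: "\<And>s x. p (s *\<^sub>R x) = s ^ l * p x"
    and harm: "\<And>x. laplacian p x = 0" and \<rho>: "\<rho>\<^sup>2 = 1 - t\<^sup>2"
  shows "integral {\<alpha>..\<alpha> + 2 * pi} (\<lambda>\<theta>. p (vec3 (\<rho> * cos \<theta>) (\<rho> * sin \<theta>) t))
    = 2 * pi * p (axis 3 1) * poly (legendre l) t"
proof -
  obtain xs where xs: "p = monomials xs" and deg: "\<And>C a b c. (C, a, b, c) \<in> set xs \<Longrightarrow> a + b + c = l"
    using homogeneous_imp_monomials[OF p hom] by blast
  let ?I = "\<lambda>f. integral {\<alpha>..\<alpha> + 2 * pi} f"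
  let ?M = "trig_moment \<alpha>"
  \<comment> \<open>\<open>E\<close> sorts the circle integral of \<open>p\<close> by powers of the
    radius: its coefficient at \<open>k\<close> belongs to the terms of degree \<open>k\<close> in
    the two horizontal coordinates.\<close>
  define E where "E = (\<Sum>(C, a, b, c)\<leftarrow>xs. monom (C * ?M a b) (a + b))"
  define e where "e = coeff E"
  \<comment> \<open>At radius \<open>r\<close> the polynomial \<open>G\<close> is r^2 times the
    integral of the Laplacian over the circle of that radius at height 1, with the horizontal second
    derivatives merged by \<open>trig_moment_recurrence\<close>. The factor r^2 avoids lowered
    exponents.\<close>
  define G where "G = (\<Sum>(C, a, b, c)\<leftarrow>xs. monom (C * ((real (a + b))\<^sup>2 * ?M a b)) (a + b)
      + monom (C * (real c * real (c - 1) * ?M a b)) (a + b + 2))"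
  have red: "real n * real (n - 1) * y ^ (n - 2) * y\<^sup>2 = real n * real (n - 1) * y ^ n" for n and y :: real
    by (cases n; cases "n - 1") (auto simp: power2_eq_square numeral_2_eq_2)
  have G0: "poly G r = 0" for r
  proof -
    let ?f = "\<lambda>(C, a, b, c) \<theta>. C * (r ^ (a + b) * (real a * real (a - 1) * (cos \<theta> ^ (a - 2) * sin \<theta> ^ b)
         + real b * real (b - 1) * (cos \<theta> ^ a * sin \<theta> ^ (b - 2)))
         + r ^ (a + b + 2) * (real c * real (c - 1)) * (cos \<theta> ^ a * sin \<theta> ^ b))"
    let ?g = "\<lambda>\<theta> m. case m of (C, a, b, c) \<Rightarrow> 
      C * (real a * real (a - 1) * (r * cos \<theta>) ^ (a - 2) * (r * sin \<theta>) ^ b * 1 ^ c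
         + real b * real (b - 1) * (r * cos \<theta>) ^ a * (r * sin \<theta>) ^ (b - 2) * 1 ^ c
         + real c * real (c - 1) * (r * cos \<theta>) ^ a * (r * sin \<theta>) ^ b * 1 ^ (c - 2))"
    have "(\<Sum>m\<leftarrow>xs. ?f m \<theta>) = r\<^sup>2 * laplacian p (vec3 (r * cos \<theta>) (r * sin \<theta>) 1)" for \<theta>
    proof -
      have "?f m \<theta> = r\<^sup>2 * ?g \<theta> m" for m
      proof -
        obtain C a b c where m: "m = (C, a, b, c)" by (cases m) auto
        have "r ^ (a + b) * (real a * real (a - 1)) = (real a * real (a - 1) * r ^ a) * r ^ b"
          by (simp add: power_add)
        also have "\<dots> = (real a * real (a - 1) * r ^ (a - 2) * r\<^sup>2) * r ^ b" by (simp only: red)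
        finally have 1: "r ^ (a + b) * (real a * real (a - 1)) = \<dots>" .
        have "r ^ (a + b) * (real b * real (b - 1)) = (real b * real (b - 1) * r ^ b) * r ^ a"
          by (simp add: power_add)
        also have "\<dots> = (real b * real (b - 1) * r ^ (b - 2) * r\<^sup>2) * r ^ a" by (simp only: red)
        finally have 2: "r ^ (a + b) * (real b * real (b - 1)) = \<dots>" .
        have "?f m \<theta> = C * ((r ^ (a + b) * (real a * real (a - 1))) * (cos \<theta> ^ (a - 2) * sin \<theta> ^ b)
         + (r ^ (a + b) * (real b * real (b - 1))) * (cos \<theta> ^ a * sin \<theta> ^ (b - 2))
         + r ^ a * r ^ b * r\<^sup>2 * (real c * real (c - 1)) * (cos \<theta> ^ a * sin \<theta> ^ b))"
          by (simp add: m algebra_simps power_add power2_eq_square)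
        also have "\<dots> = r\<^sup>2 * ?g \<theta> m"
          unfolding 1 2 m by (simp add: power_mult_distrib power2_eq_square algebra_simps)
        finally show ?thesis .
      qed
      hence "(\<Sum>m\<leftarrow>xs. ?f m \<theta>) = (\<Sum>m\<leftarrow>xs. r\<^sup>2 * ?g \<theta> m)" by simp
      also have "\<dots> = r\<^sup>2 * laplacian p (vec3 (r * cos \<theta>) (r * sin \<theta>) 1)"
        unfolding xs laplacian_monomials vec3_nth by (simp only: sum_list_const_mult)
      finally show ?thesis .
    qed
    hence z: "?I (\<lambda>\<theta>. \<Sum>m\<leftarrow>xs. ?f m \<theta>) = 0" by (simp add: harm)
    have fm: "?f m integrable_on S" "?I (?f m) = (case m of (C, a, b, c) \<Rightarrow>
       C * ((real (a + b))\<^sup>2 * ?M a b) * r ^ (a + b) + C * (real c * real (c - 1) * ?M a b) * r ^ (a + b + 2))"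
      if "S = {\<alpha>..\<alpha> + 2 * pi}" for m S
    proof -
      obtain C a b c where m: "m = (C, a, b, c)" by (cases m) auto
      have "(?f m has_integral C * (r ^ (a + b) * (real a * real (a - 1) * ?M (a - 2) b
         + real b * real (b - 1) * ?M a (b - 2))
         + r ^ (a + b + 2) * (real c * real (c - 1)) * ?M a b)) {\<alpha>..\<alpha> + 2 * pi}"
        unfolding m prod.case trig_moment_def
        by (intro has_integral_mult_right has_integral_add integrable_integral integrable_trig)
      thus "?f m integrable_on S" "?I (?f m) = (case m of (C, a, b, c) \<Rightarrow>
       C * ((real (a + b))\<^sup>2 * ?M a b) * r ^ (a + b) + C * (real c * real (c - 1) * ?M a b) * r ^ (a + b + 2))"
        unfolding trig_moment_recurrence that
        by (auto simp: m integral_unique algebra_simps has_integral_integrable)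
    qed
    have "poly G r = (\<Sum>m\<leftarrow>xs. ?I (?f m))"
      unfolding G_def fm(2)[OF refl] by (induction xs) (auto simp: poly_monom)
    also have "\<dots> = ?I (\<lambda>\<theta>. \<Sum>m\<leftarrow>xs. ?f m \<theta>)"
      by (rule integral_sum_list(2)[symmetric]) (rule fm(1)[OF refl])
    finally show ?thesis by (simp only: z)
  qed
  hence "G = 0" using poly_all_0_iff_0 by blast
  \<comment> \<open>Homogeneity replaces \<open>c\<close> by \<open>l - (a + b)\<close>, which turns
    the second part of \<open>G\<close> into a multiple of \<open>e (k - 2)\<close>.\<close>
  hence rec: "(real k)\<^sup>2 * e k + (if 2 \<le> k then real (l - (k - 2)) * real (l - (k - 2) - 1) * e (k - 2) else 0) = 0" for k
  proof -
    have "coeff G k = (real k)\<^sup>2 * e k + (if 2 \<le> k then real (l - (k - 2)) * real (l - (k - 2) - 1) * e (k - 2) else 0)"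
      using deg unfolding G_def e_def E_def
    proof (induction xs)
      case (Cons m xs)
      obtain C a b c where m: "m = (C, a, b, c)" by (cases m) auto
      have l: "l = a + b + c" using Cons.prems[of C a b c] m by simp
      have IH: "coeff (\<Sum>(C, a, b, c)\<leftarrow>xs. monom (C * ((real (a + b))\<^sup>2 * ?M a b)) (a + b)
      + monom (C * (real c * real (c - 1) * ?M a b)) (a + b + 2)) k
       = (real k)\<^sup>2 * coeff (\<Sum>(C, a, b, c)\<leftarrow>xs. monom (C * ?M a b) (a + b)) k
        + (if 2 \<le> k then real (l - (k - 2)) * real (l - (k - 2) - 1) * coeff (\<Sum>(C, a, b, c)\<leftarrow>xs. monom (C * ?M a b) (a + b)) (k - 2) else 0)"
        by (rule Cons.IH) (use Cons.prems in auto)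
      show ?case using IH by (auto simp: m l distrib_left simp del: of_nat_add of_nat_diff)
    qed simp
    thus ?thesis using \<open>G = 0\<close> by simp
  qed
  \<comment> \<open>Only pure powers of the height contribute, and these are what is left of
    \<open>p\<close> at the pole.\<close>
  have e0: "e 0 = 2 * pi * p (axis 3 1)"
    unfolding e_def E_def xs by (induction xs) (auto simp: axis_def power_0_left algebra_simps)
  have e1: "e 1 = 0" using rec[of 1] by simp
  have eodd: "e (2 * j + 1) = 0" for j
  proof (induction j)
    case (Suc j)
    show ?case using rec[of "2 * Suc j + 1"] Suc by simp
  qed (use e1 in simp)
  have eeven: "e (2 * j) = e 0 * legendre_coeff l j" if "2 * j \<le> l" for j
    using that
  proof (induction j)
    case (Suc j)
    have "4 * (real (Suc j))\<^sup>2 * e (2 * Suc j) = - (real (l - 2 * j) * real (l - 2 * j - 1) * e (2 * j))"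
    proof -
      have "(real (2 * Suc j))\<^sup>2 = 4 * (real (Suc j))\<^sup>2" by (simp add: power2_eq_square algebra_simps)
      moreover have "2 * Suc j - 2 = 2 * j" "2 \<le> 2 * Suc j" by auto
      ultimately have "4 * (real (Suc j))\<^sup>2 * e (2 * Suc j) + real (l - 2 * j) * real (l - 2 * j - 1) * e (2 * j) = 0"
        using rec[of "2 * Suc j"] by (simp only: if_True)
      thus ?thesis by linarith
    qed
    also have "\<dots> = e 0 * (- (real (l - 2 * j) * real (l - 2 * j - 1) * legendre_coeff l j))"
      using Suc by simp
    also have "\<dots> = e 0 * (4 * (real (Suc j))\<^sup>2 * legendre_coeff l (Suc j))"
      by (simp only: legendre_coeff_Suc[OF Suc.prems])
    finally have "4 * (real (Suc j))\<^sup>2 * e (2 * Suc j) = 4 * (real (Suc j))\<^sup>2 * (e 0 * legendre_coeff l (Suc j))"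
      by (simp only: mult_ac)
    thus ?case by simp
  qed simp
  have "?I (\<lambda>\<theta>. p (vec3 (\<rho> * cos \<theta>) (\<rho> * sin \<theta>) t)) = (\<Sum>(C, a, b, c)\<leftarrow>xs. C * ?M a b * (\<rho> ^ (a + b) * t ^ c))"
  proof -
    let ?f = "\<lambda>(C, a, b, c) \<theta>. C * (\<rho> ^ (a + b) * t ^ c) * (cos \<theta> ^ a * sin \<theta> ^ b)"
    have "(\<lambda>\<theta>. p (vec3 (\<rho> * cos \<theta>) (\<rho> * sin \<theta>) t)) = (\<lambda>\<theta>. \<Sum>m\<leftarrow>xs. ?f m \<theta>)"
      unfolding xs monomials_def vec3_nth
      by (intro ext arg_cong[of _ _ sum_list] map_cong refl) (auto simp: power_mult_distrib power_add)
    moreover have "?f m integrable_on {\<alpha>..\<alpha> + 2 * pi}" for m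
      by (cases m) (simp only: prod.case, intro integrable_on_mult_right integrable_trig)
    moreover have "?I (?f m) = (case m of (C, a, b, c) \<Rightarrow> C * ?M a b * (\<rho> ^ (a + b) * t ^ c))" for m
      by (cases m) (simp add: trig_moment_def)
    ultimately show ?thesis by (simp only: integral_sum_list(2))
  qed
  also have "\<dots> = (\<Sum>k\<le>l. e k * \<rho> ^ k * t ^ (l - k))"
    using deg unfolding e_def E_def
  proof (induction xs)
    case (Cons m xs)
    obtain C a b c where m: "m = (C, a, b, c)" by (cases m) auto
    have l: "l = a + b + c" using Cons.prems[of C a b c] m by simp
    have "(\<Sum>k\<le>l. coeff (monom (C * ?M a b) (a + b)) k * \<rho> ^ k * t ^ (l - k))
      = (\<Sum>k\<le>l. if k = a + b then C * ?M a b * \<rho> ^ k * t ^ (l - k) else 0)"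
      by (intro sum.cong refl) auto
    also have "\<dots> = C * ?M a b * (\<rho> ^ (a + b) * t ^ c)" using l by (simp add: mult_ac)
    finally have 1: "(\<Sum>k\<le>l. coeff (monom (C * ?M a b) (a + b)) k * \<rho> ^ k * t ^ (l - k)) = C * ?M a b * (\<rho> ^ (a + b) * t ^ c)" .
    show ?case using Cons.IH[OF Cons.prems[OF list.set_intros(2)]] 1 by (simp add: m distrib_right sum.distrib)
  qed simp
  also have "\<dots> = (\<Sum>k\<in>(\<lambda>j. 2 * j) ` {..l div 2}. e k * \<rho> ^ k * t ^ (l - k))"
  proof (rule sum.mono_neutral_right)
    show "\<forall>k\<in>{..l} - (\<lambda>j. 2 * j) ` {..l div 2}. e k * \<rho> ^ k * t ^ (l - k) = 0"
    proof
      fix k assume k: "k \<in> {..l} - (\<lambda>j. 2 * j) ` {..l div 2}"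
      have "odd k"
      proof
        assume "even k"
        then obtain j where "k = 2 * j" by (elim evenE)
        with k show False by auto
      qed
      then obtain j where "k = 2 * j + 1" by (elim oddE)
      thus "e k * \<rho> ^ k * t ^ (l - k) = 0" using eodd by simp
    qed
  qed auto
  also have "\<dots> = (\<Sum>j\<le>l div 2. e (2 * j) * \<rho> ^ (2 * j) * t ^ (l - 2 * j))"
    by (subst sum.reindex) (auto simp: inj_on_def)
  also have "\<dots> = (\<Sum>j\<le>l div 2. e 0 * (legendre_coeff l j * (1 - t\<^sup>2) ^ j * t ^ (l - 2 * j)))"
  proof (intro sum.cong refl)
    fix j assume "j \<in> {..l div 2}"
    hence "2 * j \<le> l" by simp
    thus "e (2 * j) * \<rho> ^ (2 * j) * t ^ (l - 2 * j) = e 0 * (legendre_coeff l j * (1 - t\<^sup>2) ^ j * t ^ (l - 2 * j))"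
      by (simp only: eeven power_mult \<rho>)
  qed
  also have "\<dots> = 2 * pi * p (axis 3 1) * poly (legendre l) t"
    unfolding poly_legendre e0 sum_distrib_left ..
  finally show ?thesis .
qed

section \<open>The Funk-Hecke formula\<close>

abbreviation rot3 :: "real \<Rightarrow> real^3 \<Rightarrow> real^3" where
  "rot3 \<phi> y \<equiv> vec3 (cos \<phi> * y$1 - sin \<phi> * y$2) (sin \<phi> * y$1 + cos \<phi> * y$2) (y$3)"

lemma orthogonal_transformation_rot3: "orthogonal_transformation (rot3 \<phi>)"
proof -
  have "linear (rot3 \<phi>)"
    by (rule linearI) (simp_all add: vec_eq_iff forall_3 axis_def algebra_simps)
  moreover have "norm (rot3 \<phi> y) = norm y" for y
  proof -
    have "(cos \<phi> * y$1 - sin \<phi> * y$2)\<^sup>2 + (sin \<phi> * y$1 + cos \<phi> * y$2)\<^sup>2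
       = ((cos \<phi>)\<^sup>2 + (sin \<phi>)\<^sup>2) * ((y$1)\<^sup>2 + (y$2)\<^sup>2)"
      by (simp only: power2_eq_square) (simp only: algebra_simps)
    thus ?thesis unfolding norm_vec3 vec3_nth by simp
  qed
  ultimately show ?thesis unfolding orthogonal_transformation by blast
qed

lemma rot3_nth3 [simp]: "rot3 \<phi> y $ 3 = y $ 3"
  by (simp only: vec3_nth)

lemma real_polynomial_function_continuous_on:
  fixes p :: "real^3 \<Rightarrow> real"
  assumes "real_polynomial_function p"
  shows "continuous_on S p"
  using assms by (simp add: continuous_on_polymonial_function polynomial_function_bounded_linear 
     real_polynomial_function_eq continuous_at_imp_continuous_on continuous_real_polymonial_function)

lemma rotation_mean_harmonic:
  fixes p :: "real^3 \<Rightarrow> real"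
  assumes p: "real_polynomial_function p" and hom: "\<And>s x. p (s *\<^sub>R x) = s ^ l * p x"
    and harm: "\<And>x. laplacian p x = 0" and y: "y \<in> S2"
  shows "(LINT \<phi>:{0..2 * pi}|lborel. p (rot3 \<phi> y)) = 2 * pi * p (axis 3 1) * poly (legendre l) (y $ 3)"
proof -
  define \<rho> where "\<rho> = sqrt ((y$1)\<^sup>2 + (y$2)\<^sup>2)"
  have n: "(y$1)\<^sup>2 + (y$2)\<^sup>2 + (y$3)\<^sup>2 = 1" using y by (simp add: norm_vec3)
  have \<rho>2: "\<rho>\<^sup>2 = 1 - (y$3)\<^sup>2" using n by (simp add: \<rho>_def)
  obtain \<alpha> where \<alpha>: "y$1 = \<rho> * cos \<alpha>" "y$2 = \<rho> * sin \<alpha>"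
  proof (cases "\<rho> = 0")
    case True
    hence "y$1 = 0" "y$2 = 0" by (auto simp: \<rho>_def sum_power2_eq_zero_iff)
    thus ?thesis using that[of 0] True by simp
  next
    case False
    hence "(y$1 / \<rho>)\<^sup>2 + (y$2 / \<rho>)\<^sup>2 = 1"
      by (simp add: power_divide \<rho>_def flip: add_divide_distrib)
    then obtain t where "y$1 / \<rho> = cos t" "y$2 / \<rho> = sin t" using sincos_total_2pi_le by metis
    thus ?thesis using that[of t] False by (simp add: field_simps)
  qed
  have r: "rot3 \<phi> y = vec3 (\<rho> * cos (\<alpha> + \<phi>)) (\<rho> * sin (\<alpha> + \<phi>)) (y$3)" for \<phi>
    by (simp add: \<alpha> cos_add sin_add algebra_simps)
  define h where "h = (\<lambda>\<theta>. p (vec3 (\<rho> * cos \<theta>) (\<rho> * sin \<theta>) (y$3)))"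
  have hc: "continuous_on S h" for S
    unfolding h_def
    by (intro continuous_on_compose2[OF real_polynomial_function_continuous_on[OF p, of UNIV]] continuous_intros) auto
  have "set_integrable lborel {0..2 * pi} (\<lambda>\<phi>. h (\<alpha> + \<phi>))"
    by (rule borel_integrable_atLeastAtMost')
       (intro continuous_on_compose2[OF hc[of UNIV]] continuous_intros, auto)
  hence "(LINT \<phi>:{0..2 * pi}|lborel. h (\<alpha> + \<phi>)) = integral {0..2 * pi} (\<lambda>\<phi>. h (\<alpha> + \<phi>))"
    by (rule set_borel_integral_eq_integral)
  also have "\<dots> = integral {\<alpha>..\<alpha> + 2 * pi} h"
  proof -
    have "(h has_integral integral {\<alpha>..\<alpha> + 2 * pi} h) (cbox \<alpha> (\<alpha> + 2 * pi))"
      by (simp only: box_real) (intro integrable_integral integrable_continuous_interval hc)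
    from has_integral_affinity[OF this, of 1 \<alpha>]
    have "((\<lambda>x. h (\<alpha> + x)) has_integral integral {\<alpha>..\<alpha> + 2 * pi} h) {0..2 * pi}"
      by (simp add: add.commute)
    thus ?thesis by (rule integral_unique)
  qed
  also have "\<dots> = 2 * pi * p (axis 3 1) * poly (legendre l) (y $ 3)"
    unfolding h_def by (rule circle_mean_harmonic[OF p hom harm \<rho>2])
  finally show ?thesis by (simp only: h_def r)
qed

text \<open>A rotation about the third axis changes neither the surface measure nor the weight
  \<open>\<Phi> (y $ 3)\<close>. Averaging over these rotations and exchanging the integrals
  replaces \<open>p\<close> by its mean over a circle of latitude, which
  \<open>rotation_mean_harmonic\<close> evaluates.\<close>

lemma Funk_Hecke_axis:
  fixes p :: "real^3 \<Rightarrow> real"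
  assumes p: "real_polynomial_function p" and hom: "\<And>s x. p (s *\<^sub>R x) = s ^ l * p x"
    and harm: "\<And>x. laplacian p x = 0" and \<Phi>: "set_integrable lborel {-1<..<1} \<Phi>"
  shows "(LINT y|surface_measure. \<Phi> (y $ 3) * p y)
    = p (axis 3 1) * (LINT y|surface_measure. \<Phi> (y $ 3) * poly (legendre l) (y $ 3))"
proof -
  have e: "axis 3 1 \<in> S2" by simp
  have e3: "axis 3 1 \<bullet> y = y $ 3" for y :: "real^3" by (simp add: inner_axis')
  have i\<Phi>: "integrable surface_measure (\<lambda>y. \<Phi> (y $ 3))"
    using integrable_surface_zonal[OF e \<Phi>] by (simp only: e3)
  hence [measurable]: "(\<lambda>y. \<Phi> (y $ 3)) \<in> borel_measurable surface_measure" by simp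
  have pc: "continuous_on UNIV p" by (rule real_polynomial_function_continuous_on[OF p])
  obtain B where B: "\<And>y. y \<in> S2 \<Longrightarrow> \<bar>p y\<bar> \<le> B"
    using continuous_on_sphere_bounded[OF continuous_on_subset[OF pc]] by (metis subset_UNIV)
  interpret P: pair_sigma_finite "lborel :: real measure" surface_measure
    by unfold_locales
  let ?I = "\<lambda>\<phi>. indicator {0..2 * pi} \<phi> :: real"
  define F where "F = (\<lambda>(\<phi>, y). ?I \<phi> * (\<Phi> (y $ 3) * p (rot3 \<phi> y)))"
  have Fm: "F \<in> borel_measurable (lborel \<Otimes>\<^sub>M surface_measure)"
  proof -
    have id: "(\<lambda>y. y) \<in> surface_measure \<rightarrow>\<^sub>M borel"
      by (rule borel_measurable_surface) simp
    have "(\<lambda>z :: real \<times> (real^3). (fst z, snd z)) \<in> lborel \<Otimes>\<^sub>M surface_measure \<rightarrow>\<^sub>M borel \<Otimes>\<^sub>M borel"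
      by (intro measurable_Pair measurable_compose[OF measurable_snd id] measurable_compose[OF measurable_fst]) simp
    moreover have "(\<lambda>z :: real \<times> (real^3). p (rot3 (fst z) (snd z))) \<in> borel_measurable borel"
      by (intro borel_measurable_continuous_onI continuous_on_compose2[OF pc] continuous_intros) auto
    ultimately have "(\<lambda>z :: real \<times> (real^3). p (rot3 (fst z) (snd z))) \<in> borel_measurable (lborel \<Otimes>\<^sub>M surface_measure)"
      by (simp add: borel_prod)
    moreover have "(\<lambda>z :: real \<times> (real^3). \<Phi> (snd z $ 3)) \<in> borel_measurable (lborel \<Otimes>\<^sub>M surface_measure)"
      by measurable
    ultimately show ?thesis unfolding F_def case_prod_beta by measurable
  qed
  \<comment> \<open>The majorant for Fubini: \<open>p\<close> is bounded by \<open>B\<close> on the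
    sphere, and \<open>\<Phi> (y $ 3)\<close> is integrable.\<close>
  have iprod: "integrable (lborel \<Otimes>\<^sub>M surface_measure) (\<lambda>(\<phi>, y). ?I \<phi> * (\<bar>\<Phi> (y $ 3)\<bar> * B))"
  proof (rule P.Fubini_integrable)
    show "(\<lambda>(\<phi>, y). ?I \<phi> * (\<bar>\<Phi> (y $ 3)\<bar> * B)) \<in> borel_measurable (lborel \<Otimes>\<^sub>M surface_measure)"
      unfolding case_prod_beta by measurable
    have "integrable lborel (\<lambda>\<phi>. ?I \<phi> * (LINT y|surface_measure. \<bar>\<bar>\<Phi> (y $ 3)\<bar> * B\<bar>))"
      by (intro integrable_mult_left) (auto intro!: integrable_real_indicator)
    moreover have "(LINT y|surface_measure. norm (case (\<phi>, y) of (\<phi>, y) \<Rightarrow> ?I \<phi> * (\<bar>\<Phi> (y $ 3)\<bar> * B)))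
       = ?I \<phi> * (LINT y|surface_measure. \<bar>\<bar>\<Phi> (y $ 3)\<bar> * B\<bar>)" for \<phi>
      by (simp add: abs_mult)
    ultimately show "integrable lborel (\<lambda>\<phi>. LINT y|surface_measure. norm (case (\<phi>, y) of (\<phi>, y) \<Rightarrow> ?I \<phi> * (\<bar>\<Phi> (y $ 3)\<bar> * B)))"
      by (simp only:)
    show "AE \<phi> in lborel. integrable surface_measure (\<lambda>y. case (\<phi>, y) of (\<phi>, y) \<Rightarrow> ?I \<phi> * (\<bar>\<Phi> (y $ 3)\<bar> * B))"
      using i\<Phi> by (auto intro!: AE_I2)
  qed
  have Fi: "integrable (lborel \<Otimes>\<^sub>M surface_measure) F"
  proof (rule Bochner_Integration.integrable_bound[OF iprod Fm], rule AE_I2)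
    fix z :: "real \<times> (real^3)" assume "z \<in> space (lborel \<Otimes>\<^sub>M surface_measure)"
    then obtain \<phi> y where z: "z = (\<phi>, y)" and y: "y \<in> S2" by (auto simp: space_pair_measure)
    have "rot3 \<phi> y \<in> S2"
      using y orthogonal_transformation_norm[OF orthogonal_transformation_rot3[of \<phi>], of y] by simp
    hence "\<bar>p (rot3 \<phi> y)\<bar> \<le> B" by (rule B)
    hence "?I \<phi> * (\<bar>\<Phi> (y $ 3)\<bar> * \<bar>p (rot3 \<phi> y)\<bar>) \<le> ?I \<phi> * (\<bar>\<Phi> (y $ 3)\<bar> * B)"
      by (intro mult_left_mono) auto
    also have "\<dots> \<le> \<bar>?I \<phi> * (\<bar>\<Phi> (y $ 3)\<bar> * B)\<bar>" by (rule abs_ge_self)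
    finally show "norm (F z) \<le> norm (case z of (\<phi>, y) \<Rightarrow> ?I \<phi> * (\<bar>\<Phi> (y $ 3)\<bar> * B))"
      by (simp add: F_def z abs_mult)
  qed
  have "(LINT \<phi>|lborel. LINT y|surface_measure. F (\<phi>, y)) = (LINT y|surface_measure. LINT \<phi>|lborel. F (\<phi>, y))"
    using P.Fubini_integral[of "\<lambda>\<phi> y. F (\<phi>, y)"] Fi by simp
  moreover have "(LINT y|surface_measure. F (\<phi>, y)) = ?I \<phi> * (LINT y|surface_measure. \<Phi> (y $ 3) * p y)" for \<phi>
  proof -
    have m: "(\<lambda>y. \<Phi> (y $ 3) * p y) \<in> borel_measurable surface_measure"
      using borel_measurable_continuous_sphere[OF continuous_on_subset[OF pc]] by simp
    have "(LINT y|surface_measure. \<Phi> (y $ 3) * p (rot3 \<phi> y)) = (LINT y|surface_measure. \<Phi> (rot3 \<phi> y $ 3) * p (rot3 \<phi> y))"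
      by (simp only: rot3_nth3)
    also have "\<dots> = (LINT y|surface_measure. \<Phi> (y $ 3) * p y)"
      by (rule integral_surface_orthogonal_transformation[OF orthogonal_transformation_rot3 m])
    finally show ?thesis unfolding F_def prod.case by simp
  qed
  moreover have "(LINT \<phi>|lborel. ?I \<phi> * (LINT y|surface_measure. \<Phi> (y $ 3) * p y)) = 2 * pi * (LINT y|surface_measure. \<Phi> (y $ 3) * p y)"
    by simp
  moreover have "(LINT y|surface_measure. LINT \<phi>|lborel. F (\<phi>, y))
     = (LINT y|surface_measure. 2 * pi * (p (axis 3 1) * (\<Phi> (y $ 3) * poly (legendre l) (y $ 3))))"
  proof (rule Bochner_Integration.integral_cong[OF refl])
    fix y assume "y \<in> space surface_measure"
    hence y: "y \<in> S2" by simp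
    have "(LINT \<phi>|lborel. F (\<phi>, y)) = \<Phi> (y $ 3) * (LINT \<phi>:{0..2 * pi}|lborel. p (rot3 \<phi> y))"
      unfolding F_def set_lebesgue_integral_def by (simp add: mult.left_commute)
    thus "(LINT \<phi>|lborel. F (\<phi>, y)) = 2 * pi * (p (axis 3 1) * (\<Phi> (y $ 3) * poly (legendre l) (y $ 3)))"
      unfolding rotation_mean_harmonic[OF p hom harm y] by (simp add: mult_ac)
  qed
  ultimately show ?thesis by simp
qed

lemma set_integrable_mult_poly:
  fixes \<Phi> :: "real \<Rightarrow> real" and P :: "real poly"
  assumes "set_integrable lborel {-1<..<1} \<Phi>"
  shows "set_integrable lborel {-1<..<1} (\<lambda>s. \<Phi> s * poly P s)"
proof -
  have "continuous_on {-1..1::real} (\<lambda>s. poly P s)" by (intro continuous_intros)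
  hence "bounded ((\<lambda>s. poly P s) ` {-1..1})"
    by (rule compact_imp_bounded[OF compact_continuous_image]) simp
  then obtain B where B: "\<And>s. s \<in> {-1..1} \<Longrightarrow> \<bar>poly P s\<bar> \<le> B"
    by (fastforce simp: bounded_iff)
  have i: "integrable lborel (\<lambda>s. B * (indicator {-1<..<1} s * \<Phi> s))"
    using assms by (simp add: set_integrable_def)
  have m: "(\<lambda>s. indicator {-1<..<1} s *\<^sub>R \<Phi> s) \<in> borel_measurable lborel"
    using assms by (simp add: set_integrable_def borel_measurable_integrable)
  have "poly P \<in> borel_measurable lborel"
    by (simp add: borel_measurable_continuous_onI continuous_on_poly)
  hence "(\<lambda>s. (indicator {-1<..<1} s *\<^sub>R \<Phi> s) * poly P s) \<in> borel_measurable lborel"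
    using m by measurable
  hence m': "(\<lambda>s. indicator {-1<..<1} s *\<^sub>R (\<Phi> s * poly P s)) \<in> borel_measurable lborel"
    by (simp add: mult_ac)
  show ?thesis unfolding set_integrable_def
  proof (rule Bochner_Integration.integrable_bound[OF i m'], rule AE_I2)
    fix s :: real
    have "\<bar>\<Phi> s\<bar> * \<bar>poly P s\<bar> \<le> \<bar>\<Phi> s\<bar> * \<bar>B\<bar>" if "s \<in> {-1<..<1}"
      using B[of s] that by (intro mult_left_mono) auto
    thus "norm (indicator {-1<..<1} s *\<^sub>R (\<Phi> s * poly P s)) \<le> norm (B * (indicator {-1<..<1} s * \<Phi> s))"
      by (auto simp: indicator_def abs_mult mult.commute)
  qed
qed

text \<open>A rotation places \<open>x\<close> at the pole. By rotation invariance of the Laplacian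
  the rotated polynomial is still harmonic and homogeneous, so \<open>Funk_Hecke_axis\<close>
  applies to it.\<close>

lemma zonal_spherical_harmonic:
  assumes y: "spherical_harmonic l f" and \<Phi>: "set_integrable lborel {-1<..<1} \<Phi>" and x: "x \<in> S2"
  shows "zonal \<Phi> f x = multiplier \<Phi> l * f x"
proof -
  obtain p where p: "real_polynomial_function p" and hom: "\<And>s x. p (s *\<^sub>R x) = s ^ l * p x"
    and harm: "\<And>x. laplacian p x = 0" and fp: "\<And>x. x \<in> S2 \<Longrightarrow> f x = p x"
    using y unfolding spherical_harmonic_def by blast
  obtain R :: "real^3 \<Rightarrow> real^3" where R: "orthogonal_transformation R" "R (axis 3 1) = x"
    using exists_orthogonal_transformation_axis[OF x] .
  have lin: "linear R" and bl: "bounded_linear R"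
    using R(1) by (simp_all only: orthogonal_transformation_linear linear_conv_bounded_linear[symmetric])
  let ?q = "\<lambda>y. p (R y)"
  have qp: "real_polynomial_function ?q"
    using real_polynomial_function_compose[OF polynomial_function_bounded_linear[OF bl] p] by (simp add: o_def)
  have qhom: "?q (s *\<^sub>R y) = s ^ l * ?q y" for s y
    by (simp add: linear_cmul[OF lin] hom)
  have qharm: "laplacian ?q y = 0" for y
    by (simp add: laplacian_orthogonal_transformation[OF p R(1)] harm)
  have e: "axis 3 1 \<in> S2" by simp
  have e3: "axis 3 1 \<bullet> y = y $ 3" for y :: "real^3" by (simp add: inner_axis')
  have m: "(\<lambda>y. \<Phi> (x \<bullet> y) * p y) \<in> borel_measurable surface_measure"
  proof -
    have "(\<lambda>y. \<Phi> (x \<bullet> y)) \<in> borel_measurable surface_measure"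
      using integrable_surface_zonal[OF x \<Phi>] by simp
    moreover have "p \<in> borel_measurable surface_measure"
      by (intro borel_measurable_continuous_sphere real_polynomial_function_continuous_on p)
    ultimately show ?thesis by measurable
  qed
  have "zonal \<Phi> f x = (LINT y|surface_measure. \<Phi> (x \<bullet> y) * p y)"
    unfolding zonal_def by (rule Bochner_Integration.integral_cong) (auto simp: fp)
  also have "\<dots> = (LINT y|surface_measure. \<Phi> (x \<bullet> R y) * p (R y))"
    by (rule integral_surface_orthogonal_transformation[OF R(1) m, symmetric])
  also have "\<dots> = (LINT y|surface_measure. \<Phi> (y $ 3) * p (R y))"
    using R by (auto simp: orthogonal_transformation_def inner_axis' simp flip: R(2))
  also have "\<dots> = p (R (axis 3 1)) * (LINT y|surface_measure. \<Phi> (y $ 3) * poly (legendre l) (y $ 3))"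
    by (rule Funk_Hecke_axis[OF qp qhom qharm \<Phi>])
  also have "(LINT y|surface_measure. \<Phi> (y $ 3) * poly (legendre l) (y $ 3)) = multiplier \<Phi> l"
    using integral_surface_zonal[OF e set_integrable_mult_poly[OF \<Phi>]] by (simp add: e3 multiplier_def)
  finally show ?thesis using R(2) fp[OF x] by simp
qed

section \<open>The addition theorem\<close>

text \<open>The upper limit \<open>2*l+1\<close> is a successor, and the simplifier would split off
  the last term of each sum over a degree.\<close>

declare sum.cl_ivl_Suc [simp del]

lemma spherical_harmonic_continuous_on:
  assumes "spherical_harmonic l f"
  shows "continuous_on S2 f"
proof -
  obtain p where p: "real_polynomial_function p" and fp: "\<And>x. x \<in> S2 \<Longrightarrow> f x = p x"
    using assms unfolding spherical_harmonic_def by blast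
  have "continuous_on S2 f = continuous_on S2 p" by (rule continuous_on_cong[OF refl fp])
  thus ?thesis using real_polynomial_function_continuous_on[OF p] by simp
qed

lemma degree_legendre_le: "degree (legendre l) \<le> l"
proof -
  have "degree ([:-1, 0, 1:] ^ l :: real poly) \<le> 2 * l"
    using degree_power_le[of "[:-1, 0, 1:] :: real poly" l] by simp
  thus ?thesis unfolding legendre_def
    by (intro order_trans[OF degree_smult_le]) (simp add: degree_higher_pderiv)
qed

lemma multiplier_lower_degree:
  assumes "degree p < l"
  shows "multiplier (poly p) l = 0"
  using integral_legendre_orthogonal[OF assms] by (simp add: multiplier_def)

lemma multiplier_legendre:
  assumes "l \<noteq> l'"
  shows "multiplier (poly (legendre l)) l' = 0"
proof (cases "l < l'")
  case True
  thus ?thesis using degree_legendre_le[of l] by (intro multiplier_lower_degree) simp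
next
  case False
  hence "multiplier (poly (legendre l')) l = 0"
    using degree_legendre_le[of l'] assms by (intro multiplier_lower_degree) simp
  thus ?thesis by (simp add: multiplier_def mult.commute)
qed

text \<open>For \<open>d < l\<close> the Legendre polynomial of degree \<open>l\<close> is
  orthogonal to t^d, so by Funk-Hecke the power \<open>(x \<bullet> y) ^ d\<close> integrates to 0
  against \<open>f\<close>. This being so for all nonzero \<open>x\<close>, each coefficient of the
  resulting polynomial in \<open>x\<close> vanishes.\<close>

lemma integral_monomial_spherical_harmonic:
  assumes f: "spherical_harmonic l f" and d: "a + b + c < l"
  shows "(LINT y|surface_measure. y$1 ^ a * y$2 ^ b * y$3 ^ c * f y) = 0"
proof -
  define d where "d = a + b + c"
  let ?J = "\<lambda>i j. LINT y|surface_measure. y$1 ^ i * y$2 ^ j * y$3 ^ (d - i - j) * f y"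
  note fc = spherical_harmonic_continuous_on[OF f]
  have int: "integrable surface_measure (\<lambda>y. y$1 ^ i * y$2 ^ j * y$3 ^ k * f y)" for i j k
    by (intro integrable_continuous_sphere continuous_intros fc)
  have zero: "(LINT y|surface_measure. (x \<bullet> y) ^ d * f y) = 0" if x: "x \<noteq> 0" for x
  proof -
    have s: "sgn x \<in> S2" using x by (simp add: norm_sgn)
    have "zonal (poly (monom 1 d)) f (sgn x) = 0"
      using zonal_spherical_harmonic[OF f set_integrable_poly s, of "monom 1 d"] d
      by (simp add: multiplier_lower_degree degree_monom_eq d_def)
    hence "(LINT y|surface_measure. (sgn x \<bullet> y) ^ d * f y) = 0"
      by (simp add: zonal_def poly_monom)
    moreover have "(x \<bullet> y) ^ d * f y = norm x ^ d * ((sgn x \<bullet> y) ^ d * f y)" for y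
    proof -
      have "x \<bullet> y = norm x * (sgn x \<bullet> y)" using x by (simp add: sgn_div_norm)
      thus ?thesis by (simp only: power_mult_distrib mult.assoc)
    qed
    ultimately show ?thesis by (simp only: integral_mult_right_zero)
  qed
  \<comment> \<open>For \<open>x\<close> of the form \<open>vec3 u v 1\<close> the integral is a
    polynomial in \<open>u\<close> whose coefficients are polynomials in \<open>v\<close>; two uses
    of \<open>polyfun_eq_0\<close> isolate a single monomial.\<close>
  have "(\<Sum>i\<le>d. (\<Sum>j\<le>d - i. of_nat (d choose i) * of_nat ((d - i) choose j) * ?J i j * v ^ j) * u ^ i) = 0" for u v
  proof -
    have "(vec3 u v 1 \<bullet> y) ^ d = (\<Sum>i\<le>d. \<Sum>j\<le>d - i. of_nat (d choose i) * of_nat ((d - i) choose j) * v ^ j * u ^ i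
        * (y$1 ^ i * y$2 ^ j * y$3 ^ (d - i - j)))" for y
    proof -
      have "vec3 u v 1 \<bullet> y = u * y$1 + (v * y$2 + y$3)"
        by (simp add: inner_vec_def sum_3 axis_def)
      thus ?thesis
        by (simp add: binomial_ring sum_distrib_left sum_distrib_right power_mult_distrib mult_ac)
    qed
    hence "(LINT y|surface_measure. (vec3 u v 1 \<bullet> y) ^ d * f y) =
      (LINT y|surface_measure. (\<Sum>i\<le>d. \<Sum>j\<le>d - i. of_nat (d choose i) * of_nat ((d - i) choose j) * v ^ j * u ^ i
        * (y$1 ^ i * y$2 ^ j * y$3 ^ (d - i - j) * f y)))"
      by (simp add: sum_distrib_right mult.assoc)
    also have "\<dots> = (\<Sum>i\<le>d. \<Sum>j\<le>d - i. of_nat (d choose i) * of_nat ((d - i) choose j) * v ^ j * u ^ i * ?J i j)"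
      by (subst Bochner_Integration.integral_sum,
          intro Bochner_Integration.integrable_sum integrable_mult_right int,
          subst Bochner_Integration.integral_sum,
          intro integrable_mult_right int) simp
    also have "\<dots> = (\<Sum>i\<le>d. (\<Sum>j\<le>d - i. of_nat (d choose i) * of_nat ((d - i) choose j) * ?J i j * v ^ j) * u ^ i)"
      by (simp only: sum_distrib_right, intro sum.cong refl, simp only: mult_ac)
    finally show ?thesis
      using zero[of "vec3 u v 1"] vec3_nth(3)[of u v 1] by (metis zero_index zero_neq_one)
  qed
  hence h: "\<forall>i\<le>d. (\<Sum>j\<le>d - i. of_nat (d choose i) * of_nat ((d - i) choose j) * ?J i j * v ^ j) = 0" for v
    by (intro polyfun_eq_0[THEN iffD1] allI)
  have "a \<le> d" by (simp add: d_def)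
  hence "(\<Sum>j\<le>d - a. of_nat (d choose a) * of_nat ((d - a) choose j) * ?J a j * v ^ j) = 0" for v
    using h by blast
  hence "\<forall>j\<le>d - a. of_nat (d choose a) * of_nat ((d - a) choose j) * ?J a j = 0"
    by (intro polyfun_eq_0[THEN iffD1] allI)
  moreover have "b \<le> d - a" "d - a - b = c" by (simp_all add: d_def)
  ultimately have "of_nat (d choose a) * of_nat ((d - a) choose b) * ?J a b = 0" by blast
  moreover have "d choose a \<noteq> 0" "(d - a) choose b \<noteq> 0"
    by (simp_all add: d_def binomial_eq_0_iff)
  ultimately show ?thesis using \<open>d - a - b = c\<close> by simp
qed

text \<open>The product of the first two is a homogeneous polynomial of degree
  \<open>l + l'\<close>, whose monomials are orthogonal to \<open>h\<close> one by one.\<close>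

lemma integral_product_spherical_harmonics:
  assumes f: "spherical_harmonic l f" and g: "spherical_harmonic l' g" and h: "spherical_harmonic m h"
    and lt: "l + l' < m"
  shows "(LINT y|surface_measure. f y * g y * h y) = 0"
proof -
  obtain p where p: "real_polynomial_function p" "\<And>s x. p (s *\<^sub>R x) = s ^ l * p x"
    and fp: "\<And>x. x \<in> S2 \<Longrightarrow> f x = p x"
    using f unfolding spherical_harmonic_def by blast
  obtain p' where p': "real_polynomial_function p'" "\<And>s x. p' (s *\<^sub>R x) = s ^ l' * p' x"
    and gp: "\<And>x. x \<in> S2 \<Longrightarrow> g x = p' x"
    using g unfolding spherical_harmonic_def by blast
  have "real_polynomial_function (\<lambda>x. p x * p' x)" using p(1) p'(1) by blast
  moreover have "p (s *\<^sub>R x) * p' (s *\<^sub>R x) = s ^ (l + l') * (p x * p' x)" for s x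
    by (simp add: p(2) p'(2) power_add)
  ultimately obtain xs where xs: "(\<lambda>x. p x * p' x) = monomials xs"
    and deg: "\<And>C a b c. (C, a, b, c) \<in> set xs \<Longrightarrow> a + b + c = l + l'"
    using homogeneous_imp_monomials[of "\<lambda>x. p x * p' x" "l + l'"] by blast
  note hc = spherical_harmonic_continuous_on[OF h]
  have int: "integrable surface_measure (\<lambda>y. y$1 ^ i * y$2 ^ j * y$3 ^ k * h y)" for i j k
    by (intro integrable_continuous_sphere continuous_intros hc)
  have int2: "integrable surface_measure (\<lambda>y. monomials zs y * h y)" for zs
  proof (induction zs)
    case (Cons m zs)
    obtain C a b c where m: "m = (C, a, b, c)" by (cases m) auto
    show ?case using Cons integrable_mult_right[OF int, of C a b c] by (simp add: m distrib_right mult.assoc)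
  qed simp
  have "(LINT y|surface_measure. f y * g y * h y) = (LINT y|surface_measure. monomials xs y * h y)"
    by (rule Bochner_Integration.integral_cong) (simp_all add: fp gp flip: xs)
  also have "\<dots> = 0" using deg
  proof (induction xs)
    case (Cons m xs)
    obtain C a b c where m: "m = (C, a, b, c)" by (cases m) auto
    have z: "(LINT y|surface_measure. y$1 ^ a * y$2 ^ b * y$3 ^ c * h y) = 0"
      by (rule integral_monomial_spherical_harmonic[OF h]) (use Cons.prems[of C a b c] m lt in auto)
    have "(LINT y|surface_measure. monomials (m # xs) y * h y)
      = (LINT y|surface_measure. C * (y$1 ^ a * y$2 ^ b * y$3 ^ c * h y) + monomials xs y * h y)"
      by (simp add: m distrib_right mult.assoc)
    also have "\<dots> = C * 0 + (LINT y|surface_measure. monomials xs y * h y)"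
      by (subst Bochner_Integration.integral_add[OF integrable_mult_right[OF int] int2]) (simp add: z)
    finally show ?case using Cons.IH[OF Cons.prems[OF list.set_intros(2)]] by simp
  qed simp
  finally show ?thesis .
qed

section \<open>Finite expansions in the basis\<close>

definition harmonic_sum :: "harmonics \<Rightarrow> (nat \<Rightarrow> nat \<Rightarrow> real) \<Rightarrow> nat \<Rightarrow> real^3 \<Rightarrow> real" where
  "harmonic_sum Y c n x = (\<Sum>l\<le>n. \<Sum>k=1..2*l+1. c l k * Y l k x)"

locale harmonic_basis =
  fixes Y :: harmonics
  assumes basis: "spherical_harmonic_basis Y"
begin

lemma harmonic: "k \<in> {1..2*l+1} \<Longrightarrow> spherical_harmonic l (Y l k)"
  using basis unfolding spherical_harmonic_basis_def by blast

lemma continuous_Y: "k \<in> {1..2*l+1} \<Longrightarrow> continuous_on S2 (Y l k)"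
  using harmonic spherical_harmonic_continuous_on by blast

lemma orthonormal:
  "k \<in> {1..2*l+1} \<Longrightarrow> k' \<in> {1..2*l'+1} \<Longrightarrow>
    (LINT x|surface_measure. Y l k x * Y l' k' x) = (if l = l' \<and> k = k' then 1 else 0)"
  using basis unfolding spherical_harmonic_basis_def by blast

lemma complete:
  "v \<in> L2_sphere \<Longrightarrow> (\<lambda>n. LINT x|surface_measure.
     (v x - harmonic_sum Y (fourier Y v) n x)\<^sup>2) \<longlonglongrightarrow> 0"
  using basis unfolding spherical_harmonic_basis_def harmonic_sum_def by blast

lemma continuous_harmonic_sum: "continuous_on S2 (harmonic_sum Y c n)"
  unfolding harmonic_sum_def by (intro continuous_intros continuous_Y) auto

lemma integral_harmonic_sum_mult:
  assumes "continuous_on S2 v"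
  shows "(LINT x|surface_measure. harmonic_sum Y c n x * v x) = (\<Sum>l\<le>n. \<Sum>k=1..2*l+1. c l k * fourier Y v l k)"
proof -
  have i: "integrable surface_measure (\<lambda>x. c l k * (v x * Y l k x))" if "k \<in> {1..2*l+1}" for l k
    by (intro integrable_continuous_sphere continuous_intros continuous_Y assms that)
  have "(LINT x|surface_measure. harmonic_sum Y c n x * v x)
    = (LINT x|surface_measure. (\<Sum>l\<le>n. \<Sum>k=1..2*l+1. c l k * (v x * Y l k x)))"
    by (simp only: harmonic_sum_def sum_distrib_right mult.assoc mult.commute[of "v _"])
  also have "\<dots> = (\<Sum>l\<le>n. (LINT x|surface_measure. (\<Sum>k=1..2*l+1. c l k * (v x * Y l k x))))"
    by (intro Bochner_Integration.integral_sum Bochner_Integration.integrable_sum i)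
  also have "\<dots> = (\<Sum>l\<le>n. \<Sum>k=1..2*l+1. (LINT x|surface_measure. c l k * (v x * Y l k x)))"
    by (intro sum.cong refl Bochner_Integration.integral_sum i)
  finally show ?thesis by (simp add: fourier_def)
qed

lemma fourier_harmonic_sum:
  assumes "k \<in> {1..2*l+1}"
  shows "fourier Y (harmonic_sum Y c n) l k = (if l \<le> n then c l k else 0)"
proof -
  have f: "fourier Y (Y l k) l' k' = (if l' = l \<and> k' = k then 1 else 0)" if "k' \<in> {1..2*l'+1}" for l' k'
    using orthonormal[OF assms that] by (auto simp: fourier_def)
  have "fourier Y (harmonic_sum Y c n) l k = (LINT x|surface_measure. harmonic_sum Y c n x * Y l k x)"
    by (simp add: fourier_def)
  also have "\<dots> = (\<Sum>l'\<le>n. \<Sum>k'=1..2*l'+1. c l' k' * fourier Y (Y l k) l' k')"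
    by (rule integral_harmonic_sum_mult[OF continuous_Y[OF assms]])
  also have "\<dots> = (\<Sum>l'\<le>n. \<Sum>k'=1..2*l'+1. if k' = k then (if l' = l then c l k else 0) else 0)"
    by (intro sum.cong refl) (auto simp: f)
  also have "\<dots> = (\<Sum>l'\<le>n. if l' = l then c l k else 0)"
    using assms by (intro sum.cong refl) (auto simp: sum.delta)
  also have "\<dots> = (if l \<le> n then c l k else 0)" by (simp add: sum.delta)
  finally show ?thesis .
qed

lemma integral_harmonic_sum_squared:
  "(LINT x|surface_measure. (harmonic_sum Y c n x)\<^sup>2) = (\<Sum>l\<le>n. \<Sum>k=1..2*l+1. (c l k)\<^sup>2)"
  unfolding power2_eq_square integral_harmonic_sum_mult[OF continuous_harmonic_sum]
  by (intro sum.cong refl) (auto simp: fourier_harmonic_sum)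

lemma continuous_in_L2:
  assumes "continuous_on S2 v"
  shows "v \<in> L2_sphere"
  unfolding L2_sphere_def
  by (auto intro!: borel_measurable_continuous_sphere integrable_continuous_sphere continuous_intros assms)

text \<open>Beyond \<open>n\<close> the partial sums no longer change, so their mean-square error,
  which tends to 0, is already 0; continuity makes the equality pointwise.\<close>

lemma eq_harmonic_sum:
  assumes v: "continuous_on S2 v" and z: "\<And>l k. l > n \<Longrightarrow> k \<in> {1..2*l+1} \<Longrightarrow> fourier Y v l k = 0"
    and x: "x \<in> S2"
  shows "v x = harmonic_sum Y (fourier Y v) n x"
proof -
  let ?a = "\<lambda>m. LINT x|surface_measure. (v x - harmonic_sum Y (fourier Y v) m x)\<^sup>2"
  have eq: "harmonic_sum Y (fourier Y v) m x = harmonic_sum Y (fourier Y v) n x" if "m \<ge> n" for m x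
    unfolding harmonic_sum_def using that by (intro sum.mono_neutral_right) (auto simp: z intro!: sum.neutral)
  have am: "?a m = ?a n" if "n \<le> m" for m by (simp only: eq[OF that])
  have "eventually (\<lambda>m. ?a m = ?a n) sequentially" 
    using eventually_ge_at_top[of n] by (rule eventually_mono) (rule am)
  hence "?a \<longlonglongrightarrow> ?a n" by (rule tendsto_eventually)
  hence an: "?a n = 0" using complete[OF continuous_in_L2[OF v]] LIMSEQ_unique by blast
  have "continuous_on S2 (\<lambda>x. v x - harmonic_sum Y (fourier Y v) n x)"
    by (intro continuous_intros v continuous_harmonic_sum)
  from continuous_sphere_eq_0[OF this an x] show ?thesis by simp
qed

text \<open>As a function of \<open>z\<close>, \<open>poly (legendre l) (x \<bullet> z)\<close> has
  by Funk-Hecke the coefficients \<open>\<mu> * Y l k x\<close>, in degree \<open>l\<close> only;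
  \<open>eq_harmonic_sum\<close> turns this into an identity. Integrating its diagonal over the
  sphere determines \<open>\<mu>\<close>.\<close>

lemma addition_theorem:
  assumes x: "x \<in> S2" and y: "y \<in> S2"
  shows "(\<Sum>k=1..2*l+1. Y l k x * Y l k y) = (2 * real l + 1) / (4 * pi) * poly (legendre l) (x \<bullet> y)"
proof -
  define \<mu> where "\<mu> = multiplier (poly (legendre l)) l"
  have *: "poly (legendre l) (x \<bullet> y) = \<mu> * (\<Sum>k=1..2*l+1. Y l k x * Y l k y)"
    if x: "x \<in> S2" and y: "y \<in> S2" for x y
  proof -
    let ?v = "\<lambda>z. poly (legendre l) (x \<bullet> z)"
    have c: "continuous_on S2 ?v" by (intro continuous_intros)
    have f: "fourier Y ?v m k = (if m = l then \<mu> * Y l k x else 0)" if "k \<in> {1..2*m+1}" for m k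
      using zonal_spherical_harmonic[OF harmonic[OF that] set_integrable_poly x, of "legendre l"]
        multiplier_legendre[of l m]
      by (auto simp: fourier_def zonal_def \<mu>_def)
    have "?v y = harmonic_sum Y (fourier Y ?v) l y"
      by (rule eq_harmonic_sum[OF c _ y]) (auto simp: f)
    also have "\<dots> = (\<Sum>m\<le>l. if m = l then (\<Sum>k=1..2*l+1. \<mu> * Y l k x * Y l k y) else 0)"
      unfolding harmonic_sum_def by (intro sum.cong refl) (auto simp: f)
    also have "\<dots> = \<mu> * (\<Sum>k=1..2*l+1. Y l k x * Y l k y)"
      by (simp add: sum_distrib_left mult.assoc)
    finally show ?thesis .
  qed
  have "4 * pi = (LINT z|surface_measure. 1)" by (simp add: measure_surface_sphere)
  also have "\<dots> = (LINT z|surface_measure. \<mu> * (\<Sum>k=1..2*l+1. Y l k z * Y l k z))"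
  proof (rule Bochner_Integration.integral_cong[OF refl])
    fix z assume "z \<in> space surface_measure"
    hence z: "z \<in> S2" by simp
    hence "z \<bullet> z = 1" by (simp add: norm_eq_1)
    thus "1 = \<mu> * (\<Sum>k=1..2*l+1. Y l k z * Y l k z)" using *[OF z z] by simp
  qed
  also have "\<dots> = \<mu> * (\<Sum>k=1..2*l+1. (LINT z|surface_measure. Y l k z * Y l k z))"
    by (subst integral_mult_right_zero, subst Bochner_Integration.integral_sum)
       (auto intro!: integrable_continuous_sphere continuous_intros continuous_Y)
  also have "(\<Sum>k=1..2*l+1. (LINT z|surface_measure. Y l k z * Y l k z)) = (\<Sum>k=1..2*l+1. 1)"
    by (intro sum.cong refl) (subst orthonormal, auto)
  finally have "4 * pi = \<mu> * (2 * real l + 1)" by simp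
  moreover have "2 * real l + 1 \<noteq> 0" by linarith
  ultimately have "\<mu> = 4 * pi / (2 * real l + 1)" by (simp only: eq_divide_eq) simp
  thus ?thesis unfolding *[OF x y] using \<open>2 * real l + 1 \<noteq> 0\<close> by simp
qed

lemma sum_Y_squared: "x \<in> S2 \<Longrightarrow> (\<Sum>k=1..2*l+1. (Y l k x)\<^sup>2) = (2 * real l + 1) / (4 * pi)"
  using addition_theorem[of x x l] by (simp add: power2_eq_square norm_eq_1)

lemma abs_sum_Y_le:
  assumes "x \<in> S2"
  shows "\<bar>\<Sum>k=1..2*l+1. c k * Y l k x\<bar> \<le> sqrt (\<Sum>k=1..2*l+1. (c k)\<^sup>2) * sqrt ((2 * real l + 1) / (4 * pi))"
proof -
  have "(\<Sum>k=1..2*l+1. c k * Y l k x)\<^sup>2 \<le> (\<Sum>k=1..2*l+1. (c k)\<^sup>2) * (\<Sum>k=1..2*l+1. (Y l k x)\<^sup>2)"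
    by (rule Cauchy_Schwarz_ineq_sum)
  hence "sqrt ((\<Sum>k=1..2*l+1. c k * Y l k x)\<^sup>2) \<le> sqrt ((\<Sum>k=1..2*l+1. (c k)\<^sup>2) * (\<Sum>k=1..2*l+1. (Y l k x)\<^sup>2))"
    by (rule real_sqrt_le_mono)
  thus ?thesis unfolding sum_Y_squared[OF assms] by (simp only: real_sqrt_mult real_sqrt_abs)
qed

lemma mem_Pn_iff: "p \<in> Pn Y n \<longleftrightarrow> (\<exists>c. \<forall>x\<in>S2. p x = harmonic_sum Y c n x)"
  unfolding Pn_def harmonic_sum_def by blast

lemma harmonic_sum_in_Pn: "harmonic_sum Y c n \<in> Pn Y n"
  unfolding mem_Pn_iff by blast

lemma Pn_mono:
  assumes "p \<in> Pn Y m" "m \<le> n"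
  shows "p \<in> Pn Y n"
proof -
  obtain c where c: "\<And>x. x \<in> S2 \<Longrightarrow> p x = harmonic_sum Y c m x" using assms(1) unfolding mem_Pn_iff by blast
  have "harmonic_sum Y c m x = harmonic_sum Y (\<lambda>l k. if l \<le> m then c l k else 0) n x" for x
    unfolding harmonic_sum_def using assms(2) by (intro sum.mono_neutral_cong_left) auto
  thus ?thesis unfolding mem_Pn_iff using c by auto
qed

lemma Y_in_Pn:
  assumes "k \<in> {1..2*l+1}"
  shows "Y l k \<in> Pn Y l"
proof -
  have "Y l k x = harmonic_sum Y (\<lambda>l' k'. if l' = l \<and> k' = k then 1 else 0) l x" for x
  proof -
    have "harmonic_sum Y (\<lambda>l' k'. if l' = l \<and> k' = k then 1 else 0) l x
      = (\<Sum>l'\<le>l. \<Sum>k'=1..2*l'+1. if k' = k then (if l' = l then Y l k x else 0) else 0)"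
      unfolding harmonic_sum_def by (intro sum.cong refl) auto
    also have "\<dots> = (\<Sum>l'\<le>l. if l' = l then Y l k x else 0)"
      using assms by (intro sum.cong refl) (auto simp: sum.delta)
    finally show ?thesis by simp
  qed
  thus ?thesis unfolding mem_Pn_iff by blast
qed

text \<open>Exactness is assumed on \<open>Pn Y t\<close>; placing products in such a span is what
  lets quadrature reproduce inner products. Coefficients beyond degree \<open>a + b\<close> vanish
  by \<open>integral_product_spherical_harmonics\<close>.\<close>

lemma Pn_mult:
  assumes p: "p \<in> Pn Y a" and q: "q \<in> Pn Y b"
  shows "(\<lambda>x. p x * q x) \<in> Pn Y (a + b)"
proof -
  obtain c where c: "\<And>x. x \<in> S2 \<Longrightarrow> p x = harmonic_sum Y c a x" using p unfolding mem_Pn_iff by blast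
  obtain d where d: "\<And>x. x \<in> S2 \<Longrightarrow> q x = harmonic_sum Y d b x" using q unfolding mem_Pn_iff by blast
  let ?v = "\<lambda>x. harmonic_sum Y c a x * harmonic_sum Y d b x"
  have cv: "continuous_on S2 ?v" by (intro continuous_intros continuous_harmonic_sum)
  have "fourier Y ?v m j = 0" if m: "m > a + b" and j: "j \<in> {1..2*m+1}" for m j
  proof -
    have "fourier Y ?v m j = (LINT x|surface_measure. harmonic_sum Y c a x * (harmonic_sum Y d b x * Y m j x))"
      by (simp add: fourier_def mult.assoc)
    also have "\<dots> = (\<Sum>l\<le>a. \<Sum>k=1..2*l+1. c l k * fourier Y (\<lambda>x. harmonic_sum Y d b x * Y m j x) l k)"
      by (intro integral_harmonic_sum_mult continuous_intros continuous_harmonic_sum continuous_Y j)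
    also have "\<dots> = 0"
    proof (intro sum.neutral ballI)
      fix l k assume l: "l \<in> {..a}" and k: "k \<in> {1..2*l+1}"
      have "fourier Y (\<lambda>x. harmonic_sum Y d b x * Y m j x) l k
        = (LINT x|surface_measure. harmonic_sum Y d b x * (Y m j x * Y l k x))"
        by (simp add: fourier_def mult.assoc)
      also have "\<dots> = (\<Sum>l'\<le>b. \<Sum>k'=1..2*l'+1. d l' k' * fourier Y (\<lambda>x. Y m j x * Y l k x) l' k')"
        by (intro integral_harmonic_sum_mult continuous_intros continuous_Y j k)
      also have "\<dots> = 0"
      proof (intro sum.neutral ballI)
        fix l' k' assume l': "l' \<in> {..b}" and k': "k' \<in> {1..2*l'+1}"
        have "fourier Y (\<lambda>x. Y m j x * Y l k x) l' k' = (LINT x|surface_measure. Y l k x * Y l' k' x * Y m j x)"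
          by (simp add: fourier_def mult_ac)
        also have "\<dots> = 0"
          by (rule integral_product_spherical_harmonics[OF harmonic[OF k] harmonic[OF k'] harmonic[OF j]])
             (use l l' m in auto)
        finally show "d l' k' * fourier Y (\<lambda>x. Y m j x * Y l k x) l' k' = 0" by simp
      qed
      finally show "c l k * fourier Y (\<lambda>x. harmonic_sum Y d b x * Y m j x) l k = 0" by simp
    qed
    finally show ?thesis .
  qed
  hence "\<forall>x\<in>S2. p x * q x = harmonic_sum Y (fourier Y ?v) (a + b) x"
    using eq_harmonic_sum[OF cv] c d by simp
  thus ?thesis unfolding mem_Pn_iff by blast
qed

end

section \<open>Sobolev spaces\<close>

text \<open>By Parseval, the squared L2 norm of the component of degree \<open>l\<close>.
  Coefficient families take the place of functions from here on.\<close>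

definition energy :: "(nat \<Rightarrow> nat \<Rightarrow> real) \<Rightarrow> nat \<Rightarrow> real" where
  "energy c l = (\<Sum>k=1..2*l+1. (c l k)\<^sup>2)"

abbreviation sobolev_weight :: "real \<Rightarrow> nat \<Rightarrow> real" where
  "sobolev_weight r l \<equiv> (1 + real l * (real l + 1)) powr r"

definition admissible :: "real \<Rightarrow> (nat \<Rightarrow> nat \<Rightarrow> real) \<Rightarrow> bool" where
  "admissible r c \<longleftrightarrow> summable (\<lambda>l. sobolev_weight r l * energy c l)"

definition layer :: "harmonics \<Rightarrow> (nat \<Rightarrow> nat \<Rightarrow> real) \<Rightarrow> nat \<Rightarrow> real^3 \<Rightarrow> real" where
  "layer Y c l x = (\<Sum>k=1..2*l+1. c l k * Y l k x)"

text \<open>The series is grouped by degree because the addition theorem bounds a whole layer at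
  once.\<close>

definition harmonic_series :: "harmonics \<Rightarrow> (nat \<Rightarrow> nat \<Rightarrow> real) \<Rightarrow> real^3 \<Rightarrow> real" where
  "harmonic_series Y c x = (\<Sum>l. layer Y c l x)"

lemma harmonic_sum_layer: "harmonic_sum Y c n x = (\<Sum>l\<le>n. layer Y c l x)"
  by (simp add: harmonic_sum_def layer_def)

lemma energy_nonneg [simp]: "0 \<le> energy c l"
  by (simp add: energy_def sum_nonneg)

lemma sobolev_weight_pos: "0 < sobolev_weight r l"
proof -
  have "0 < 1 + real l * (real l + 1)" by (intro add_pos_nonneg) auto
  thus ?thesis by simp
qed

lemma sobolev_term_energy: "sobolev_term Y r v l = sobolev_weight r l * energy (fourier Y v) l"
  by (simp add: sobolev_term_def energy_def)

lemma energy_le: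
  assumes "\<And>k. k \<in> {1..2*l+1} \<Longrightarrow> \<bar>d l k\<bar> \<le> K * \<bar>c l k\<bar>"
  shows "energy d l \<le> K\<^sup>2 * energy c l"
  unfolding energy_def sum_distrib_left
proof (rule sum_mono)
  fix k assume "k \<in> {1..2*l+1}"
  hence "\<bar>d l k\<bar>\<^sup>2 \<le> (K * \<bar>c l k\<bar>)\<^sup>2" using assms by (intro power_mono) auto
  thus "(d l k)\<^sup>2 \<le> K\<^sup>2 * (c l k)\<^sup>2" by (simp add: power_mult_distrib)
qed

lemma energy_add_le: "energy (\<lambda>l k. c l k + d l k) l \<le> 2 * energy c l + 2 * energy d l"
  unfolding energy_def sum_distrib_left sum.distrib[symmetric]
proof (rule sum_mono)
  fix k
  show "(c l k + d l k)\<^sup>2 \<le> 2 * (c l k)\<^sup>2 + 2 * (d l k)\<^sup>2"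
    using sum_squares_bound[of "c l k" "d l k"] by (simp add: power2_sum)
qed

lemma energy_cong:
  assumes "\<And>k. k \<in> {1..2*l+1} \<Longrightarrow> c l k = d l k"
  shows "energy c l = energy d l"
  unfolding energy_def using assms by (intro sum.cong) auto

lemma admissible_bounded:
  assumes "admissible r c" "\<And>l k. k \<in> {1..2*l+1} \<Longrightarrow> \<bar>d l k\<bar> \<le> K * \<bar>c l k\<bar>"
  shows "admissible r d"
  unfolding admissible_def
proof (rule summable_comparison_test')
  show "summable (\<lambda>l. K\<^sup>2 * (sobolev_weight r l * energy c l))"
    using assms(1) unfolding admissible_def by (rule summable_mult)
  fix l :: nat assume "0 \<le> l"
  show "norm (sobolev_weight r l * energy d l) \<le> K\<^sup>2 * (sobolev_weight r l * energy c l)"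
    using mult_left_mono[OF energy_le[of l d K c], of "sobolev_weight r l"] assms(2) by (simp add: mult_ac)
qed

lemma admissible_add:
  assumes "admissible r c" "admissible r d"
  shows "admissible r (\<lambda>l k. c l k + d l k)"
  unfolding admissible_def
proof (rule summable_comparison_test')
  show "summable (\<lambda>l. 2 * (sobolev_weight r l * energy c l) + 2 * (sobolev_weight r l * energy d l))"
    using assms unfolding admissible_def by (intro summable_add summable_mult)
  fix l :: nat assume "0 \<le> l"
  show "norm (sobolev_weight r l * energy (\<lambda>l k. c l k + d l k) l)
      \<le> 2 * (sobolev_weight r l * energy c l) + 2 * (sobolev_weight r l * energy d l)"
    using mult_left_mono[OF energy_add_le[of c d l], of "sobolev_weight r l"] by (simp add: algebra_simps)
qed

lemma admissible_finite: "admissible r (\<lambda>l k. if l \<le> n then c l k else 0)"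
  unfolding admissible_def
  by (rule summable_finite[of "{..n}"]) (auto simp: energy_def)

lemma inverse_sobolev_weight_le:
  assumes "0 \<le> r"
  shows "1 / sobolev_weight r l \<le> 2 powr r * (real l + 1) powr (- 2 * r)"
proof -
  have "(real l + 1)\<^sup>2 / 2 \<le> 1 + real l * (real l + 1)"
    by (simp add: power2_eq_square algebra_simps)
  hence "((real l + 1)\<^sup>2 / 2) powr r \<le> sobolev_weight r l"
    using assms by (intro powr_mono2) auto
  hence "1 / sobolev_weight r l \<le> 1 / ((real l + 1)\<^sup>2 / 2) powr r"
    by (intro divide_left_mono) (auto intro!: mult_pos_pos add_pos_nonneg)
  also have "\<dots> = 2 powr r * (real l + 1) powr (- 2 * r)"
  proof -
    have "((real l + 1)\<^sup>2) powr r = (real l + 1) powr (2 * r)"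
      by (simp add: powr_powr flip: powr_numeral)
    thus ?thesis by (simp add: powr_divide powr_minus divide_simps)
  qed
  finally show ?thesis .
qed

text \<open>The terms are of order l^(1 - 2 r). This is the Sobolev embedding into continuous
  functions, and the place where its threshold \<open>r > 1\<close> arises.\<close>

lemma summable_inverse_sobolev_weight:
  assumes "r > 1"
  shows "summable (\<lambda>l. (2 * real l + 1) / sobolev_weight r l)"
proof (rule summable_comparison_test')
  have "summable (\<lambda>l. real (Suc l) powr (1 - 2 * r))"
    using assms by (subst summable_Suc_iff) (simp add: summable_real_powr_iff)
  thus "summable (\<lambda>l. 2 * 2 powr r * real (Suc l) powr (1 - 2 * r))" by (rule summable_mult)
  fix l :: nat assume "0 \<le> l"
  have "(2 * real l + 1) * (1 / sobolev_weight r l) \<le> (2 * (real l + 1)) * (2 powr r * (real l + 1) powr (- 2 * r))"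
    using assms by (intro mult_mono inverse_sobolev_weight_le) auto
  also have "\<dots> = 2 * 2 powr r * ((real l + 1) powr 1 * (real l + 1) powr (- 2 * r))" by simp
  also have "\<dots> = 2 * 2 powr r * real (Suc l) powr (1 - 2 * r)"
    unfolding powr_add[symmetric] by (simp add: add.commute)
  finally show "norm ((2 * real l + 1) / sobolev_weight r l) \<le> 2 * 2 powr r * real (Suc l) powr (1 - 2 * r)"
    by simp
qed

lemma summable_layer_bound:
  assumes "r > 1" "admissible r c"
  shows "summable (\<lambda>l. sqrt (energy c l) * sqrt ((2 * real l + 1) / (4 * pi)))"
proof (rule summable_comparison_test')
  show "summable (\<lambda>l. 1 / 2 * (sobolev_weight r l * energy c l) + 1 / (8 * pi) * ((2 * real l + 1) / sobolev_weight r l))"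
    using assms(2) summable_inverse_sobolev_weight[OF assms(1)] unfolding admissible_def
    by (intro summable_add summable_mult)
  fix l :: nat assume "0 \<le> l"
  note w = sobolev_weight_pos[of l r]
  \<comment> \<open>The arithmetic-geometric mean in place of Cauchy-Schwarz yields a termwise
    majorant.\<close>
  have am: "sqrt a * sqrt b \<le> (a + b) / 2" if "0 \<le> a" "0 \<le> b" for a b
    using arith_geo_mean_sqrt[OF that] by (simp add: real_sqrt_mult)
  have "sqrt (energy c l) * sqrt ((2 * real l + 1) / (4 * pi))
      = sqrt (sobolev_weight r l * energy c l) * sqrt (1 / (4 * pi) * ((2 * real l + 1) / sobolev_weight r l))"
    using w by (simp flip: real_sqrt_mult)
  also have "\<dots> \<le> (sobolev_weight r l * energy c l + 1 / (4 * pi) * ((2 * real l + 1) / sobolev_weight r l)) / 2"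
    using w by (intro am) auto
  finally show "norm (sqrt (energy c l) * sqrt ((2 * real l + 1) / (4 * pi)))
     \<le> 1 / 2 * (sobolev_weight r l * energy c l) + 1 / (8 * pi) * ((2 * real l + 1) / sobolev_weight r l)"
    by (simp add: abs_mult add_divide_distrib)
qed

lemma zonal_cong: "(\<And>y. y \<in> S2 \<Longrightarrow> v y = w y) \<Longrightarrow> zonal \<Phi> v x = zonal \<Phi> w x"
  unfolding zonal_def by (intro Bochner_Integration.integral_cong) auto

lemma fourier_cong: "(\<And>y. y \<in> S2 \<Longrightarrow> v y = w y) \<Longrightarrow> fourier Y v l k = fourier Y w l k"
  unfolding fourier_def by (intro Bochner_Integration.integral_cong) auto

section \<open>Infinite expansions, Sobolev functions and the action of the operator\<close>

context harmonic_basis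
begin

lemma continuous_layer: "continuous_on S2 (layer Y c l)"
  unfolding layer_def by (intro continuous_intros continuous_Y) auto

lemma abs_layer_le:
  "x \<in> S2 \<Longrightarrow> \<bar>layer Y c l x\<bar> \<le> sqrt (energy c l) * sqrt ((2 * real l + 1) / (4 * pi))"
  unfolding layer_def energy_def by (rule abs_sum_Y_le)

lemma summable_layer:
  assumes "r > 1" "admissible r c" "x \<in> S2"
  shows "summable (\<lambda>l. \<bar>layer Y c l x\<bar>)" "summable (\<lambda>l. layer Y c l x)"
proof -
  show "summable (\<lambda>l. \<bar>layer Y c l x\<bar>)"
    by (rule summable_comparison_test'[OF summable_layer_bound[OF assms(1,2)]])
       (use abs_layer_le[OF assms(3)] in auto)
  thus "summable (\<lambda>l. layer Y c l x)" by (rule summable_rabs_cancel)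
qed

lemma abs_harmonic_series_le:
  assumes "r > 1" "admissible r c" "x \<in> S2"
  shows "\<bar>harmonic_series Y c x\<bar> \<le> (\<Sum>l. sqrt (energy c l) * sqrt ((2 * real l + 1) / (4 * pi)))"
proof -
  have "\<bar>harmonic_series Y c x\<bar> \<le> (\<Sum>l. \<bar>layer Y c l x\<bar>)"
    unfolding harmonic_series_def by (rule summable_rabs[OF summable_layer(1)[OF assms]])
  also have "\<dots> \<le> (\<Sum>l. sqrt (energy c l) * sqrt ((2 * real l + 1) / (4 * pi)))"
    by (intro suminf_le abs_layer_le assms(3) summable_layer(1)[OF assms] summable_layer_bound[OF assms(1,2)])
  finally show ?thesis .
qed

lemma continuous_harmonic_series:
  assumes "r > 1" "admissible r c"
  shows "continuous_on S2 (harmonic_series Y c)"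
proof (rule uniform_limit_theorem)
  show "uniform_limit S2 (\<lambda>n x. \<Sum>l<n. layer Y c l x) (harmonic_series Y c) sequentially"
    unfolding harmonic_series_def
    by (rule Weierstrass_m_test[OF _ summable_layer_bound[OF assms]]) (simp add: abs_layer_le)
  show "\<forall>\<^sub>F n in sequentially. continuous_on S2 (\<lambda>x. \<Sum>l<n. layer Y c l x)"
    by (intro always_eventually allI continuous_on_sum continuous_layer)
qed simp

lemma integrable_mult_continuous:
  assumes G: "integrable surface_measure G" and v: "continuous_on S2 v"
  shows "integrable surface_measure (\<lambda>y. G y * v y :: real)"
proof -
  obtain B where B: "\<And>y. y \<in> S2 \<Longrightarrow> \<bar>v y\<bar> \<le> B" using continuous_on_sphere_bounded[OF v] by metis
  have [measurable]: "G \<in> borel_measurable surface_measure" using G by simp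
  have [measurable]: "v \<in> borel_measurable surface_measure" by (rule borel_measurable_continuous_sphere[OF v])
  show ?thesis
  proof (rule Bochner_Integration.integrable_bound[OF integrable_mult_right[OF G, of B]])
    show "AE y in surface_measure. norm (G y * v y) \<le> norm (B * G y)"
    proof (rule AE_I2)
      fix y assume "y \<in> space surface_measure"
      hence "\<bar>v y\<bar> \<le> \<bar>B\<bar>" using B[of y] by simp
      hence "\<bar>G y\<bar> * \<bar>v y\<bar> \<le> \<bar>G y\<bar> * \<bar>B\<bar>" by (intro mult_left_mono) auto
      thus "norm (G y * v y) \<le> norm (B * G y)" by (simp add: abs_mult mult.commute)
    qed
  qed measurable
qed

text \<open>Stated for every integrable \<open>G\<close>: a basis function gives the Fourier
  coefficients, a zonal kernel the action of the operator. The layer bounds, uniform on the sphere,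
  justify exchanging sum and integral.\<close>

lemma integral_harmonic_series:
  assumes r: "r > 1" and c: "admissible r c" and G: "integrable surface_measure G"
  shows "(\<lambda>l. LINT y|surface_measure. G y * layer Y c l y) sums (LINT y|surface_measure. G y * harmonic_series Y c y)"
proof -
  let ?b = "\<lambda>l. sqrt (energy c l) * sqrt ((2 * real l + 1) / (4 * pi))"
  have int: "integrable surface_measure (\<lambda>y. G y * layer Y c l y)" for l
    by (rule integrable_mult_continuous[OF G continuous_layer])
  have "(\<lambda>l. LINT y|surface_measure. G y * layer Y c l y) sums (LINT y|surface_measure. (\<Sum>l. G y * layer Y c l y))"
  proof (rule sums_integral[OF int])
    show "AE y in surface_measure. summable (\<lambda>l. norm (G y * layer Y c l y))"
      by (rule AE_I2) (use summable_mult[OF summable_layer(1)[OF r c]] in \<open>simp add: abs_mult\<close>)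
    show "summable (\<lambda>l. LINT y|surface_measure. norm (G y * layer Y c l y))"
    proof (rule summable_comparison_test')
      show "summable (\<lambda>l. ?b l * (LINT y|surface_measure. \<bar>G y\<bar>))"
        by (rule summable_mult2[OF summable_layer_bound[OF r c]])
      fix l :: nat assume "0 \<le> l"
      have "(LINT y|surface_measure. norm (G y * layer Y c l y)) \<le> (LINT y|surface_measure. ?b l * \<bar>G y\<bar>)"
      proof (rule integral_mono)
        fix y assume "y \<in> space surface_measure"
        hence "\<bar>layer Y c l y\<bar> \<le> ?b l" by (intro abs_layer_le) simp
        hence "\<bar>layer Y c l y\<bar> * \<bar>G y\<bar> \<le> ?b l * \<bar>G y\<bar>" by (rule mult_right_mono) simp
        thus "norm (G y * layer Y c l y) \<le> ?b l * \<bar>G y\<bar>" by (simp only: real_norm_def abs_mult mult.commute)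
      qed (intro integrable_norm int, intro integrable_mult_right integrable_abs G)
      thus "norm (LINT y|surface_measure. norm (G y * layer Y c l y)) \<le> ?b l * (LINT y|surface_measure. \<bar>G y\<bar>)"
        by simp
    qed
  qed
  also have "(LINT y|surface_measure. (\<Sum>l. G y * layer Y c l y)) = (LINT y|surface_measure. G y * harmonic_series Y c y)"
    by (rule Bochner_Integration.integral_cong[OF refl])
       (simp add: harmonic_series_def suminf_mult summable_layer(2)[OF r c])
  finally show ?thesis .
qed

lemma fourier_harmonic_series:
  assumes r: "r > 1" and c: "admissible r c" and k: "k \<in> {1..2*l+1}"
  shows "fourier Y (harmonic_series Y c) l k = c l k"
proof -
  have "(LINT y|surface_measure. Y l k y * layer Y c m y) = (if m = l then c l k else 0)" for m
  proof -
    have "layer Y c m y = harmonic_sum Y (\<lambda>l k. if l = m then c l k else 0) m y" for y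
    proof -
      have "layer Y (\<lambda>l k. if l = m then c l k else 0) i y = (if i = m then layer Y c m y else 0)" for i
        by (simp add: layer_def)
      thus ?thesis by (simp add: harmonic_sum_layer)
    qed
    hence "(LINT y|surface_measure. Y l k y * layer Y c m y)
        = fourier Y (harmonic_sum Y (\<lambda>l k. if l = m then c l k else 0) m) l k"
      by (simp add: fourier_def mult.commute)
    thus ?thesis using fourier_harmonic_sum[OF k] by simp
  qed
  hence "(\<lambda>m. if m = l then c l k else 0) sums (LINT y|surface_measure. Y l k y * harmonic_series Y c y)"
    using integral_harmonic_series[OF r c integrable_continuous_sphere[OF continuous_Y[OF k]]] by simp
  moreover have "(\<lambda>m. if m = l then c l k else 0) sums c l k" by (rule sums_single)
  ultimately show ?thesis using sums_unique2 by (simp add: fourier_def mult.commute) blast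
qed

lemma zonal_harmonic_series:
  assumes r: "r > 1" and c: "admissible r c" and \<Phi>: "set_integrable lborel {-1<..<1} \<Phi>" and x: "x \<in> S2"
  shows "zonal \<Phi> (harmonic_series Y c) x = harmonic_series Y (\<lambda>l k. multiplier \<Phi> l * c l k) x"
proof -
  note G = integrable_surface_zonal[OF x \<Phi>]
  have "(LINT y|surface_measure. \<Phi> (x \<bullet> y) * layer Y c l y) = layer Y (\<lambda>l k. multiplier \<Phi> l * c l k) l x" for l
  proof -
    have "(LINT y|surface_measure. \<Phi> (x \<bullet> y) * layer Y c l y)
        = (LINT y|surface_measure. (\<Sum>k=1..2*l+1. c l k * (\<Phi> (x \<bullet> y) * Y l k y)))"
      by (simp add: layer_def sum_distrib_left mult.left_commute)
    also have "\<dots> = (\<Sum>k=1..2*l+1. c l k * zonal \<Phi> (Y l k) x)"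
      unfolding zonal_def
      by (subst Bochner_Integration.integral_sum)
         (auto intro!: integrable_mult_right integrable_mult_continuous[OF G] continuous_Y)
    also have "\<dots> = layer Y (\<lambda>l k. multiplier \<Phi> l * c l k) l x"
      unfolding layer_def
      by (intro sum.cong refl) (simp add: zonal_spherical_harmonic[OF harmonic \<Phi> x])
    finally show ?thesis .
  qed
  thus ?thesis using integral_harmonic_series[OF r c G]
    by (simp add: zonal_def harmonic_series_def sums_iff)
qed

lemma sobolev_iff: "v \<in> sobolev Y r \<longleftrightarrow> continuous_on S2 v \<and> admissible r (fourier Y v)"
proof -
  have "sobolev_term Y r v = (\<lambda>l. sobolev_weight r l * energy (fourier Y v) l)"
    by (rule ext) (rule sobolev_term_energy)
  thus ?thesis by (auto simp: sobolev_def admissible_def intro: continuous_in_L2)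
qed

lemma sobolev_cong:
  assumes "\<And>x. x \<in> S2 \<Longrightarrow> v x = w x" "v \<in> sobolev Y r"
  shows "w \<in> sobolev Y r"
proof -
  have "fourier Y v = fourier Y w" by (intro ext fourier_cong assms(1))
  moreover have "continuous_on S2 v = continuous_on S2 w" by (rule continuous_on_cong[OF refl assms(1)])
  ultimately show ?thesis using assms(2) by (simp add: sobolev_iff)
qed

lemma harmonic_series_in_sobolev:
  assumes "r > 1" "admissible r c"
  shows "harmonic_series Y c \<in> sobolev Y r"
proof -
  have "admissible r (fourier Y (harmonic_series Y c))"
    by (rule admissible_bounded[OF assms(2), where K = 1]) (simp add: fourier_harmonic_series[OF assms])
  thus ?thesis using continuous_harmonic_series[OF assms] by (simp add: sobolev_iff)
qed

lemma fourier_diff: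
  assumes "continuous_on S2 v" "continuous_on S2 w" "k \<in> {1..2*l+1}"
  shows "fourier Y (\<lambda>x. v x - w x) l k = fourier Y v l k - fourier Y w l k"
  unfolding fourier_def left_diff_distrib
  by (intro Bochner_Integration.integral_diff integrable_continuous_sphere continuous_intros continuous_Y assms)

lemma fourier_add:
  assumes "continuous_on S2 v" "continuous_on S2 w" "k \<in> {1..2*l+1}"
  shows "fourier Y (\<lambda>x. v x + w x) l k = fourier Y v l k + fourier Y w l k"
  unfolding fourier_def distrib_right
  by (intro Bochner_Integration.integral_add integrable_continuous_sphere continuous_intros continuous_Y assms)

text \<open>The difference has no nonzero coefficient, so \<open>eq_harmonic_sum\<close> applies to
  it already with \<open>n = 0\<close>.\<close>

lemma continuous_eqI:
  assumes "continuous_on S2 v" "continuous_on S2 w" "x \<in> S2"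
    "\<And>l k. k \<in> {1..2*l+1} \<Longrightarrow> fourier Y v l k = fourier Y w l k"
  shows "v x = w x"
proof -
  have c: "continuous_on S2 (\<lambda>x. v x - w x)" by (intro continuous_intros assms)
  have z: "fourier Y (\<lambda>x. v x - w x) l k = 0" if "k \<in> {1..2*l+1}" for l k
    using fourier_diff[OF assms(1,2) that] assms(4)[OF that] by simp
  have "v x - w x = harmonic_sum Y (fourier Y (\<lambda>x. v x - w x)) 0 x"
    by (rule eq_harmonic_sum[OF c _ assms(3)]) (use z in auto)
  also have "\<dots> = 0" unfolding harmonic_sum_def by (intro sum.neutral ballI) (simp add: z)
  finally show ?thesis by simp
qed

lemma sobolev_eq_harmonic_series:
  assumes "r > 1" "v \<in> sobolev Y r" "x \<in> S2"
  shows "v x = harmonic_series Y (fourier Y v) x"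
proof (rule continuous_eqI[OF _ _ assms(3)])
  have a: "admissible r (fourier Y v)" using assms by (simp add: sobolev_iff)
  show "continuous_on S2 v" using assms by (simp add: sobolev_iff)
  show "continuous_on S2 (harmonic_series Y (fourier Y v))" by (rule continuous_harmonic_series[OF assms(1) a])
  show "fourier Y v l k = fourier Y (harmonic_series Y (fourier Y v)) l k" if "k \<in> {1..2*l+1}" for l k
    using fourier_harmonic_series[OF assms(1) a that] by simp
qed

lemma sobolev_add:
  assumes "v \<in> sobolev Y r" "w \<in> sobolev Y r"
  shows "(\<lambda>x. v x + w x) \<in> sobolev Y r"
proof -
  have c: "continuous_on S2 v" "continuous_on S2 w" using assms by (auto simp: sobolev_iff)
  have "admissible r (\<lambda>l k. fourier Y v l k + fourier Y w l k)"
    using assms by (intro admissible_add) (auto simp: sobolev_iff)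
  hence "admissible r (fourier Y (\<lambda>x. v x + w x))"
    by (rule admissible_bounded[where K = 1]) (use fourier_add[OF c] in auto)
  thus ?thesis using c by (auto simp: sobolev_iff intro!: continuous_intros)
qed

lemma harmonic_sum_eq_series:
  "harmonic_sum Y c n x = harmonic_series Y (\<lambda>l k. if l \<le> n then c l k else 0) x"
proof -
  have "layer Y (\<lambda>l k. if l \<le> n then c l k else 0) l x = (if l \<in> {..n} then layer Y c l x else 0)" for l
    by (simp add: layer_def)
  hence "harmonic_series Y (\<lambda>l k. if l \<le> n then c l k else 0) x = (\<Sum>l. if l \<in> {..n} then layer Y c l x else 0)"
    by (simp add: harmonic_series_def)
  also have "\<dots> = (\<Sum>l\<in>{..n}. layer Y c l x)"
    using sums_unique[OF sums_If_finite_set[of "{..n}" "\<lambda>l. layer Y c l x"]] by simp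
  finally show ?thesis by (simp add: harmonic_sum_layer)
qed

lemma zonal_harmonic_sum:
  assumes \<Phi>: "set_integrable lborel {-1<..<1} \<Phi>" and x: "x \<in> S2"
  shows "zonal \<Phi> (harmonic_sum Y c n) x = harmonic_sum Y (\<lambda>l k. multiplier \<Phi> l * c l k) n x"
proof -
  have "zonal \<Phi> (harmonic_sum Y c n) x = zonal \<Phi> (harmonic_series Y (\<lambda>l k. if l \<le> n then c l k else 0)) x"
    by (rule zonal_cong) (rule harmonic_sum_eq_series)
  \<comment> \<open>Finitely many coefficients are admissible for every exponent; 2 is an arbitrary
    choice above 1.\<close>
  also have "\<dots> = harmonic_series Y (\<lambda>l k. multiplier \<Phi> l * (if l \<le> n then c l k else 0)) x"
    by (rule zonal_harmonic_series[OF _ admissible_finite \<Phi> x, of 2]) simp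
  also have "(\<lambda>l k. multiplier \<Phi> l * (if l \<le> n then c l k else 0)) = (\<lambda>l k. if l \<le> n then multiplier \<Phi> l * c l k else 0)"
    by (auto simp: fun_eq_iff)
  also have "harmonic_series Y \<dots> x = harmonic_sum Y (\<lambda>l k. multiplier \<Phi> l * c l k) n x"
    by (rule harmonic_sum_eq_series[symmetric])
  finally show ?thesis .
qed

lemma harmonic_sum_in_sobolev: "r > 1 \<Longrightarrow> harmonic_sum Y c n \<in> sobolev Y r"
  using sobolev_cong[OF harmonic_sum_eq_series[symmetric] harmonic_series_in_sobolev[OF _ admissible_finite]]
  by blast

lemma zonal_sobolev:
  assumes r: "r > 1" and v: "v \<in> sobolev Y r" and \<Phi>: "set_integrable lborel {-1<..<1} \<Phi>"
    and K: "\<And>l. \<bar>multiplier \<Phi> l\<bar> \<le> K"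
  shows "zonal \<Phi> v \<in> sobolev Y r"
    and "k \<in> {1..2*l+1} \<Longrightarrow> fourier Y (zonal \<Phi> v) l k = multiplier \<Phi> l * fourier Y v l k"
proof -
  let ?c = "\<lambda>l k. multiplier \<Phi> l * fourier Y v l k"
  have a: "admissible r (fourier Y v)" using v by (simp add: sobolev_iff)
  have a': "admissible r ?c"
    by (rule admissible_bounded[OF a, of _ K]) (simp add: abs_mult mult_right_mono K)
  have eq: "harmonic_series Y ?c x = zonal \<Phi> v x" if "x \<in> S2" for x
  proof -
    have "zonal \<Phi> v x = zonal \<Phi> (harmonic_series Y (fourier Y v)) x"
      by (rule zonal_cong) (rule sobolev_eq_harmonic_series[OF r v])
    thus ?thesis using zonal_harmonic_series[OF r a \<Phi> that] by simp
  qed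
  show "zonal \<Phi> v \<in> sobolev Y r"
    by (rule sobolev_cong[OF eq harmonic_series_in_sobolev[OF r a']])
  show "fourier Y (zonal \<Phi> v) l k = ?c l k" if "k \<in> {1..2*l+1}"
  proof -
    have "fourier Y (zonal \<Phi> v) l k = fourier Y (harmonic_series Y ?c) l k"
      by (rule fourier_cong) (rule eq[symmetric])
    thus ?thesis using fourier_harmonic_series[OF r a' that] by simp
  qed
qed

end

section \<open>Quadrature\<close>

lemma cap_radius: "0 < 1 / (4 * (real d + 1)\<^sup>2)" "1 / (4 * (real d + 1)\<^sup>2) \<le> 1"
proof -
  have d: "1 \<le> (real d + 1)\<^sup>2" by (rule one_le_power) simp
  show "0 < 1 / (4 * (real d + 1)\<^sup>2)" using d by (intro divide_pos_pos) auto
  have "1 / (4 * (real d + 1)\<^sup>2) \<le> 1 / 1"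
  proof (rule divide_left_mono)
    show "1 \<le> 4 * (real d + 1)\<^sup>2" "0 < 4 * (real d + 1)\<^sup>2 * 1" using d by linarith+
  qed simp
  thus "1 / (4 * (real d + 1)\<^sup>2) \<le> 1" by simp
qed

text \<open>On a cap of this height the Legendre polynomials up to degree \<open>d\<close> are at
  least 1/2, so the multiplier is at least half of the cap's area 2 \<pi> \<eta>. Integration over
  caps is thus invertible on polynomials of degree at most \<open>d\<close>, with inverse
  multipliers at most 1 / (\<pi> \<eta>).\<close>

lemma multiplier_cap_ge:
  fixes d l :: nat
  assumes l: "l \<le> d" and \<eta>: "\<eta> = 1 / (4 * (real d + 1)\<^sup>2)"
  shows "pi * \<eta> \<le> multiplier (indicator {1 - \<eta>..}) l"
proof -
  have \<eta>1: "0 < \<eta>" "\<eta> \<le> 1"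
    unfolding \<eta> by (rule cap_radius)+
  let ?I = "indicator {1 - \<eta>..<1} :: real \<Rightarrow> real"
  have e: "indicator {-1<..<1} s *\<^sub>R (indicator {1 - \<eta>..} s * g) = ?I s * g" for s g :: real
    using \<eta>1 by (auto simp: indicator_def)
  have "\<eta> / 2 = (LINT s|lborel. ?I s * (1 / 2))" using \<eta>1 by simp
  also have "\<dots> \<le> (LINT s|lborel. ?I s * poly (legendre l) s)"
  proof (rule integral_mono)
    show "integrable lborel (\<lambda>s. ?I s * (1 / 2))"
      using \<eta>1 by (intro integrable_mult_left) (auto intro!: integrable_real_indicator)
    have "set_integrable lborel {1 - \<eta>..<1} (poly (legendre l))"
      by (rule set_integrable_subset[OF set_integrable_poly]) (use \<eta>1 in auto)
    thus "integrable lborel (\<lambda>s. ?I s * poly (legendre l) s)" by (simp add: set_integrable_def)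
    fix s :: real
    show "?I s * (1 / 2) \<le> ?I s * poly (legendre l) s"
    proof (cases "s \<in> {1 - \<eta>..<1}")
      case True
      have "1 / (4 * (real d + 1)\<^sup>2) \<le> 1 / (4 * (real l + 1)\<^sup>2)"
        using l by (intro divide_left_mono mult_left_mono power_mono) auto
      hence "1 / 2 \<le> poly (legendre l) s" using True \<eta> by (intro poly_legendre_ge_half) auto
      thus ?thesis using True by simp
    qed simp
  qed
  also have "\<dots> = (LINT s:{-1<..<1}|lborel. indicator {1 - \<eta>..} s * poly (legendre l) s)"
    unfolding set_lebesgue_integral_def e ..
  finally show ?thesis unfolding multiplier_def using pi_gt_zero by (simp add: field_simps)
qed

section \<open>Positive quadrature within and beyond its degree of exactness\<close>

locale positive_quadrature = harmonic_basis Y for Y :: harmonics +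
  fixes N :: nat and w :: "nat \<Rightarrow> real" and x :: "nat \<Rightarrow> real^3" and t :: nat
  assumes nodes: "j \<in> {1..N} \<Longrightarrow> x j \<in> S2"
    and weights: "j \<in> {1..N} \<Longrightarrow> 0 < w j"
    and exact: "exact_on (quadrature N w x) (Pn Y t)"
begin

abbreviation "Q \<equiv> quadrature N w x"

lemma Q_cong: "(\<And>y. y \<in> S2 \<Longrightarrow> g y = h y) \<Longrightarrow> Q g = Q h"
  unfolding quadrature_def using nodes by (intro sum.cong) auto

lemma Q_mono: "(\<And>y. y \<in> S2 \<Longrightarrow> g y \<le> h y) \<Longrightarrow> Q g \<le> Q h"
  unfolding quadrature_def using nodes weights by (intro sum_mono mult_left_mono) (auto intro: less_imp_le)

lemma Q_nonneg: "(\<And>y. y \<in> S2 \<Longrightarrow> 0 \<le> g y) \<Longrightarrow> 0 \<le> Q g"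
  unfolding quadrature_def using nodes weights by (intro sum_nonneg mult_nonneg_nonneg) (auto intro: less_imp_le)

lemma Q_add: "Q (\<lambda>y. g y + h y) = Q g + Q h"
  by (simp add: quadrature_def sum.distrib distrib_left)

lemma Q_cmult: "Q (\<lambda>y. c * g y) = c * Q g"
  by (simp add: quadrature_def sum_distrib_left mult.left_commute)

lemma Q_sum: "Q (\<lambda>y. \<Sum>i\<in>I. g i y) = (\<Sum>i\<in>I. Q (g i))"
  unfolding quadrature_def sum_distrib_left by (rule sum.swap)

lemma Q_exact: "p \<in> Pn Y m \<Longrightarrow> m \<le> t \<Longrightarrow> Q p = (LINT y|surface_measure. p y)"
  using exact Pn_mono unfolding exact_on_def by blast

lemma Q_mult_exact:
  "p \<in> Pn Y a \<Longrightarrow> q \<in> Pn Y b \<Longrightarrow> a + b \<le> t \<Longrightarrow> Q (\<lambda>y. p y * q y) = (LINT y|surface_measure. p y * q y)"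
  by (rule Q_exact[OF Pn_mult])

lemma Q_mult_harmonic_sum:
  "Q (\<lambda>y. g y * harmonic_sum Y c n y) = (\<Sum>l\<le>n. \<Sum>k=1..2*l+1. c l k * Q (\<lambda>y. g y * Y l k y))"
proof -
  have "Q (\<lambda>y. g y * harmonic_sum Y c n y) = Q (\<lambda>y. \<Sum>l\<le>n. \<Sum>k=1..2*l+1. c l k * (g y * Y l k y))"
    by (simp add: harmonic_sum_def sum_distrib_left mult.left_commute)
  thus ?thesis by (simp add: Q_sum Q_cmult)
qed

lemma Q_harmonic_sum_mult_Y:
  assumes "k \<in> {1..2*l+1}" "n + l \<le> t"
  shows "Q (\<lambda>y. harmonic_sum Y c n y * Y l k y) = (if l \<le> n then c l k else 0)"
  using Q_mult_exact[OF harmonic_sum_in_Pn Y_in_Pn[OF assms(1)] assms(2)] fourier_harmonic_sum[OF assms(1)]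
  by (simp add: fourier_def)

text \<open>The indicator of a cap of radius about \<open>1/m\<close> is dominated by the square of the reproducing kernel.\<close>

lemma Q_cap_le:
  assumes z: "z \<in> S2" and m: "2 * m \<le> t"
  shows "Q (\<lambda>y. indicator {1 - 1 / (4 * (real m + 1)\<^sup>2)..} (z \<bullet> y)) \<le> 16 * pi / (real m + 1)\<^sup>2"
proof -
  let ?\<eta> = "1 / (4 * (real m + 1)\<^sup>2)"
  let ?K = "harmonic_sum Y (\<lambda>l k. Y l k z) m"
  have sq: "(\<Sum>l\<le>m. 2 * real l + 1) = (real m + 1)\<^sup>2"
    by (induction m) (simp_all add: power2_eq_square algebra_simps)
  have K: "?K y = (\<Sum>l\<le>m. (2 * real l + 1) / (4 * pi) * poly (legendre l) (z \<bullet> y))" if "y \<in> S2" for y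
    unfolding harmonic_sum_def by (intro sum.cong refl addition_theorem z that)
  have Kge: "(real m + 1)\<^sup>2 / (8 * pi) \<le> ?K y" if y: "y \<in> S2" and cap: "1 - ?\<eta> \<le> z \<bullet> y" for y
  proof -
    have zy: "z \<bullet> y \<le> 1" using norm_cauchy_schwarz[of z y] z y by simp
    have "(real m + 1)\<^sup>2 / (8 * pi) = (\<Sum>l\<le>m. (2 * real l + 1) / (4 * pi) * (1 / 2))"
      unfolding sq[symmetric] sum_divide_distrib by simp
    also have "\<dots> \<le> ?K y" unfolding K[OF y]
    proof (intro sum_mono mult_left_mono)
      fix l assume "l \<in> {..m}"
      hence "?\<eta> \<le> 1 / (4 * (real l + 1)\<^sup>2)"
        by (intro divide_left_mono mult_left_mono power_mono) auto
      thus "1 / 2 \<le> poly (legendre l) (z \<bullet> y)" using cap zy by (intro poly_legendre_ge_half) auto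
    qed auto
    finally show ?thesis .
  qed
  have m0: "0 < (real m + 1)\<^sup>2" by (simp add: add_nonneg_eq_0_iff power2_eq_square)
  \<comment> \<open>The reciprocal of the lower bound in \<open>Kge\<close>, so that
    \<open>?a * ?K y \<ge> 1\<close> on the cap.\<close>
  let ?a = "8 * pi / (real m + 1)\<^sup>2"
  have "Q (\<lambda>y. indicator {1 - ?\<eta>..} (z \<bullet> y)) \<le> Q (\<lambda>y. ?a\<^sup>2 * (?K y * ?K y))"
  proof (rule Q_mono)
    fix y :: "real^3" assume y: "y \<in> S2"
    show "indicator {1 - ?\<eta>..} (z \<bullet> y) \<le> ?a\<^sup>2 * (?K y * ?K y)"
    proof (cases "1 - ?\<eta> \<le> z \<bullet> y")
      case True
      have "1 = ?a * ((real m + 1)\<^sup>2 / (8 * pi))" using m0 by simp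
      also have "\<dots> \<le> ?a * ?K y" using Kge[OF y True] by (intro mult_left_mono) auto
      finally have "1 \<le> (?a * ?K y)\<^sup>2" by (rule one_le_power)
      hence "1 \<le> ?a\<^sup>2 * (?K y * ?K y)" by (simp only: power_mult_distrib power2_eq_square[of "?K y"])
      thus ?thesis using True by (simp only: indicator_simps(1) atLeast_iff)
    qed simp
  qed
  also have "\<dots> = ?a\<^sup>2 * (LINT y|surface_measure. ?K y * ?K y)"
    unfolding Q_cmult using m
    by (subst Q_mult_exact[OF harmonic_sum_in_Pn harmonic_sum_in_Pn]) auto
  also have "(LINT y|surface_measure. ?K y * ?K y) = (\<Sum>l\<le>m. \<Sum>k=1..2*l+1. (Y l k z)\<^sup>2)"
    using integral_harmonic_sum_squared[of "\<lambda>l k. Y l k z" m] by (simp add: power2_eq_square)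
  also have "\<dots> = (\<Sum>l\<le>m. (2 * real l + 1) / (4 * pi))"
    by (intro sum.cong refl sum_Y_squared z)
  also have "\<dots> = (real m + 1)\<^sup>2 / (4 * pi)"
    unfolding sq[symmetric] sum_divide_distrib ..
  also have "?a\<^sup>2 * \<dots> = 16 * pi / (real m + 1)\<^sup>2"
  proof -
    have "(8 * pi / D)\<^sup>2 * (D / (4 * pi)) = 16 * pi / D" if "0 < D" for D :: real
      using that by (simp add: power2_eq_square field_simps)
    thus ?thesis using m0 by blast
  qed
  finally show ?thesis .
qed

text \<open>
  A Marcinkiewicz--Zygmund inequality beyond the degree of exactness: a polynomial of degree \<open>d\<close> is the
  average over caps of radius about \<open>1/d\<close> of a polynomial of comparable norm, and the quadrature
  measure of such a cap is controlled by \<open>Q_cap_le\<close>.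
\<close>

lemma Marcinkiewicz_Zygmund:
  assumes m: "2 * m \<le> t" and md: "m \<le> d"
  shows "Q (\<lambda>y. (harmonic_sum Y c d y)\<^sup>2) \<le> 128 * ((real d + 1) / (real m + 1))\<^sup>2 * (\<Sum>l\<le>d. energy c l)"
proof -
  define \<eta> where "\<eta> = 1 / (4 * (real d + 1)\<^sup>2)"
  define \<Phi> :: "real \<Rightarrow> real" where "\<Phi> = indicator {1 - \<eta>..}"
  \<comment> \<open>Dividing by the multipliers undoes the integration over caps:
    \<open>?h z\<close> is the integral of \<open>?h'\<close> over the cap about
    \<open>z\<close>.\<close>
  define c' where "c' = (\<lambda>l k. c l k / multiplier \<Phi> l)"
  let ?h = "harmonic_sum Y c d" and ?h' = "harmonic_sum Y c' d"
  have \<eta>0: "0 < \<eta>" and \<eta>1: "\<eta> \<le> 1" unfolding \<eta>_def by (rule cap_radius)+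
  have \<mu>: "pi * \<eta> \<le> multiplier \<Phi> l" if "l \<le> d" for l
    unfolding \<Phi>_def by (rule multiplier_cap_ge[OF that \<eta>_def])
  have \<mu>0: "0 < multiplier \<Phi> l" if "l \<le> d" for l
    using \<mu>[OF that] \<eta>0 by (meson less_le_trans mult_pos_pos pi_gt_zero)
  have \<Phi>i: "set_integrable lborel {-1<..<1} \<Phi>"
  proof -
    have "set_integrable lborel ({-1<..<1} \<inter> {1 - \<eta>..}) (\<lambda>_. 1 :: real)"
      by (rule set_integrable_subset[of _ "{-1<..<1}"]) (auto simp: set_integrable_def intro!: integrable_real_indicator)
    thus ?thesis unfolding set_integrable_def \<Phi>_def by (simp add: indicator_inter_arith)
  qed
  have mass: "(LINT y|surface_measure. \<Phi> (z \<bullet> y)) = 2 * pi * \<eta>" if z: "z \<in> S2" for z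
  proof -
    have "(LINT y|surface_measure. \<Phi> (z \<bullet> y)) = 2 * pi * (LINT s:{-1<..<1}|lborel. \<Phi> s)"
      by (rule integral_surface_zonal[OF z \<Phi>i])
    also have "(LINT s:{-1<..<1}|lborel. \<Phi> s) = (LINT s|lborel. indicator {1 - \<eta>..<1} s)"
      unfolding set_lebesgue_integral_def
      by (intro Bochner_Integration.integral_cong refl) (use \<eta>0 \<eta>1 in \<open>auto simp: \<Phi>_def indicator_def\<close>)
    also have "\<dots> = \<eta>" using \<eta>0 by simp
    finally show ?thesis .
  qed
  have average: "?h z = (LINT y|surface_measure. \<Phi> (z \<bullet> y) * ?h' y)" if z: "z \<in> S2" for z
  proof -
    have "zonal \<Phi> ?h' z = harmonic_sum Y (\<lambda>l k. multiplier \<Phi> l * c' l k) d z"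
      by (rule zonal_harmonic_sum[OF \<Phi>i z])
    also have "\<dots> = ?h z"
      unfolding harmonic_sum_def using \<mu>0 by (intro sum.cong refl) (auto simp: c'_def less_imp_neq[symmetric])
    finally show ?thesis by (simp add: zonal_def)
  qed
  have int1: "integrable surface_measure (\<lambda>y. \<Phi> (z \<bullet> y) * v y)" if "z \<in> S2" "continuous_on S2 v" for z v
    by (rule integrable_mult_continuous[OF integrable_surface_zonal[OF that(1) \<Phi>i] that(2)])
  have cs: "(?h z)\<^sup>2 \<le> 2 * pi * \<eta> * (LINT y|surface_measure. \<Phi> (z \<bullet> y) * (?h' y)\<^sup>2)" if z: "z \<in> S2" for z
  proof -
    \<comment> \<open>\<open>a\<close> is the mean of \<open>?h'\<close> over the cap; that the
      variance is nonnegative is Cauchy-Schwarz for this weight.\<close>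
    define a where "a = ?h z / (2 * pi * \<eta>)"
    have i0: "integrable surface_measure (\<lambda>y. \<Phi> (z \<bullet> y))" by (rule integrable_surface_zonal[OF z \<Phi>i])
    have i1: "integrable surface_measure (\<lambda>y. \<Phi> (z \<bullet> y) * ?h' y)"
      by (rule int1[OF z continuous_harmonic_sum])
    have i2: "integrable surface_measure (\<lambda>y. \<Phi> (z \<bullet> y) * (?h' y)\<^sup>2)"
      by (intro int1[OF z] continuous_intros continuous_harmonic_sum)
    have "0 \<le> (LINT y|surface_measure. \<Phi> (z \<bullet> y) * (?h' y - a)\<^sup>2)"
      by (rule Bochner_Integration.integral_nonneg) (simp add: \<Phi>_def)
    also have "\<dots> = (LINT y|surface_measure. \<Phi> (z \<bullet> y) * (?h' y)\<^sup>2 - 2 * a * (\<Phi> (z \<bullet> y) * ?h' y) + a\<^sup>2 * \<Phi> (z \<bullet> y))"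
      by (intro Bochner_Integration.integral_cong refl) (simp add: power2_eq_square algebra_simps)
    also have "\<dots> = (LINT y|surface_measure. \<Phi> (z \<bullet> y) * (?h' y)\<^sup>2) - 2 * a * (LINT y|surface_measure. \<Phi> (z \<bullet> y) * ?h' y)
        + a\<^sup>2 * (LINT y|surface_measure. \<Phi> (z \<bullet> y))"
      by (simp add: Bochner_Integration.integral_add Bochner_Integration.integral_diff i0 i1 i2)
    also have "\<dots> = (LINT y|surface_measure. \<Phi> (z \<bullet> y) * (?h' y)\<^sup>2) - 2 * a * ?h z + a\<^sup>2 * (2 * pi * \<eta>)"
      by (simp only: average[OF z, symmetric] mass[OF z])
    also have "a\<^sup>2 * (2 * pi * \<eta>) = a * ?h z" using \<eta>0 by (simp add: a_def power2_eq_square)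
    finally have "a * ?h z \<le> (LINT y|surface_measure. \<Phi> (z \<bullet> y) * (?h' y)\<^sup>2)" by simp
    hence "2 * pi * \<eta> * (a * ?h z) \<le> 2 * pi * \<eta> * (LINT y|surface_measure. \<Phi> (z \<bullet> y) * (?h' y)\<^sup>2)"
      using \<eta>0 by (intro mult_left_mono) auto
    moreover have "2 * pi * \<eta> * (a * ?h z) = (?h z)\<^sup>2" using \<eta>0 by (simp add: a_def power2_eq_square)
    ultimately show ?thesis by simp
  qed
  \<comment> \<open>The cap of height \<open>\<eta>\<close> lies inside the larger one belonging to
    \<open>m\<close>, the size that the exactness of \<open>Q\<close> resolves.\<close>
  have capQ: "Q (\<lambda>z. \<Phi> (z \<bullet> y)) \<le> 16 * pi / (real m + 1)\<^sup>2" if y: "y \<in> S2" for y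
  proof -
    have "\<eta> \<le> 1 / (4 * (real m + 1)\<^sup>2)" unfolding \<eta>_def
      using md by (intro divide_left_mono mult_left_mono power_mono) auto
    hence "Q (\<lambda>z. \<Phi> (z \<bullet> y)) \<le> Q (\<lambda>z. indicator {1 - 1 / (4 * (real m + 1)\<^sup>2)..} (y \<bullet> z))"
      unfolding \<Phi>_def by (intro Q_mono) (auto simp: indicator_def inner_commute)
    also have "\<dots> \<le> 16 * pi / (real m + 1)\<^sup>2" by (rule Q_cap_le[OF y m])
    finally show ?thesis .
  qed
  have c2: "continuous_on S2 (\<lambda>y. (?h' y)\<^sup>2)" by (intro continuous_intros continuous_harmonic_sum)
  have "Q (\<lambda>z. (?h z)\<^sup>2) \<le> Q (\<lambda>z. 2 * pi * \<eta> * (LINT y|surface_measure. \<Phi> (z \<bullet> y) * (?h' y)\<^sup>2))"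
    by (rule Q_mono) (rule cs)
  \<comment> \<open>\<open>Q\<close> acts on the centre \<open>z\<close> and is a finite sum, so it
    passes under the integral, where it meets only the indicator of the cap.\<close>
  also have "\<dots> = 2 * pi * \<eta> * (LINT y|surface_measure. Q (\<lambda>z. \<Phi> (z \<bullet> y)) * (?h' y)\<^sup>2)"
  proof -
    have "(LINT y|surface_measure. Q (\<lambda>z. \<Phi> (z \<bullet> y)) * (?h' y)\<^sup>2)
      = (LINT y|surface_measure. (\<Sum>j=1..N. w j * (\<Phi> (x j \<bullet> y) * (?h' y)\<^sup>2)))"
      by (simp add: quadrature_def sum_distrib_right mult.assoc)
    also have "\<dots> = (\<Sum>j=1..N. w j * (LINT y|surface_measure. \<Phi> (x j \<bullet> y) * (?h' y)\<^sup>2))"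
      by (subst Bochner_Integration.integral_sum) (use nodes int1[OF _ c2] in auto)
    finally show ?thesis by (simp add: quadrature_def sum_distrib_left mult_ac)
  qed
  also have "\<dots> \<le> 2 * pi * \<eta> * (LINT y|surface_measure. 16 * pi / (real m + 1)\<^sup>2 * (?h' y)\<^sup>2)"
  proof (intro mult_left_mono integral_mono)
    have "integrable surface_measure (\<lambda>y. \<Sum>j=1..N. w j * (\<Phi> (x j \<bullet> y) * (?h' y)\<^sup>2))"
      by (intro Bochner_Integration.integrable_sum integrable_mult_right int1[OF nodes c2])
    thus "integrable surface_measure (\<lambda>y. Q (\<lambda>z. \<Phi> (z \<bullet> y)) * (?h' y)\<^sup>2)"
      by (simp add: quadrature_def sum_distrib_right mult.assoc)
    show "integrable surface_measure (\<lambda>y. 16 * pi / (real m + 1)\<^sup>2 * (?h' y)\<^sup>2)"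
      by (intro integrable_mult_right integrable_continuous_sphere c2)
    fix y assume "y \<in> space surface_measure"
    thus "Q (\<lambda>z. \<Phi> (z \<bullet> y)) * (?h' y)\<^sup>2 \<le> 16 * pi / (real m + 1)\<^sup>2 * (?h' y)\<^sup>2"
      by (intro mult_right_mono capQ) auto
  qed (use \<eta>0 in auto)
  also have "(LINT y|surface_measure. 16 * pi / (real m + 1)\<^sup>2 * (?h' y)\<^sup>2)
      = 16 * pi / (real m + 1)\<^sup>2 * (\<Sum>l\<le>d. energy c' l)"
    by (simp only: integral_mult_right_zero integral_harmonic_sum_squared energy_def)
  also have "2 * pi * \<eta> * (16 * pi / (real m + 1)\<^sup>2 * (\<Sum>l\<le>d. energy c' l))
     \<le> 2 * pi * \<eta> * (16 * pi / (real m + 1)\<^sup>2 * (\<Sum>l\<le>d. (1 / (pi * \<eta>))\<^sup>2 * energy c l))"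
  proof (intro mult_left_mono sum_mono energy_le)
    fix l k assume "l \<in> {..d}"
    hence l: "l \<le> d" by simp
    have "\<bar>c' l k\<bar> = \<bar>c l k\<bar> / multiplier \<Phi> l" using \<mu>0[OF l] by (simp add: c'_def abs_divide)
    also have "\<dots> \<le> \<bar>c l k\<bar> / (pi * \<eta>)"
      using \<mu>[OF l] \<mu>0[OF l] \<eta>0 by (intro divide_left_mono) auto
    finally show "\<bar>c' l k\<bar> \<le> 1 / (pi * \<eta>) * \<bar>c l k\<bar>" by simp
  qed (use \<eta>0 in auto)
  \<comment> \<open>The constant 32 collects 2 \<pi> \<eta> from the mass of the cap, 16 \<pi> from
    \<open>Q_cap_le\<close> and 1 / (\<pi> \<eta>)^2 from the inverse multipliers; then 1 / \<eta> =
    4 (d + 1)^2 makes it 128.\<close>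
  also have "\<dots> = 32 / \<eta> / (real m + 1)\<^sup>2 * (\<Sum>l\<le>d. energy c l)"
  proof -
    have "2 * pi * \<eta> * (16 * pi / D * ((1 / (pi * \<eta>))\<^sup>2 * S)) = 32 / \<eta> / D * S" for D S :: real
      using \<eta>0 by (simp add: power2_eq_square)
    thus ?thesis by (simp only: sum_distrib_left[symmetric])
  qed
  also have "32 / \<eta> / (real m + 1)\<^sup>2 = 128 * ((real d + 1) / (real m + 1))\<^sup>2"
    by (simp add: \<eta>_def power_divide)
  finally show ?thesis .
qed

text \<open>By exactness on degree \<open>2 * n\<close> the \<open>Y l k\<close> with
  \<open>l \<le> n\<close> are orthonormal for the discrete inner product, and this is Bessel's
  inequality there.\<close>

lemma Bessel_Q:
  assumes n: "2 * n \<le> t"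
  shows "(\<Sum>l\<le>n. energy (\<lambda>l k. Q (\<lambda>y. g y * Y l k y)) l) \<le> Q (\<lambda>y. (g y)\<^sup>2)"
proof -
  define D where "D = (\<lambda>l k. Q (\<lambda>y. g y * Y l k y))"
  let ?h = "harmonic_sum Y D n" and ?E = "\<Sum>l\<le>n. energy D l"
  have 1: "Q (\<lambda>y. g y * ?h y) = ?E"
    unfolding Q_mult_harmonic_sum by (simp add: energy_def D_def power2_eq_square)
  have 2: "Q (\<lambda>y. ?h y * ?h y) = ?E"
    using Q_mult_exact[OF harmonic_sum_in_Pn harmonic_sum_in_Pn, of n n D D] n integral_harmonic_sum_squared[of D n]
    by (simp add: power2_eq_square energy_def)
  have "0 \<le> Q (\<lambda>y. (g y - ?h y)\<^sup>2)" by (rule Q_nonneg) simp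
  also have "\<dots> = Q (\<lambda>y. (g y)\<^sup>2 + ((- 2) * (g y * ?h y) + ?h y * ?h y))"
    by (intro Q_cong) (simp add: power2_eq_square algebra_simps)
  also have "\<dots> = Q (\<lambda>y. (g y)\<^sup>2) + ((- 2) * ?E + ?E)"
    unfolding Q_add Q_cmult 1 2 ..
  finally show ?thesis by (simp add: D_def)
qed

definition Q_norm :: "(real^3 \<Rightarrow> real) \<Rightarrow> real" where
  "Q_norm g = sqrt (Q (\<lambda>y. (g y)\<^sup>2))"

text \<open>Moving the square roots of the weights into the values makes the triangle inequality of
  \<open>L2_set\<close> available.\<close>

lemma Q_norm_L2_set: "Q_norm g = L2_set (\<lambda>j. sqrt (w j) * g (x j)) {1..N}"
  unfolding Q_norm_def L2_set_def quadrature_def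
  using weights by (intro arg_cong[of _ _ sqrt] sum.cong) (auto simp: power_mult_distrib less_imp_le)

lemma Q_norm_add: "Q_norm (\<lambda>y. g y + h y) \<le> Q_norm g + Q_norm h"
  unfolding Q_norm_L2_set distrib_left by (rule L2_set_triangle_ineq)

lemma Q_norm_sum: "Q_norm (\<lambda>y. \<Sum>j<(J::nat). g j y) \<le> (\<Sum>j<J. Q_norm (g j))"
proof (induction J)
  case 0
  show ?case by (simp add: Q_norm_def quadrature_def)
next
  case (Suc J)
  have "Q_norm (\<lambda>y. \<Sum>j<Suc J. g j y) \<le> Q_norm (\<lambda>y. \<Sum>j<J. g j y) + Q_norm (g J)"
    using Q_norm_add[of "\<lambda>y. \<Sum>j<J. g j y" "g J"] by simp
  thus ?case using Suc by simp
qed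

text \<open>Dyadic decomposition of the tail of the series of \<open>f\<close> beyond the degree \<open>s\<close>.\<close>

lemma Q_norm_tail_le:
  assumes r: "r > 1" and f: "f \<in> sobolev Y r" and s: "1 \<le> s" "s \<le> t" "t \<le> 2 * s"
  shows "Q_norm (\<lambda>y. f y - harmonic_sum Y (fourier Y f) s y)
    \<le> 2 * sqrt 2048 / (1 - 2 powr (1 - r)) * real s powr (- r) * sobolev_norm Y r f"
proof -
  let ?F = "fourier Y f"
  define B where "B = (\<lambda>j. harmonic_sum Y (\<lambda>l k. if 2 ^ j * s < l then ?F l k else 0) (2 ^ Suc j * s))"
  define M where "M = sobolev_norm Y r f"
  have a: "summable (\<lambda>l. sobolev_weight r l * energy ?F l)"
    using f by (simp add: sobolev_iff admissible_def)
  have M: "M = sqrt (\<Sum>l. sobolev_weight r l * energy ?F l)"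
    by (simp add: M_def sobolev_norm_def sobolev_term_energy)
  have M2: "M\<^sup>2 = (\<Sum>l. sobolev_weight r l * energy ?F l)"
    unfolding M by (intro real_sqrt_pow2 suminf_nonneg[OF a]) auto
  have M0: "0 \<le> M" unfolding M by (intro real_sqrt_ge_zero suminf_nonneg[OF a]) auto
  \<comment> \<open>The ratio of successive block bounds: the Marcinkiewicz-Zygmund factor doubles,
    while the Sobolev weight contributes \<open>2 powr (- r)\<close>.\<close>
  define \<theta> where "\<theta> = 2 powr (1 - r)"
  have \<theta>: "0 < \<theta>" "\<theta> < 1" using r by (auto simp: \<theta>_def powr_less_one)
  have Bj: "Q_norm (B j) \<le> 2 * sqrt 2048 * \<theta> ^ j * (real s powr (- r) * M)" for j
  proof -
    let ?c = "\<lambda>l k. if 2 ^ j * s < l then ?F l k else 0"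
    define u where "u = real (2 ^ j * s)"
    have u0: "0 < u" using s by (simp add: u_def)
    have en: "(\<Sum>l\<le>2 ^ Suc j * s. energy ?c l) \<le> u powr (- 2 * r) * M\<^sup>2"
    proof -
      have "energy ?c l \<le> u powr (- 2 * r) * (sobolev_weight r l * energy ?F l)" for l
      proof (cases "2 ^ j * s < l")
        case True
        hence ul: "u \<le> real l" by (simp add: u_def less_imp_le of_nat_le_iff del: of_nat_mult of_nat_power)
        have "u\<^sup>2 \<le> (real l)\<^sup>2" using ul u0 by (intro power_mono) auto
        also have "\<dots> \<le> 1 + real l * (real l + 1)" by (simp add: power2_eq_square algebra_simps)
        finally have "(u\<^sup>2) powr r \<le> sobolev_weight r l" using r u0 by (intro powr_mono2) auto
        moreover have "(u\<^sup>2) powr r = u powr (2 * r)"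
          using u0 by (simp add: powr_powr flip: powr_numeral)
        ultimately have "u powr (2 * r) \<le> sobolev_weight r l" by simp
        hence "u powr (- 2 * r) * u powr (2 * r) \<le> u powr (- 2 * r) * sobolev_weight r l"
          by (intro mult_left_mono) auto
        hence "1 \<le> u powr (- 2 * r) * sobolev_weight r l" using u0 by (simp flip: powr_add)
        hence "1 * energy ?F l \<le> u powr (- 2 * r) * sobolev_weight r l * energy ?F l"
          by (intro mult_right_mono) auto
        thus ?thesis using True by (simp add: energy_def mult.assoc)
      qed (simp add: energy_def sum_nonneg)
      hence "(\<Sum>l\<le>2 ^ Suc j * s. energy ?c l) \<le> (\<Sum>l\<le>2 ^ Suc j * s. u powr (- 2 * r) * (sobolev_weight r l * energy ?F l))"
        by (rule sum_mono)
      also have "\<dots> = u powr (- 2 * r) * (\<Sum>l\<le>2 ^ Suc j * s. sobolev_weight r l * energy ?F l)"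
        by (simp only: sum_distrib_left)
      also have "\<dots> \<le> u powr (- 2 * r) * M\<^sup>2"
        unfolding M2 by (intro mult_left_mono sum_le_suminf a) auto
      finally show ?thesis .
    qed
    \<comment> \<open>The choice \<open>m = t div 2\<close> is the largest that exactness allows;
      \<open>t \<le> 2 * s\<close> puts it below the top degree of every block.\<close>
    have md: "t div 2 \<le> 2 ^ Suc j * s"
    proof -
      have "t div 2 \<le> s" using s by simp
      also have "\<dots> \<le> 2 ^ Suc j * s" by simp
      finally show ?thesis .
    qed
    have ratio: "(real (2 ^ Suc j * s) + 1) / (real (t div 2) + 1) \<le> 8 * 2 ^ j"
    proof -
      have "s \<le> 2 * (t div 2) + 1" using s by linarith
      hence "real s \<le> real (2 * (t div 2) + 1)" by (rule of_nat_mono)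
      hence t2: "real s / 2 \<le> real (t div 2) + 1" by simp
      have "real (2 ^ Suc j * s) + 1 \<le> 4 * (2 ^ j * real s)"
      proof -
        have "1 \<le> 2 ^ j * real s" using s by (simp add: mult_ge1_I)
        moreover have "real (2 ^ Suc j * s) = 2 * (2 ^ j * real s)" by simp
        ultimately show ?thesis by linarith
      qed
      also have "\<dots> = 8 * 2 ^ j * (real s / 2)" by simp
      also have "\<dots> \<le> 8 * 2 ^ j * (real (t div 2) + 1)" by (rule mult_left_mono[OF t2]) simp
      finally show ?thesis by (simp add: divide_le_eq)
    qed
    have "Q (\<lambda>y. (B j y)\<^sup>2) \<le> 128 * ((real (2 ^ Suc j * s) + 1) / (real (t div 2) + 1))\<^sup>2 * (\<Sum>l\<le>2 ^ Suc j * s. energy ?c l)"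
      unfolding B_def by (rule Marcinkiewicz_Zygmund[OF _ md]) simp
    also have "\<dots> \<le> 128 * (8 * 2 ^ j)\<^sup>2 * (u powr (- 2 * r) * M\<^sup>2)"
      by (intro mult_mono power_mono ratio en sum_nonneg) auto
    \<comment> \<open>Here 128 times 8^2 equals 4 times 2048.\<close>
    also have "\<dots> = (2 * sqrt 2048 * 2 ^ j * (u powr (- r) * M))\<^sup>2"
    proof -
      have "u powr (- 2 * r) = (u powr (- r))\<^sup>2"
        by (simp add: power2_eq_square flip: powr_add)
      thus ?thesis by (simp add: power_mult_distrib)
    qed
    finally have "Q_norm (B j) \<le> sqrt ((2 * sqrt 2048 * 2 ^ j * (u powr (- r) * M))\<^sup>2)"
      unfolding Q_norm_def by (rule real_sqrt_le_mono)
    also have "\<dots> = 2 * sqrt 2048 * 2 ^ j * (u powr (- r) * M)"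
      using M0 by simp
    also have "u powr (- r) = (2 powr (- r)) ^ j * real s powr (- r)"
    proof -
      have "u powr (- r) = (2 ^ j) powr (- r) * real s powr (- r)"
        by (simp add: u_def powr_mult)
      also have "(2 ^ j) powr (- r) = (2 powr (- r)) ^ j"
        by (simp add: powr_powr mult.commute flip: powr_realpow)
      finally show ?thesis .
    qed
    also have "2 * sqrt 2048 * 2 ^ j * ((2 powr (- r)) ^ j * real s powr (- r) * M)
       = 2 * sqrt 2048 * (2 * 2 powr (- r)) ^ j * (real s powr (- r) * M)"
      by (simp add: power_mult_distrib)
    also have "2 * 2 powr (- r) = \<theta>" unfolding \<theta>_def powr_diff by (simp add: powr_minus divide_inverse)
    finally show ?thesis .
  qed
  have tele: "(\<Sum>j<J. B j y) = harmonic_sum Y ?F (2 ^ J * s) y - harmonic_sum Y ?F s y" for J y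
  proof (induction J)
    case (Suc J)
    have lay: "layer Y (\<lambda>l k. if 2 ^ J * s < l then ?F l k else 0) l y = (if 2 ^ J * s < l then layer Y ?F l y else 0)" for l
      by (simp add: layer_def)
    have "B J y = (\<Sum>l\<le>2 ^ Suc J * s. if 2 ^ J * s < l then layer Y ?F l y else 0)"
      unfolding B_def harmonic_sum_layer lay ..
    also have "\<dots> = (\<Sum>l\<in>{..2 ^ Suc J * s} - {..2 ^ J * s}. layer Y ?F l y)"
      by (intro sum.mono_neutral_cong_right) auto
    also have "\<dots> = harmonic_sum Y ?F (2 ^ Suc J * s) y - harmonic_sum Y ?F (2 ^ J * s) y"
      unfolding harmonic_sum_layer by (rule sum_diff) auto
    finally show ?case using Suc by simp
  qed simp
  have part: "Q_norm (\<lambda>y. \<Sum>j<J. B j y) \<le> 2 * sqrt 2048 / (1 - \<theta>) * real s powr (- r) * M" for J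
  proof -
    have "Q_norm (\<lambda>y. \<Sum>j<J. B j y) \<le> (\<Sum>j<J. Q_norm (B j))" by (rule Q_norm_sum)
    also have "\<dots> \<le> (\<Sum>j<J. 2 * sqrt 2048 * \<theta> ^ j * (real s powr (- r) * M))" by (rule sum_mono) (rule Bj)
    also have "\<dots> = 2 * sqrt 2048 * (\<Sum>j<J. \<theta> ^ j) * (real s powr (- r) * M)"
      by (simp only: sum_distrib_left sum_distrib_right)
    also have "\<dots> \<le> 2 * sqrt 2048 * (1 / (1 - \<theta>)) * (real s powr (- r) * M)"
    proof (intro mult_left_mono mult_right_mono)
      show "(\<Sum>j<J. \<theta> ^ j) \<le> 1 / (1 - \<theta>)"
        using sum_le_suminf[of "\<lambda>j. \<theta> ^ j" "{..<J}"] \<theta> suminf_geometric[of \<theta>] summable_geometric[of \<theta>] by simp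
    qed (use M0 in auto)
    finally show ?thesis by (simp add: mult_ac)
  qed
  \<comment> \<open>Convergence at the nodes suffices: \<open>Q_norm\<close> is a continuous
    function of finitely many values, so the bound on the partial sums of blocks passes to the
    limit.\<close>
  have lim: "(\<lambda>J. \<Sum>j<J. B j (x i)) \<longlonglongrightarrow> f (x i) - harmonic_sum Y ?F s (x i)" if "i \<in> {1..N}" for i
  proof -
    have a': "admissible r ?F" using f by (simp add: sobolev_iff)
    have "(\<lambda>l. layer Y ?F l (x i)) sums f (x i)"
      using summable_sums[OF summable_layer(2)[OF r a' nodes[OF that]]]
        sobolev_eq_harmonic_series[OF r f nodes[OF that]] by (simp add: harmonic_series_def)
    hence "(\<lambda>n. harmonic_sum Y ?F n (x i)) \<longlonglongrightarrow> f (x i)"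
      by (simp add: sums_def_le harmonic_sum_layer)
    moreover have "filterlim (\<lambda>J. 2 ^ J * s) at_top sequentially"
    proof (rule filterlim_at_top_mono[OF filterlim_ident])
      have "J \<le> 2 ^ J * s" for J
      proof -
        have "J \<le> 2 ^ J * 1" using less_imp_le[OF less_exp[of J]] by simp
        also have "\<dots> \<le> 2 ^ J * s" by (rule mult_le_mono2[OF s(1)])
        finally show ?thesis .
      qed
      thus "\<forall>\<^sub>F J in sequentially. J \<le> 2 ^ J * s" by simp
    qed
    ultimately have "(\<lambda>J. harmonic_sum Y ?F (2 ^ J * s) (x i)) \<longlonglongrightarrow> f (x i)"
      by (rule filterlim_compose)
    thus ?thesis unfolding tele by (intro tendsto_diff tendsto_const)
  qed
  have "(\<lambda>J. Q_norm (\<lambda>y. \<Sum>j<J. B j y)) \<longlonglongrightarrow> Q_norm (\<lambda>y. f y - harmonic_sum Y ?F s y)"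
    unfolding Q_norm_def quadrature_def by (intro tendsto_intros lim)
  hence "Q_norm (\<lambda>y. f y - harmonic_sum Y ?F s y) \<le> 2 * sqrt 2048 / (1 - \<theta>) * real s powr (- r) * M"
    by (rule LIMSEQ_le_const2) (use part in auto)
  thus ?thesis by (simp only: \<theta>_def M_def)
qed

text \<open>The partial sum of degree \<open>t - n\<close> times \<open>Y l k\<close> with
  \<open>l \<le> n\<close> has degree at most \<open>t\<close>, so quadrature recovers its
  coefficients without error. What remains are the discrete coefficients of the tail
  \<open>g\<close>, to which \<open>Bessel_Q\<close> and \<open>Q_norm_tail_le\<close>
  apply.\<close>

lemma aliasing_error:
  assumes r: "r > 1" and f: "f \<in> sobolev Y r" and n: "1 \<le> n" "2 * n \<le> t"
  shows "sqrt (\<Sum>l\<le>n. energy (\<lambda>l k. fourier Y f l k - Q (\<lambda>y. f y * Y l k y)) l)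
    \<le> 2 * sqrt 2048 / (1 - 2 powr (1 - r)) * (real t - real n) powr (- r) * sobolev_norm Y r f"
proof -
  define s where "s = t - n"
  define g where "g = (\<lambda>y. f y - harmonic_sum Y (fourier Y f) s y)"
  have s: "1 \<le> s" "s \<le> t" "t \<le> 2 * s" "n \<le> s" "real t - real n = real s" using n by (auto simp: s_def)
  have "energy (\<lambda>l k. fourier Y f l k - Q (\<lambda>y. f y * Y l k y)) l = energy (\<lambda>l k. Q (\<lambda>y. g y * Y l k y)) l"
    if l: "l \<le> n" for l
    unfolding energy_def
  proof (intro sum.cong refl)
    fix k assume k: "k \<in> {1..2*l+1}"
    have "Q (\<lambda>y. f y * Y l k y) = Q (\<lambda>y. g y * Y l k y + harmonic_sum Y (fourier Y f) s y * Y l k y)"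
      by (intro Q_cong) (simp add: g_def algebra_simps)
    also have "\<dots> = Q (\<lambda>y. g y * Y l k y) + fourier Y f l k"
      unfolding Q_add using l s n by (subst Q_harmonic_sum_mult_Y[OF k]) (auto simp: s_def)
    finally show "(fourier Y f l k - Q (\<lambda>y. f y * Y l k y))\<^sup>2 = (Q (\<lambda>y. g y * Y l k y))\<^sup>2" by simp
  qed
  hence "(\<Sum>l\<le>n. energy (\<lambda>l k. fourier Y f l k - Q (\<lambda>y. f y * Y l k y)) l)
    = (\<Sum>l\<le>n. energy (\<lambda>l k. Q (\<lambda>y. g y * Y l k y)) l)" by simp
  also have "\<dots> \<le> Q (\<lambda>y. (g y)\<^sup>2)" by (rule Bessel_Q[OF n(2)])
  finally have "sqrt (\<Sum>l\<le>n. energy (\<lambda>l k. fourier Y f l k - Q (\<lambda>y. f y * Y l k y)) l) \<le> Q_norm g"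
    unfolding Q_norm_def by (rule real_sqrt_le_mono)
  also have "\<dots> \<le> 2 * sqrt 2048 / (1 - 2 powr (1 - r)) * real s powr (- r) * sobolev_norm Y r f"
    unfolding g_def by (rule Q_norm_tail_le[OF r f s(1-3)])
  finally show ?thesis by (simp only: s(5))
qed

end

section \<open>Discrete solutions\<close>

context positive_quadrature
begin

text \<open>Testing with each \<open>Y l k\<close> decouples the system: by exactness the left side
  is \<open>(1 - multiplier \<Phi> l) * c l k\<close>. Being an equivalence, this covers existence
  and uniqueness together.\<close>

lemma galerkin_iff:
  assumes n: "2 * n \<le> t" and \<Phi>: "set_integrable lborel {-1<..<1} \<Phi>"
    and ne: "\<And>l. multiplier \<Phi> l \<noteq> 1"
  shows "discrete_solution Galerkin Y r \<Phi> Q n f U \<longleftrightarrow>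
    (\<forall>z\<in>S2. U z = harmonic_sum Y (\<lambda>l k. Q (\<lambda>y. f y * Y l k y) / (1 - multiplier \<Phi> l)) n z)"
proof -
  let ?D = "\<lambda>l k. Q (\<lambda>y. f y * Y l k y)"
  have res: "U z - zonal \<Phi> U z = harmonic_sum Y (\<lambda>l k. (1 - multiplier \<Phi> l) * c l k) n z"
    if c: "\<forall>z\<in>S2. U z = harmonic_sum Y c n z" and z: "z \<in> S2" for c z
  proof -
    have "zonal \<Phi> U z = zonal \<Phi> (harmonic_sum Y c n) z"
      by (rule zonal_cong) (use c in simp)
    also have "\<dots> = harmonic_sum Y (\<lambda>l k. multiplier \<Phi> l * c l k) n z"
      by (rule zonal_harmonic_sum[OF \<Phi> z])
    finally show ?thesis using c z
      by (simp add: harmonic_sum_def sum_subtractf left_diff_distrib)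
  qed
  show ?thesis
  proof
    assume G: "discrete_solution Galerkin Y r \<Phi> Q n f U"
    then obtain c where c: "\<forall>z\<in>S2. U z = harmonic_sum Y c n z" by (auto simp: mem_Pn_iff)
    have "c l k = ?D l k / (1 - multiplier \<Phi> l)" if l: "l \<le> n" and k: "k \<in> {1..2*l+1}" for l k
    proof -
      have "Q (\<lambda>y. (U y - zonal \<Phi> U y) * Y l k y) = ?D l k"
        using G Pn_mono[OF Y_in_Pn[OF k] l] by simp
      moreover have "Q (\<lambda>y. (U y - zonal \<Phi> U y) * Y l k y)
          = Q (\<lambda>y. harmonic_sum Y (\<lambda>l k. (1 - multiplier \<Phi> l) * c l k) n y * Y l k y)"
        by (rule Q_cong) (simp add: res[OF c])
      moreover have "\<dots> = (1 - multiplier \<Phi> l) * c l k"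
        using l n by (subst Q_harmonic_sum_mult_Y[OF k]) auto
      ultimately show ?thesis using ne[of l] by (simp add: field_simps)
    qed
    thus "\<forall>z\<in>S2. U z = harmonic_sum Y (\<lambda>l k. ?D l k / (1 - multiplier \<Phi> l)) n z"
      using c by (simp add: harmonic_sum_def)
  next
    assume U: "\<forall>z\<in>S2. U z = harmonic_sum Y (\<lambda>l k. ?D l k / (1 - multiplier \<Phi> l)) n z"
    have R: "U z - zonal \<Phi> U z = harmonic_sum Y ?D n z" if "z \<in> S2" for z
    proof -
      have "1 - multiplier \<Phi> l \<noteq> 0" for l using ne[of l] by simp
      thus ?thesis using res[OF U that] by simp
    qed
    show "discrete_solution Galerkin Y r \<Phi> Q n f U"
      unfolding discrete_solution.simps
    proof (intro conjI ballI)
      show "U \<in> Pn Y n" unfolding mem_Pn_iff using U by blast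
      fix p assume "p \<in> Pn Y n"
      then obtain c where c: "\<And>z. z \<in> S2 \<Longrightarrow> p z = harmonic_sum Y c n z" by (auto simp: mem_Pn_iff)
      have "Q (\<lambda>y. (U y - zonal \<Phi> U y) * p y) = Q (\<lambda>y. harmonic_sum Y ?D n y * harmonic_sum Y c n y)"
        by (rule Q_cong) (simp add: R c)
      also have "\<dots> = (\<Sum>l\<le>n. \<Sum>k=1..2*l+1. c l k * Q (\<lambda>y. harmonic_sum Y ?D n y * Y l k y))"
        by (rule Q_mult_harmonic_sum)
      also have "\<dots> = (\<Sum>l\<le>n. \<Sum>k=1..2*l+1. c l k * ?D l k)"
      proof (intro sum.cong refl)
        fix l k assume "l \<in> {..n}" and k: "k \<in> {1..2*l+1}"
        thus "c l k * Q (\<lambda>y. harmonic_sum Y ?D n y * Y l k y) = c l k * ?D l k"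
          using n by (subst Q_harmonic_sum_mult_Y[OF k]) auto
      qed
      also have "\<dots> = Q (\<lambda>y. f y * harmonic_sum Y c n y)" by (rule Q_mult_harmonic_sum[symmetric])
      also have "\<dots> = Q (\<lambda>y. f y * p y)" by (rule Q_cong) (simp add: c)
      finally show "Q (\<lambda>y. (U y - zonal \<Phi> U y) * p y) = Q (\<lambda>y. f y * p y)" .
    qed
  qed
qed

text \<open>Since T L_n U lies in P_n, where L_n is the identity, applying L_n to the Nystrom
  equation gives (I - T) L_n U = L_n f. Hence L_n U is the Galerkin solution, and inserting it into
  the equation determines U.\<close>

lemma nystrom_iff:
  assumes n: "2 * n \<le> t" and \<Phi>: "set_integrable lborel {-1<..<1} \<Phi>"
    and ne: "\<And>l. multiplier \<Phi> l \<noteq> 1" and K: "\<And>l. \<bar>multiplier \<Phi> l\<bar> \<le> K"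
    and r: "r > 1" and f: "f \<in> sobolev Y r"
  defines "G \<equiv> harmonic_sum Y (\<lambda>l k. Q (\<lambda>y. f y * Y l k y) / (1 - multiplier \<Phi> l)) n"
  shows "discrete_solution Nystrom Y r \<Phi> Q n f U \<longleftrightarrow> (\<forall>z\<in>S2. U z = f z + zonal \<Phi> G z)"
proof -
  let ?D = "\<lambda>l k. Q (\<lambda>y. f y * Y l k y)"
  have G: "G \<in> sobolev Y r" unfolding G_def by (rule harmonic_sum_in_sobolev[OF r])
  have hyp: "hyperinterpolation Y Q n U = harmonic_sum Y (\<lambda>l k. Q (\<lambda>y. U y * Y l k y)) n" for U
    by (simp add: fun_eq_iff hyperinterpolation_def harmonic_sum_def)
  note zs = zonal_harmonic_sum[OF \<Phi>]
  have Qstep: "Q (\<lambda>y. U y * Y l k y) = ?D l k + multiplier \<Phi> l * c l k"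
    if U: "\<And>z. z \<in> S2 \<Longrightarrow> U z = f z + zonal \<Phi> (harmonic_sum Y c n) z" and l: "l \<le> n" and k: "k \<in> {1..2*l+1}" for U c l k
  proof -
    have "Q (\<lambda>y. U y * Y l k y) = Q (\<lambda>y. f y * Y l k y + harmonic_sum Y (\<lambda>l k. multiplier \<Phi> l * c l k) n y * Y l k y)"
      by (rule Q_cong) (simp add: U zs distrib_right)
    also have "\<dots> = ?D l k + multiplier \<Phi> l * c l k"
      unfolding Q_add using l n by (subst Q_harmonic_sum_mult_Y[OF k]) auto
    finally show ?thesis .
  qed
  show ?thesis
  proof
    assume U: "discrete_solution Nystrom Y r \<Phi> Q n f U"
    let ?c = "\<lambda>l k. Q (\<lambda>y. U y * Y l k y)"
    have U': "U z = f z + zonal \<Phi> (harmonic_sum Y ?c n) z" if "z \<in> S2" for z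
      using U that by (simp add: hyp algebra_simps)
    have "?c l k = ?D l k / (1 - multiplier \<Phi> l)" if "l \<le> n" "k \<in> {1..2*l+1}" for l k
      using Qstep[OF U' that] ne[of l] by (simp add: field_simps)
    hence "harmonic_sum Y ?c n = G" by (simp add: fun_eq_iff G_def harmonic_sum_def)
    thus "\<forall>z\<in>S2. U z = f z + zonal \<Phi> G z" using U' by simp
  next
    assume U: "\<forall>z\<in>S2. U z = f z + zonal \<Phi> G z"
    have "(\<lambda>z. f z + zonal \<Phi> G z) \<in> sobolev Y r"
      by (rule sobolev_add[OF f zonal_sobolev(1)[OF r G \<Phi> K]])
    hence Us: "U \<in> sobolev Y r" by (rule sobolev_cong[rotated]) (use U in simp)
    let ?c = "\<lambda>l k. Q (\<lambda>y. U y * Y l k y)"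
    have "?c l k = ?D l k / (1 - multiplier \<Phi> l)" if "l \<le> n" "k \<in> {1..2*l+1}" for l k
      using Qstep[OF bspec[OF U, unfolded G_def] that] ne[of l] by (simp add: field_simps)
    hence "harmonic_sum Y ?c n = G" by (simp add: fun_eq_iff G_def harmonic_sum_def)
    thus "discrete_solution Nystrom Y r \<Phi> Q n f U" using U Us by (simp add: hyp)
  qed
qed

end

section \<open>The exact equation and the Sloan iteration on coefficients\<close>

context harmonic_basis
begin

lemma exact_solution_exists:
  assumes r: "r > 1" and \<Phi>: "set_integrable lborel {-1<..<1} \<Phi>" and K: "\<And>l. \<bar>multiplier \<Phi> l\<bar> \<le> K"
    and \<delta>: "\<delta> > 0" "\<And>l. \<delta> \<le> \<bar>1 - multiplier \<Phi> l\<bar>" and f: "f \<in> sobolev Y r"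
  shows "\<exists>u. exact_solution Y r \<Phi> f u"
proof -
  define c where "c = (\<lambda>l k. fourier Y f l k / (1 - multiplier \<Phi> l))"
  let ?u = "harmonic_series Y c"
  have ne: "1 - multiplier \<Phi> l \<noteq> 0" for l using \<delta>(1) \<delta>(2)[of l] by auto
  have a: "admissible r c"
  proof (rule admissible_bounded[where K = "1 / \<delta>"])
    show "admissible r (fourier Y f)" using f by (simp add: sobolev_iff)
    fix l k :: nat
    have "\<bar>c l k\<bar> = \<bar>fourier Y f l k\<bar> / \<bar>1 - multiplier \<Phi> l\<bar>" by (simp add: c_def abs_divide)
    also have "\<dots> \<le> \<bar>fourier Y f l k\<bar> / \<delta>"
      using \<delta>(1) \<delta>(2)[of l] by (intro divide_left_mono mult_pos_pos) auto
    finally show "\<bar>c l k\<bar> \<le> 1 / \<delta> * \<bar>fourier Y f l k\<bar>" by simp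
  qed
  have u: "?u \<in> sobolev Y r" by (rule harmonic_series_in_sobolev[OF r a])
  note z = zonal_sobolev[OF r u \<Phi> K]
  have cu: "continuous_on S2 ?u" "continuous_on S2 (zonal \<Phi> ?u)" "continuous_on S2 f"
    using u z(1) f by (auto simp: sobolev_iff)
  have "?u x - zonal \<Phi> ?u x = f x" if x: "x \<in> S2" for x
  proof (rule continuous_eqI[OF _ cu(3) x])
    show "continuous_on S2 (\<lambda>x. ?u x - zonal \<Phi> ?u x)" by (intro continuous_intros cu)
    fix l k :: nat assume k: "k \<in> {1..2*l+1}"
    have "fourier Y (\<lambda>x. ?u x - zonal \<Phi> ?u x) l k = c l k - multiplier \<Phi> l * c l k"
      using fourier_diff[OF cu(1,2) k] z(2)[OF k] fourier_harmonic_series[OF r a k] by simp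
    also have "\<dots> = (1 - multiplier \<Phi> l) * c l k" by (simp add: algebra_simps)
    also have "\<dots> = fourier Y f l k" using ne[of l] by (simp add: c_def)
    finally show "fourier Y (\<lambda>x. ?u x - zonal \<Phi> ?u x) l k = fourier Y f l k" .
  qed
  thus ?thesis unfolding exact_solution_def using u by blast
qed

lemma fourier_exact_solution:
  assumes r: "r > 1" and \<Phi>: "set_integrable lborel {-1<..<1} \<Phi>" and K: "\<And>l. \<bar>multiplier \<Phi> l\<bar> \<le> K"
    and u: "exact_solution Y r \<Phi> f u" and k: "k \<in> {1..2*l+1}"
  shows "(1 - multiplier \<Phi> l) * fourier Y u l k = fourier Y f l k"
proof -
  have us: "u \<in> sobolev Y r" and eq: "\<And>x. x \<in> S2 \<Longrightarrow> u x - zonal \<Phi> u x = f x"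
    using u by (auto simp: exact_solution_def)
  note z = zonal_sobolev[OF r us \<Phi> K]
  have cu: "continuous_on S2 u" "continuous_on S2 (zonal \<Phi> u)" using us z(1) by (auto simp: sobolev_iff)
  have "fourier Y f l k = fourier Y (\<lambda>x. u x - zonal \<Phi> u x) l k" by (rule fourier_cong) (simp add: eq)
  also have "\<dots> = fourier Y u l k - multiplier \<Phi> l * fourier Y u l k"
    using fourier_diff[OF cu k] z(2)[OF k] by simp
  finally show ?thesis by (simp add: algebra_simps)
qed

text \<open>The exact solution is a fixed point of the Sloan step, so each step multiplies the error
  in degree \<open>l\<close> by the multiplier.\<close>

lemma sloan_error_fourier:
  assumes r: "r > 1" and \<Phi>: "set_integrable lborel {-1<..<1} \<Phi>" and K: "\<And>l. \<bar>multiplier \<Phi> l\<bar> \<le> K"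
    and f: "f \<in> sobolev Y r" and u: "exact_solution Y r \<Phi> f u" and U: "U \<in> sobolev Y r"
  shows "sloan \<Phi> f q U \<in> sobolev Y r \<and> (\<forall>l. \<forall>k\<in>{1..2*l+1}.
     fourier Y u l k - fourier Y (sloan \<Phi> f q U) l k = multiplier \<Phi> l ^ q * (fourier Y u l k - fourier Y U l k))"
proof (induction q)
  case 0
  show ?case using U by simp
next
  case (Suc q)
  let ?S = "sloan \<Phi> f q U"
  have S: "?S \<in> sobolev Y r" using Suc by blast
  note z = zonal_sobolev[OF r S \<Phi> K]
  have c: "continuous_on S2 f" "continuous_on S2 (zonal \<Phi> ?S)" using f z(1) by (auto simp: sobolev_iff)
  have "fourier Y u l k - fourier Y (sloan \<Phi> f (Suc q) U) l k = multiplier \<Phi> l ^ Suc q * (fourier Y u l k - fourier Y U l k)"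
    if k: "k \<in> {1..2*l+1}" for l k
  proof -
    have "fourier Y u l k = fourier Y f l k + multiplier \<Phi> l * fourier Y u l k"
      using fourier_exact_solution[OF r \<Phi> K u k] by (simp add: algebra_simps)
    moreover have "fourier Y (sloan \<Phi> f (Suc q) U) l k = fourier Y f l k + multiplier \<Phi> l * fourier Y ?S l k"
      using fourier_add[OF c k] z(2)[OF k] by simp
    ultimately have "fourier Y u l k - fourier Y (sloan \<Phi> f (Suc q) U) l k
       = multiplier \<Phi> l * (fourier Y u l k - fourier Y ?S l k)"
      by (simp only: right_diff_distrib)
    thus ?thesis using Suc k by simp
  qed
  moreover have "sloan \<Phi> f (Suc q) U \<in> sobolev Y r" using sobolev_add[OF f z(1)] by simp
  ultimately show ?case by blast
qed

end

section \<open>Error estimates\<close>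

lemma powr_diff_Suc_ge:
  fixes b :: real
  assumes x: "0 < x" and b: "0 \<le> b" "b \<le> 1"
  shows "b * (x + 1) powr (b - 1) \<le> (x + 1) powr b - x powr b"
proof -
  have "\<exists>z. x < z \<and> z < x + 1 \<and> (x + 1) powr b - x powr b = (x + 1 - x) * (b * z powr (b - 1))"
    by (rule MVT2) (use x in \<open>auto intro!: derivative_eq_intros\<close>)
  then obtain z where z: "x < z" "z < x + 1" "(x + 1) powr b - x powr b = b * z powr (b - 1)" by auto
  have "(x + 1) powr (b - 1) \<le> z powr (b - 1)" using z x b by (intro powr_mono2') auto
  thus ?thesis unfolding z(3) using b by (intro mult_left_mono) auto
qed

lemma powr_diff_Suc_ge':
  fixes b :: real
  assumes x: "0 < x" and b: "b < 0"
  shows "- b * (x + 1) powr (b - 1) \<le> x powr b - (x + 1) powr b"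
proof -
  have "\<exists>z. x < z \<and> z < x + 1 \<and> (x + 1) powr b - x powr b = (x + 1 - x) * (b * z powr (b - 1))"
    by (rule MVT2) (use x in \<open>auto intro!: derivative_eq_intros\<close>)
  then obtain z where z: "x < z" "z < x + 1" "(x + 1) powr b - x powr b = b * z powr (b - 1)" by auto
  have "(x + 1) powr (b - 1) \<le> z powr (b - 1)" using z x b by (intro powr_mono2') auto
  hence "- b * (x + 1) powr (b - 1) \<le> - b * z powr (b - 1)" using b by (intro mult_left_mono) auto
  thus ?thesis using z(3) by simp
qed

text \<open>For \<open>0 \<le> a\<close> the largest term times their number is good enough. For
  negative \<open>a\<close> the mean value theorem, in \<open>powr_diff_Suc_ge\<close>, bounds each
  term by a difference, and the differences telescope.\<close>

lemma sum_powr_le: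
  fixes a :: real
  assumes a: "-1 < a"
  shows "\<exists>C>0. \<forall>n\<ge>1. (\<Sum>l\<le>n. (real l + 1) powr a) \<le> C * real n powr (a + 1)"
proof -
  have "\<exists>K>0. \<forall>n. (\<Sum>l\<le>n. (real l + 1) powr a) \<le> K * (real n + 1) powr (a + 1)"
  proof (cases "0 \<le> a")
    case True
    have "(\<Sum>l\<le>n. (real l + 1) powr a) \<le> 1 * (real n + 1) powr (a + 1)" for n
    proof -
      have "(\<Sum>l\<le>n. (real l + 1) powr a) \<le> (\<Sum>l\<le>n. (real n + 1) powr a)"
        using True by (intro sum_mono powr_mono2) auto
      also have "\<dots> = (real n + 1) powr 1 * (real n + 1) powr a" by (simp add: algebra_simps)
      also have "\<dots> = (real n + 1) powr (a + 1)" by (simp only: powr_add[symmetric] add.commute)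
      finally show ?thesis by simp
    qed
    thus ?thesis by (intro exI[of _ 1]) simp
  next
    case False
    have b: "0 < a + 1" "a + 1 \<le> 1" using a False by auto
    have "(\<Sum>l\<le>n. (real l + 1) powr a) \<le> 1 / (a + 1) * (real n + 1) powr (a + 1)" for n
    proof (induction n)
      case 0
      show ?case using b by simp
    next
      case (Suc n)
      have "(a + 1) * (real n + 1 + 1) powr a \<le> (real n + 1 + 1) powr (a + 1) - (real n + 1) powr (a + 1)"
        using powr_diff_Suc_ge[of "real n + 1" "a + 1"] b by simp
      hence "(real n + 1 + 1) powr a \<le> 1 / (a + 1) * ((real n + 1 + 1) powr (a + 1) - (real n + 1) powr (a + 1))"
        using b by (simp add: pos_le_divide_eq mult.commute)
      thus ?case using Suc by (simp add: right_diff_distrib add_ac)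
    qed
    thus ?thesis using b by (intro exI[of _ "1 / (a + 1)"]) auto
  qed
  then obtain K where K: "K > 0" "\<And>n. (\<Sum>l\<le>n. (real l + 1) powr a) \<le> K * (real n + 1) powr (a + 1)" by blast
  have "(\<Sum>l\<le>n. (real l + 1) powr a) \<le> K * 2 powr (a + 1) * real n powr (a + 1)" if n: "n \<ge> 1" for n
  proof -
    have "(real n + 1) powr (a + 1) \<le> (2 * real n) powr (a + 1)"
      using n a by (intro powr_mono2) auto
    also have "\<dots> = 2 powr (a + 1) * real n powr (a + 1)" by (rule powr_mult)
    finally have "K * (real n + 1) powr (a + 1) \<le> K * (2 powr (a + 1) * real n powr (a + 1))"
      using K(1) by (intro mult_left_mono) auto
    thus ?thesis using K(2)[of n] by (simp add: mult.assoc)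
  qed
  thus ?thesis using K(1) by (intro exI[of _ "K * 2 powr (a + 1)"]) auto
qed

lemma sum_inverse_le_ln:
  assumes n: "n \<ge> 1"
  shows "(\<Sum>l\<le>n. 1 / (real l + 1)) \<le> (1 / ln 2 + 1) * ln (real n + 1)"
proof -
  have le: "(\<Sum>l\<le>n. 1 / (real l + 1)) \<le> 1 + ln (real n + 1)" for n
  proof (induction n)
    case (Suc n)
    have "ln ((real n + 1) / (real n + 2)) \<le> (real n + 1) / (real n + 2) - 1"
      by (intro ln_le_minus_one) auto
    moreover have "(real n + 1) / (real n + 2) - 1 = - (1 / (real n + 2))" by (simp add: field_simps)
    moreover have "ln ((real n + 1) / (real n + 2)) = ln (real n + 1) - ln (real n + 2)"
      by (rule ln_divide_pos) auto
    ultimately show ?case using Suc by (simp add: add_ac)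
  qed simp
  \<comment> \<open>For \<open>n \<ge> 1\<close> the logarithm is at least \<open>ln 2\<close>, so
    it absorbs the constant 1.\<close>
  have "1 \<le> 1 / ln 2 * ln (real n + 1)"
    using n by (simp add: pos_le_divide_eq)
  thus ?thesis using le[of n] by (simp only: distrib_right mult_1)
qed

text \<open>The exponent combines the squared damping (l + 1)^(-2 \<gamma>) with the dimension 2 l +
  1 of a degree. The cases of \<open>rho\<close> are the growth types of this sum: power, logarithm,
  convergence.\<close>

lemma sum_low_degrees_le:
  assumes \<gamma>: "0 \<le> \<gamma>"
  shows "\<exists>C>0. \<forall>n\<ge>1. (\<Sum>l\<le>n. (real l + 1) powr (1 - 2 * \<gamma>)) \<le> C * (rho \<gamma> n)\<^sup>2"
proof -
  consider "\<gamma> < 1" | "\<gamma> = 1" | "1 < \<gamma>" by linarith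
  thus ?thesis
  proof cases
    case 1
    have "(rho \<gamma> n)\<^sup>2 = real n powr (1 - 2 * \<gamma> + 1)" for n
      using 1 by (simp add: rho_def power2_eq_square flip: powr_add)
    thus ?thesis using sum_powr_le[of "1 - 2 * \<gamma>"] 1 by simp
  next
    case 2
    have "(\<Sum>l\<le>n. (real l + 1) powr (1 - 2 * \<gamma>)) \<le> (1 / ln 2 + 1) * (rho \<gamma> n)\<^sup>2" if n: "n \<ge> 1" for n
    proof -
      have "(\<Sum>l\<le>n. (real l + 1) powr (1 - 2 * \<gamma>)) = (\<Sum>l\<le>n. 1 / (real l + 1))"
        using 2 by (intro sum.cong) (auto simp: powr_minus divide_inverse)
      thus ?thesis using sum_inverse_le_ln[OF n] 2 by (simp add: rho_def)
    qed
    moreover have "0 < 1 / ln 2 + (1::real)" by (simp add: add_pos_pos)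
    ultimately show ?thesis by blast
  next
    case 3
    have s: "summable (\<lambda>l. (real l + 1) powr (1 - 2 * \<gamma>))"
    proof -
      have "summable (\<lambda>l. real (Suc l) powr (1 - 2 * \<gamma>))"
        using 3 by (subst summable_Suc_iff) (simp add: summable_real_powr_iff)
      thus ?thesis by (simp add: add.commute)
    qed
    let ?C = "(\<Sum>l. (real l + 1) powr (1 - 2 * \<gamma>)) + 1"
    have "0 \<le> (\<Sum>l. (real l + 1) powr (1 - 2 * \<gamma>))" by (rule suminf_nonneg[OF s]) simp
    moreover have "(\<Sum>l\<le>n. (real l + 1) powr (1 - 2 * \<gamma>)) \<le> ?C * (rho \<gamma> n)\<^sup>2" for n
      using sum_le_suminf[OF s, of "{..n}"] 3 by (simp add: rho_def)
    ultimately show ?thesis by (intro exI[of _ ?C]) auto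
  qed
qed

lemma sum_high_degrees_le:
  assumes b: "b < 0" and n: "1 \<le> n"
  shows "(\<Sum>l\<in>{n<..L}. (real l + 1) powr (b - 1)) \<le> real n powr b / (- b)"
proof -
  \<comment> \<open>\<open>max n L\<close> keeps the claim valid while the range of summation is
    empty.\<close>
  have "(\<Sum>l\<in>{n<..L}. (real l + 1) powr (b - 1)) \<le> ((real n + 1) powr b - (real (max n L) + 1) powr b) / (- b)"
  proof (induction L)
    case (Suc L)
    show ?case
    proof (cases "n \<le> L")
      case True
      have "- b * (real (Suc L) + 1) powr (b - 1) \<le> real (Suc L) powr b - (real (Suc L) + 1) powr b"
        by (rule powr_diff_Suc_ge'[OF _ b]) simp
      hence "(real (Suc L) + 1) powr (b - 1) \<le> (real (Suc L) powr b - (real (Suc L) + 1) powr b) / (- b)"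
        using b by (simp only: pos_le_divide_eq neg_0_less_iff_less mult.commute)
      moreover have "{n<..Suc L} = insert (Suc L) {n<..L}" using True by auto
      ultimately have "(\<Sum>l\<in>{n<..Suc L}. (real l + 1) powr (b - 1))
         \<le> (real (Suc L) powr b - (real (Suc L) + 1) powr b) / (- b) + ((real n + 1) powr b - (real (max n L) + 1) powr b) / (- b)"
        using Suc by simp
      also have "\<dots> = ((real n + 1) powr b - (real (max n (Suc L)) + 1) powr b) / (- b)"
        using True b by (simp add: max_def add.commute diff_divide_distrib)
      finally show ?thesis .
    next
      case False
      hence "max n (Suc L) = n" "{n<..Suc L} = {}" by auto
      thus ?thesis by simp
    qed
  qed simp
  also have "\<dots> \<le> real n powr b / (- b)"
  proof (intro divide_right_mono)
    have "(real n + 1) powr b \<le> real n powr b" using b n by (intro powr_mono2') auto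
    thus "(real n + 1) powr b - (real (max n L) + 1) powr b \<le> real n powr b"
      using powr_ge_zero[of "real (max n L) + 1" b] by linarith
  qed (use b in simp)
  finally show ?thesis .
qed

context positive_quadrature
begin

text \<open>
  The degrees up to \<open>n\<close> carry the aliasing error of the discrete Fourier coefficients and the degrees
  beyond \<open>n\<close> the truncation error; both are damped by \<open>\<mu>\<^sub>l\<^sup>m / (1 - \<mu>\<^sub>l) = O((1 + l) powr (-\<gamma>))\<close>.
\<close>

lemma damped_error_le:
  assumes r: "r > 1" and f: "f \<in> sobolev Y r" and n: "1 \<le> n" "2 * n \<le> t" and \<gamma>: "0 \<le> \<gamma>" and A: "0 \<le> A"
    and d: "\<And>l k. k \<in> {1..2*l+1} \<Longrightarrow> \<bar>d l k\<bar> \<le> A * (real l + 1) powr (- \<gamma>) *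
      \<bar>fourier Y f l k - (if l \<le> n then Q (\<lambda>y. f y * Y l k y) else 0)\<bar>"
    and C1: "(\<Sum>l\<le>n. (real l + 1) powr (1 - 2 * \<gamma>)) \<le> C1 * (rho \<gamma> n)\<^sup>2" "0 \<le> C1" "0 \<le> rho \<gamma> n"
    and z: "z \<in> S2" and ad: "admissible r d"
  shows "\<bar>harmonic_series Y d z\<bar> \<le> A * (sqrt C1 * (2 * sqrt 2048 / (1 - 2 powr (1 - r)))
        + sqrt (2 powr r / (2 * \<gamma> + 2 * r - 2))) *
      (real n powr (-(r + \<gamma> - 1)) + rho \<gamma> n * (real t - real n) powr (-r)) * sobolev_norm Y r f"
proof -
  define e where "e = (\<lambda>l k. fourier Y f l k - (if l \<le> n then Q (\<lambda>y. f y * Y l k y) else 0))"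
  define M where "M = sobolev_norm Y r f"
  define C2 where "C2 = 2 * sqrt 2048 / (1 - 2 powr (1 - r))"
  define S where "S = (real t - real n) powr (- r)"
  \<comment> \<open>\<open>g l\<close> is the damping times the sup norm factor of degree
    \<open>l\<close>. In the next definition, \<open>b - 1\<close> is the exponent that remains when
    its square is divided by the Sobolev weight, and \<open>b / 2\<close> is the final rate.\<close>
  define g where "g = (\<lambda>l. (real l + 1) powr (- \<gamma>) * sqrt ((2 * real l + 1) / (4 * pi)))"
  define b where "b = 2 - 2 * \<gamma> - 2 * r"
  have b0: "b < 0" using r \<gamma> by (simp add: b_def)
  have C20: "0 \<le> C2" 
  proof -
    have "2 powr (1 - r) < 1" using r by (simp add: powr_less_one)
    thus ?thesis by (simp add: C2_def)
  qed
  have as: "summable (\<lambda>l. sobolev_weight r l * energy (fourier Y f) l)"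
    using f by (simp add: sobolev_iff admissible_def)
  have M: "M = sqrt (\<Sum>l. sobolev_weight r l * energy (fourier Y f) l)"
    by (simp add: M_def sobolev_norm_def sobolev_term_energy)
  have M0: "0 \<le> M" unfolding M by (intro real_sqrt_ge_zero suminf_nonneg[OF as]) (simp add: sobolev_weight_pos less_imp_le)
  have g0: "0 \<le> g l" for l by (simp add: g_def)
  have g2: "(g l)\<^sup>2 \<le> (real l + 1) powr (1 - 2 * \<gamma>)" for l
  proof -
    have "(g l)\<^sup>2 = (real l + 1) powr (- 2 * \<gamma>) * ((2 * real l + 1) / (4 * pi))"
    proof -
      have "((real l + 1) powr (- \<gamma>))\<^sup>2 = (real l + 1) powr (- 2 * \<gamma>)"
        by (simp add: power2_eq_square flip: powr_add)
      moreover have "(sqrt ((2 * real l + 1) / (4 * pi)))\<^sup>2 = (2 * real l + 1) / (4 * pi)"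
        by (rule real_sqrt_pow2) simp
      ultimately show ?thesis by (simp only: g_def power_mult_distrib)
    qed
    also have "(2 * real l + 1) / (4 * pi) \<le> (2 * real l + 1) / 2"
      using pi_ge_two by (intro divide_left_mono) auto
    also have "(2 * real l + 1) / 2 \<le> (real l + 1) powr 1" by simp
    finally have "(g l)\<^sup>2 \<le> (real l + 1) powr (- 2 * \<gamma>) * (real l + 1) powr 1" by (simp add: mult_left_mono)
    moreover have "- 2 * \<gamma> + 1 = 1 - 2 * \<gamma>" by simp
    ultimately show ?thesis by (simp only: powr_add[symmetric])
  qed
  have term_le: "sqrt (energy d l) * sqrt ((2 * real l + 1) / (4 * pi)) \<le> A * (g l * sqrt (energy e l))" for l
  proof -
    have "energy d l \<le> (A * (real l + 1) powr (- \<gamma>))\<^sup>2 * energy e l"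
      by (rule energy_le) (use d in \<open>simp add: e_def\<close>)
    hence "sqrt (energy d l) \<le> sqrt ((A * (real l + 1) powr (- \<gamma>))\<^sup>2 * energy e l)" by (rule real_sqrt_le_mono)
    also have "\<dots> = A * (real l + 1) powr (- \<gamma>) * sqrt (energy e l)" using A by (simp add: real_sqrt_mult)
    finally have "sqrt (energy d l) * sqrt ((2 * real l + 1) / (4 * pi))
        \<le> A * (real l + 1) powr (- \<gamma>) * sqrt (energy e l) * sqrt ((2 * real l + 1) / (4 * pi))"
      by (intro mult_right_mono) auto
    thus ?thesis by (simp only: g_def mult_ac)
  qed
  have CS: "(\<Sum>i\<in>I. u i * v i) \<le> sqrt (\<Sum>i\<in>I. (u i)\<^sup>2) * sqrt (\<Sum>i\<in>I. (v i)\<^sup>2)" for u v :: "nat \<Rightarrow> real" and I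
  proof -
    have "(\<Sum>i\<in>I. u i * v i) \<le> sqrt ((\<Sum>i\<in>I. u i * v i)\<^sup>2)" by simp
    also have "\<dots> \<le> sqrt ((\<Sum>i\<in>I. (u i)\<^sup>2) * (\<Sum>i\<in>I. (v i)\<^sup>2))"
      by (rule real_sqrt_le_mono[OF Cauchy_Schwarz_ineq_sum])
    finally show ?thesis by (simp add: real_sqrt_mult)
  qed
  \<comment> \<open>Cauchy-Schwarz: one factor is the sum behind \<open>rho\<close>, the other the
    aliasing error.\<close>
  have low: "(\<Sum>l\<le>n. g l * sqrt (energy e l)) \<le> sqrt C1 * rho \<gamma> n * (C2 * S * M)"
  proof -
    have "(\<Sum>l\<le>n. g l * sqrt (energy e l)) \<le> sqrt (\<Sum>l\<le>n. (g l)\<^sup>2) * sqrt (\<Sum>l\<le>n. (sqrt (energy e l))\<^sup>2)"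
      by (rule CS)
    also have "\<dots> \<le> sqrt (C1 * (rho \<gamma> n)\<^sup>2) * (C2 * S * M)"
    proof (intro mult_mono real_sqrt_le_mono)
      show "(\<Sum>l\<le>n. (g l)\<^sup>2) \<le> C1 * (rho \<gamma> n)\<^sup>2"
        using sum_mono[of "{..n}" "\<lambda>l. (g l)\<^sup>2"] g2 C1(1) by (meson order_trans)
      have "(\<Sum>l\<le>n. (sqrt (energy e l))\<^sup>2) = (\<Sum>l\<le>n. energy (\<lambda>l k. fourier Y f l k - Q (\<lambda>y. f y * Y l k y)) l)"
        by (intro sum.cong refl) (simp add: energy_def e_def sum_nonneg)
      thus "sqrt (\<Sum>l\<le>n. (sqrt (energy e l))\<^sup>2) \<le> C2 * S * M"
        using aliasing_error[OF r f n] by (simp only: C2_def S_def M_def)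
    qed (auto simp: C1(2) sum_nonneg)
    also have "sqrt (C1 * (rho \<gamma> n)\<^sup>2) = sqrt C1 * rho \<gamma> n" using C1(3) by (simp add: real_sqrt_mult)
    finally show ?thesis .
  qed
  \<comment> \<open>Beyond \<open>n\<close> there are no discrete coefficients, so \<open>e\<close>
    agrees with the coefficients of \<open>f\<close>; the Sobolev weight is divided out of one
    factor and put into the other.\<close>
  have high: "(\<Sum>l\<in>{n<..L}. g l * sqrt (energy e l)) \<le> sqrt (2 powr r / (- b)) * real n powr (-(r + \<gamma> - 1)) * M" for L
  proof -
    have w: "0 < sobolev_weight r l" for l by (rule sobolev_weight_pos)
    have "(\<Sum>l\<in>{n<..L}. g l * sqrt (energy e l))
       = (\<Sum>l\<in>{n<..L}. (g l / sqrt (sobolev_weight r l)) * sqrt (sobolev_weight r l * energy (fourier Y f) l))"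
    proof (intro sum.cong refl)
      fix l assume "l \<in> {n<..L}"
      hence "energy e l = energy (fourier Y f) l" by (intro energy_cong) (simp add: e_def)
      thus "g l * sqrt (energy e l) = (g l / sqrt (sobolev_weight r l)) * sqrt (sobolev_weight r l * energy (fourier Y f) l)"
        using w[of l] by (simp add: real_sqrt_mult)
    qed
    also have "\<dots> \<le> sqrt (\<Sum>l\<in>{n<..L}. (g l / sqrt (sobolev_weight r l))\<^sup>2)
        * sqrt (\<Sum>l\<in>{n<..L}. (sqrt (sobolev_weight r l * energy (fourier Y f) l))\<^sup>2)"
      by (rule CS)
    also have "\<dots> \<le> sqrt (2 powr r * (real n powr b / (- b))) * M"
      unfolding M
    proof (intro mult_mono real_sqrt_le_mono)
      have "(\<Sum>l\<in>{n<..L}. (g l / sqrt (sobolev_weight r l))\<^sup>2) \<le> (\<Sum>l\<in>{n<..L}. 2 powr r * (real l + 1) powr (b - 1))"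
      proof (rule sum_mono)
        fix l
        have "(g l / sqrt (sobolev_weight r l))\<^sup>2 = (g l)\<^sup>2 * (1 / sobolev_weight r l)"
          using w[of l] by (simp add: power_divide)
        also have "\<dots> \<le> (real l + 1) powr (1 - 2 * \<gamma>) * (2 powr r * (real l + 1) powr (- 2 * r))"
          using r w[of l] by (intro mult_mono g2 inverse_sobolev_weight_le) auto
        also have "\<dots> = 2 powr r * ((real l + 1) powr (1 - 2 * \<gamma>) * (real l + 1) powr (- 2 * r))" by simp
        also have "(real l + 1) powr (1 - 2 * \<gamma>) * (real l + 1) powr (- 2 * r) = (real l + 1) powr (b - 1)"
          by (simp add: b_def algebra_simps flip: powr_add)
        finally show "(g l / sqrt (sobolev_weight r l))\<^sup>2 \<le> 2 powr r * (real l + 1) powr (b - 1)" .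
      qed
      also have "\<dots> \<le> 2 powr r * (real n powr b / (- b))"
        unfolding sum_distrib_left[symmetric] by (intro mult_left_mono sum_high_degrees_le b0 n) simp
      finally show "(\<Sum>l\<in>{n<..L}. (g l / sqrt (sobolev_weight r l))\<^sup>2) \<le> 2 powr r * (real n powr b / (- b))" .
      have "(\<Sum>l\<in>{n<..L}. (sqrt (sobolev_weight r l * energy (fourier Y f) l))\<^sup>2)
          = (\<Sum>l\<in>{n<..L}. sobolev_weight r l * energy (fourier Y f) l)"
        using w by (intro sum.cong refl real_sqrt_pow2) (simp add: less_imp_le)
      also have "\<dots> \<le> (\<Sum>l. sobolev_weight r l * energy (fourier Y f) l)"
        using w by (intro sum_le_suminf as) (auto simp: less_imp_le)
      finally show "(\<Sum>l\<in>{n<..L}. (sqrt (sobolev_weight r l * energy (fourier Y f) l))\<^sup>2)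
          \<le> (\<Sum>l. sobolev_weight r l * energy (fourier Y f) l)" .
      show "0 \<le> sqrt (2 powr r * (real n powr b / (- b)))"
        using b0 by (intro real_sqrt_ge_zero mult_nonneg_nonneg divide_nonneg_pos) auto
      show "0 \<le> sqrt (\<Sum>l\<in>{n<..L}. (sqrt (sobolev_weight r l * energy (fourier Y f) l))\<^sup>2)"
        by (intro real_sqrt_ge_zero sum_nonneg) simp
    qed
    also have "sqrt (2 powr r * (real n powr b / (- b))) = sqrt (2 powr r / (- b)) * sqrt (real n powr b)"
      by (simp add: mult.commute flip: real_sqrt_mult)
    also have "sqrt (real n powr b) = real n powr (-(r + \<gamma> - 1))"
    proof -
      have "real n powr b = (real n powr (-(r + \<gamma> - 1)))\<^sup>2"
        by (simp add: b_def power2_eq_square algebra_simps flip: powr_add)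
      thus ?thesis by simp
    qed
    finally show ?thesis .
  qed
  let ?R = "real n powr (-(r + \<gamma> - 1)) + rho \<gamma> n * S"
  let ?C = "sqrt C1 * C2 + sqrt (2 powr r / (- b))"
  have total: "(\<Sum>l\<le>L. g l * sqrt (energy e l)) \<le> ?C * ?R * M" for L
  proof -
    have "(\<Sum>l\<le>L. g l * sqrt (energy e l)) \<le> (\<Sum>l\<in>{..n} \<union> {n<..L}. g l * sqrt (energy e l))"
      using g0 by (intro sum_mono2) auto
    also have "\<dots> = (\<Sum>l\<le>n. g l * sqrt (energy e l)) + (\<Sum>l\<in>{n<..L}. g l * sqrt (energy e l))"
      by (rule sum.union_disjoint) auto
    also have "\<dots> \<le> sqrt C1 * rho \<gamma> n * (C2 * S * M) + sqrt (2 powr r / (- b)) * real n powr (-(r + \<gamma> - 1)) * M"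
      using low high by (rule add_mono)
    \<comment> \<open>Expanding the product gives the two terms at hand and two nonnegative cross
      terms.\<close>
    also have "\<dots> \<le> ?C * ?R * M"
    proof -
      have "0 \<le> sqrt C1 * C2 * real n powr (-(r + \<gamma> - 1)) * M" "0 \<le> sqrt (2 powr r / (- b)) * (rho \<gamma> n * S) * M"
        using C1(2,3) C20 M0 b0
        by (intro mult_nonneg_nonneg real_sqrt_ge_zero divide_nonneg_pos; simp add: S_def)+
      moreover have "?C * ?R * M = (sqrt C1 * rho \<gamma> n * (C2 * S * M) + sqrt (2 powr r / (- b)) * real n powr (-(r + \<gamma> - 1)) * M)
         + (sqrt C1 * C2 * real n powr (-(r + \<gamma> - 1)) * M + sqrt (2 powr r / (- b)) * (rho \<gamma> n * S) * M)"
        by (simp only: distrib_left distrib_right mult_ac add_ac)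
      ultimately show ?thesis by linarith
    qed
    finally show ?thesis .
  qed
  have "\<bar>harmonic_series Y d z\<bar> \<le> (\<Sum>l. sqrt (energy d l) * sqrt ((2 * real l + 1) / (4 * pi)))"
    by (rule abs_harmonic_series_le[OF r ad z])
  also have "\<dots> \<le> A * (?C * ?R * M)"
  proof (rule suminf_le_const[OF summable_layer_bound[OF r ad]])
    fix L
    have "(\<Sum>l<L. sqrt (energy d l) * sqrt ((2 * real l + 1) / (4 * pi))) \<le> (\<Sum>l<L. A * (g l * sqrt (energy e l)))"
      by (rule sum_mono) (rule term_le)
    also have "\<dots> = A * (\<Sum>l<L. g l * sqrt (energy e l))" by (simp only: sum_distrib_left)
    also have "\<dots> \<le> A * (\<Sum>l\<le>L. g l * sqrt (energy e l))"
      using g0 by (intro mult_left_mono[OF _ A] sum_mono2) auto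
    also have "\<dots> \<le> A * (?C * ?R * M)" by (rule mult_left_mono[OF total A])
    finally show "(\<Sum>l<L. sqrt (energy d l) * sqrt ((2 * real l + 1) / (4 * pi))) \<le> A * (?C * ?R * M)" .
  qed
  also have "- b = 2 * \<gamma> + 2 * r - 2" by (simp add: b_def)
  finally show ?thesis by (simp only: C2_def S_def M_def mult.assoc)
qed

end

section \<open>Assembly of the estimate\<close>

lemma rho_nonneg: "0 \<le> rho \<gamma> n"
  by (auto simp: rho_def)

theorem theorem4p1:
  fixes Y :: harmonics
    and \<Phi> :: "real \<Rightarrow> real"
    and \<beta> CT \<delta> r \<gamma> :: real
    and N t :: "nat \<Rightarrow> nat"
    and w :: "nat \<Rightarrow> nat \<Rightarrow> real"
    and x :: "nat \<Rightarrow> nat \<Rightarrow> real^3"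
    and Q :: "nat \<Rightarrow> (real^3 \<Rightarrow> real) \<Rightarrow> real"
    and q :: nat
    and star :: scheme
  assumes Y: "spherical_harmonic_basis Y"
    and \<Phi>: "set_integrable lborel {-1<..<1} \<Phi>"
    and pos: "\<beta> > 0" "CT > 0" "\<delta> > 0"
    and decay: "\<And>l. \<bar>multiplier \<Phi> l\<bar> \<le> CT * (1 + real l) powr (-\<beta>)"
    and gap: "\<And>l. \<bar>1 - multiplier \<Phi> l\<bar> \<ge> \<delta>"
    and Q_def: "\<And>n. Q n = quadrature (N n) (w n) (x n)"
    and nodes: "\<And>n j. n \<ge> 1 \<Longrightarrow> j \<in> {1..N n} \<Longrightarrow> x n j \<in> S2"
    and weights: "\<And>n j. n \<ge> 1 \<Longrightarrow> j \<in> {1..N n} \<Longrightarrow> w n j > 0"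
    and exact: "\<And>n. n \<ge> 1 \<Longrightarrow> exact_on (Q n) (Pn Y (t n))"
    and t: "\<And>n. n \<ge> 1 \<Longrightarrow> t n \<ge> 2 * n"
    and \<gamma>_def: "\<gamma> = (real q + real (eps star)) * \<beta>"
    and r: "r > 1"
  shows "\<exists>C>0. \<forall>n\<ge>1. \<forall>f\<in>sobolev Y r.
           (\<exists>u. exact_solution Y r \<Phi> f u) \<and>
           (\<exists>U. discrete_solution star Y r \<Phi> (Q n) n f U) \<and>
           (\<forall>u U. exact_solution Y r \<Phi> f u \<longrightarrow> discrete_solution star Y r \<Phi> (Q n) n f U \<longrightarrow>
              Linf_norm (\<lambda>z. u z - sloan \<Phi> f q U z)
                \<le> ereal (C * (real n powr (-(r + \<gamma> - 1)) +
                              rho \<gamma> n * (real (t n) - real n) powr (-r)) * sobolev_norm Y r f))"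
proof -
  interpret harmonic_basis Y by unfold_locales (rule Y)
  \<comment> \<open>The number of factors T in the error: one for each Sloan step, and one that the
    Nystrom solution already contains.\<close>
  define m where "m = q + eps star"
  have \<gamma>: "\<gamma> = real m * \<beta>" "0 \<le> \<gamma>" using pos by (simp_all add: \<gamma>_def m_def)
  define A where "A = CT ^ m / \<delta>"
  have A: "0 < A" using pos by (simp add: A_def)
  obtain C1 where C1: "0 < C1"
    "\<And>n. n \<ge> 1 \<Longrightarrow> (\<Sum>l\<le>n. (real l + 1) powr (1 - 2 * \<gamma>)) \<le> C1 * (rho \<gamma> n)\<^sup>2"
    using sum_low_degrees_le[OF \<gamma>(2)] by blast
  define C where "C = A * (sqrt C1 * (2 * sqrt 2048 / (1 - 2 powr (1 - r)))
        + sqrt (2 powr r / (2 * \<gamma> + 2 * r - 2)))"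
  have C: "0 < C"
  proof -
    have "2 powr (1 - r) < 1" using r by (simp add: powr_less_one)
    thus ?thesis unfolding C_def using A C1(1) r \<gamma>(2) by (intro mult_pos_pos add_pos_pos divide_pos_pos) auto
  qed
  have K: "\<bar>multiplier \<Phi> l\<bar> \<le> CT" for l
  proof -
    have "(1 + real l) powr (- \<beta>) \<le> 1" using pos by (simp add: powr_minus inverse_le_1_iff ge_one_powr_ge_zero)
    hence "CT * (1 + real l) powr (- \<beta>) \<le> CT * 1" using pos by (intro mult_left_mono) auto
    thus ?thesis using decay[of l] by simp
  qed
  have nz: "1 - multiplier \<Phi> l \<noteq> 0" for l using gap[of l] pos by auto
  hence ne: "multiplier \<Phi> l \<noteq> 1" for l by (metis diff_self)
  have damp: "\<bar>multiplier \<Phi> l ^ m / (1 - multiplier \<Phi> l)\<bar> \<le> A * (real l + 1) powr (- \<gamma>)" for l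
  proof -
    have "\<bar>multiplier \<Phi> l ^ m / (1 - multiplier \<Phi> l)\<bar> = \<bar>multiplier \<Phi> l\<bar> ^ m / \<bar>1 - multiplier \<Phi> l\<bar>"
      by (simp add: abs_divide power_abs)
    also have "\<dots> \<le> (CT * (1 + real l) powr (- \<beta>)) ^ m / \<delta>"
      using pos by (intro frac_le power_mono decay gap) auto
    also have "\<dots> = A * (real l + 1) powr (- \<gamma>)"
      using \<gamma> by (simp add: A_def power_mult_distrib powr_power add.commute)
    finally show ?thesis .
  qed
  show ?thesis
  proof (intro exI[of _ C] conjI C allI impI ballI)
    fix n :: nat and f assume n: "1 \<le> n" and f: "f \<in> sobolev Y r"
    interpret positive_quadrature Y "N n" "w n" "x n" "t n"
      by unfold_locales (use nodes[OF n] weights[OF n] exact[OF n] in \<open>auto simp: Q_def\<close>)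
    note t2 = t[OF n]
    let ?Q = "quadrature (N n) (w n) (x n)"
    \<comment> \<open>Coefficients of the Galerkin solution, from which both schemes are
      built.\<close>
    define c where "c = (\<lambda>l k. ?Q (\<lambda>y. f y * Y l k y) / (1 - multiplier \<Phi> l))"
    let ?G = "harmonic_sum Y c n"
    have Gs: "?G \<in> sobolev Y r" by (rule harmonic_sum_in_sobolev[OF r])
    have gal: "discrete_solution Galerkin Y r \<Phi> ?Q n f U \<longleftrightarrow> (\<forall>z\<in>S2. U z = ?G z)" for U
      unfolding c_def by (rule galerkin_iff[OF t2 \<Phi> ne])
    have nys: "discrete_solution Nystrom Y r \<Phi> ?Q n f U \<longleftrightarrow> (\<forall>z\<in>S2. U z = f z + zonal \<Phi> ?G z)" for U
      unfolding c_def by (rule nystrom_iff[OF t2 \<Phi> ne K r f])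
    show "\<exists>u. exact_solution Y r \<Phi> f u"
      by (rule exact_solution_exists[OF r \<Phi> K pos(3) gap f])
    show "\<exists>U. discrete_solution star Y r \<Phi> (Q n) n f U"
    proof (cases star)
      case Galerkin
      have "discrete_solution Galerkin Y r \<Phi> ?Q n f ?G" unfolding gal by blast
      thus ?thesis unfolding Galerkin Q_def by blast
    next
      case Nystrom
      have "discrete_solution Nystrom Y r \<Phi> ?Q n f (\<lambda>z. f z + zonal \<Phi> ?G z)" unfolding nys by blast
      thus ?thesis unfolding Nystrom Q_def by blast
    qed
    fix u U assume u: "exact_solution Y r \<Phi> f u" and U: "discrete_solution star Y r \<Phi> (Q n) n f U"
    \<comment> \<open>Either error is that of the Galerkin solution, with one additional multiplier
      for Nystrom, whose solution is one \<open>sloan\<close> step from \<open>?G\<close>.\<close>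
    have U': "U \<in> sobolev Y r \<and> (\<forall>l. \<forall>k\<in>{1..2*l+1}. fourier Y u l k - fourier Y U l k
      = multiplier \<Phi> l ^ eps star * (fourier Y u l k - fourier Y ?G l k))"
    proof (cases star)
      case Galerkin
      hence "\<forall>z\<in>S2. U z = ?G z" using U gal unfolding Q_def by blast
      hence eq: "\<And>z. z \<in> S2 \<Longrightarrow> U z = ?G z" by blast
      have "fourier Y U = fourier Y ?G" by (intro ext fourier_cong eq)
      moreover have "U \<in> sobolev Y r" by (rule sobolev_cong[OF eq[symmetric] Gs])
      ultimately show ?thesis using Galerkin by simp
    next
      case Nystrom
      hence "\<forall>z\<in>S2. U z = f z + zonal \<Phi> ?G z" using U nys unfolding Q_def by blast
      hence eq: "\<And>z. z \<in> S2 \<Longrightarrow> U z = sloan \<Phi> f 1 ?G z" by simp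
      have "fourier Y U = fourier Y (sloan \<Phi> f 1 ?G)" by (intro ext fourier_cong eq)
      moreover have S1: "sloan \<Phi> f 1 ?G \<in> sobolev Y r" using sloan_error_fourier[OF r \<Phi> K f u Gs, of 1] by blast
      moreover have "U \<in> sobolev Y r" by (rule sobolev_cong[OF eq[symmetric] S1])
      ultimately show ?thesis using sloan_error_fourier[OF r \<Phi> K f u Gs, of 1] Nystrom by simp
    qed
    define S where "S = sloan \<Phi> f q U"
    have S: "S \<in> sobolev Y r" and Se: "\<And>l k. k \<in> {1..2*l+1} \<Longrightarrow> fourier Y u l k - fourier Y S l k
      = multiplier \<Phi> l ^ q * (fourier Y u l k - fourier Y U l k)"
      using sloan_error_fourier[OF r \<Phi> K f u conjunct1[OF U'], of q] unfolding S_def by blast+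
    have us: "u \<in> sobolev Y r" using u by (simp add: exact_solution_def)
    have cu: "continuous_on S2 u" "continuous_on S2 S" using us S by (auto simp: sobolev_iff)
    let ?d = "\<lambda>l k. fourier Y u l k - fourier Y S l k"
    have d: "?d l k = multiplier \<Phi> l ^ m / (1 - multiplier \<Phi> l) *
        (fourier Y f l k - (if l \<le> n then ?Q (\<lambda>y. f y * Y l k y) else 0))" if k: "k \<in> {1..2*l+1}" for l k
    proof -
      have "fourier Y u l k = fourier Y f l k / (1 - multiplier \<Phi> l)"
        using fourier_exact_solution[OF r \<Phi> K u k] nz[of l] by (simp add: field_simps)
      moreover have "fourier Y ?G l k = (if l \<le> n then ?Q (\<lambda>y. f y * Y l k y) else 0) / (1 - multiplier \<Phi> l)"
        using fourier_harmonic_sum[OF k] by (simp add: c_def)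
      ultimately have e: "fourier Y u l k - fourier Y ?G l k
          = (fourier Y f l k - (if l \<le> n then ?Q (\<lambda>y. f y * Y l k y) else 0)) / (1 - multiplier \<Phi> l)"
        by (simp only: diff_divide_distrib)
      have "?d l k = multiplier \<Phi> l ^ q * (multiplier \<Phi> l ^ eps star * (fourier Y u l k - fourier Y ?G l k))"
        using Se[OF k] U' k by simp
      also have "\<dots> = multiplier \<Phi> l ^ m * (fourier Y u l k - fourier Y ?G l k)"
        by (simp only: m_def power_add mult.assoc)
      finally show ?thesis unfolding e by simp
    qed
    have ad: "admissible r ?d"
    proof -
      have "admissible r (\<lambda>l k. fourier Y u l k + (- fourier Y S l k))"
        using us S by (intro admissible_add admissible_bounded[of r "fourier Y S" "\<lambda>l k. - fourier Y S l k" 1])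
          (auto simp: sobolev_iff)
      thus ?thesis by simp
    qed
    have bound: "\<bar>u z - S z\<bar> \<le> C * (real n powr (-(r + \<gamma> - 1)) +
        rho \<gamma> n * (real (t n) - real n) powr (-r)) * sobolev_norm Y r f" if z: "z \<in> S2" for z
    proof -
      have "u z - S z = harmonic_series Y ?d z"
      proof (rule continuous_eqI[OF _ _ z])
        show "continuous_on S2 (\<lambda>z. u z - S z)" by (intro continuous_intros cu)
        show "continuous_on S2 (harmonic_series Y ?d)" by (rule continuous_harmonic_series[OF r ad])
        fix l k :: nat assume k: "k \<in> {1..2*l+1}"
        show "fourier Y (\<lambda>z. u z - S z) l k = fourier Y (harmonic_series Y ?d) l k"
          using fourier_diff[OF cu k] fourier_harmonic_series[OF r ad k] by simp
      qed
      moreover have "\<bar>harmonic_series Y ?d z\<bar> \<le> C * (real n powr (-(r + \<gamma> - 1)) +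
        rho \<gamma> n * (real (t n) - real n) powr (-r)) * sobolev_norm Y r f"
        unfolding C_def
      proof (rule damped_error_le[OF r f n t2 \<gamma>(2) less_imp_le[OF A] _ C1(2)[OF n] less_imp_le[OF C1(1)] rho_nonneg z ad])
        fix l k :: nat assume k: "k \<in> {1..2*l+1}"
        show "\<bar>?d l k\<bar> \<le> A * (real l + 1) powr (- \<gamma>) *
            \<bar>fourier Y f l k - (if l \<le> n then ?Q (\<lambda>y. f y * Y l k y) else 0)\<bar>"
          unfolding d[OF k] abs_mult by (rule mult_right_mono[OF damp]) simp
      qed
      ultimately show ?thesis by simp
    qed
    \<comment> \<open>Measurability is what \<open>esssup_I\<close> asks for; the bound itself holds
      at every point of the sphere, without an exceptional null set.\<close>
    have "(\<lambda>z. u z - S z) \<in> borel_measurable surface_measure"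
      by (intro borel_measurable_continuous_sphere continuous_intros cu)
    hence "(\<lambda>z. ereal \<bar>u z - S z\<bar>) \<in> borel_measurable surface_measure" by measurable
    thus "Linf_norm (\<lambda>z. u z - sloan \<Phi> f q U z)
                \<le> ereal (C * (real n powr (-(r + \<gamma> - 1)) +
                              rho \<gamma> n * (real (t n) - real n) powr (-r)) * sobolev_norm Y r f)"
      unfolding Linf_norm_def S_def[symmetric]
    proof (rule esssup_I, intro AE_I2)
      fix z assume "z \<in> space surface_measure"
      hence z: "z \<in> S2" by simp
      show "ereal \<bar>u z - S z\<bar> \<le> ereal (C * (real n powr (-(r + \<gamma> - 1)) +
                              rho \<gamma> n * (real (t n) - real n) powr (-r)) * sobolev_norm Y r f)"
        using bound[OF z] by (simp only: ereal_less_eq(3))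
    qed
  qed
qed

end
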